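(* Let $m\in\mathbb N$ be such that $M_0=m\mathbb N$, and let $R$ be a representation set (complete set of representatives) of $\{\rho\in\widehat{\mathcal T\mathcal F}:\rho|_{\mathcal T^m}=I_{d_\rho}\}/{\sim}$. Write $\operatorname{Ind}=\operatorname{Ind}_{\mathcal T\mathcal F}^{\mathcal G}$. Then the following maps are (well-defined and) bijective, where $\bigsqcup$ denotes the disjoint union: (i) $$\bigsqcup_{\rho\in R}\{k/N: k\in L_{\mathcal S}^*,N\in M_0\}/\mathcal G_\rho\to\operatorname{Ind}\bigl(\{\rho\in\widehat{\mathcal T\mathcal F}:\exists N\in M_0:\rho|_{\mathcal T^N}=I_{d_\rho}\}\bigr),\qquad(\mathcal G_\rho\cdot(k/N),\rho)\mapsto\operatorname{Ind}(\chi_{k/N}\rho);$$ (ii) for every $N\in M_0$, $$\bigsqcup_{\rho\in R}(L_{\mathcal S}^*/N)/\mathcal G_\rho\to\operatorname{Ind}\bigl(\{\rho\in\widehat{\mathcal T\mathcal F}:\rho|_{\mathcal T^N}=I_{d_\rho}\}\bigr),\qquad(\mathcal G_\rho\cdot k,\rho)\mapsto\operatorname{Ind}(\chi_k\rho).$$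
   Context: $\mathbb N=\{1,2,\dots\}$. $E(d)=O(d)\ltimes\mathbb R^d$ is the Euclidean group: elements $(A,b)$ with product $(A_1,b_1)(A_2,b_2)=(A_1A_2,b_1+A_1b_2)$, acting on $\mathbb R^d$ by $(A,b)\cdot x=Ax+b$; write $L(A,b)=A$, $\tau(A,b)=b$. A translation is an element $(I_d,b)$. A $d$-dimensional space group is a discrete subgroup of $E(d)$ containing $d$ translations with linearly independent translation vectors. For $A_1\in O(d_1)$ and $(A_2,b_2)\in E(d_2)$ put $A_1\oplus(A_2,b_2):=\left(\begin{pmatrix}A_1&0\\ 0&A_2\end{pmatrix},\begin{pmatrix}0\\ b_2\end{pmatrix}\right)\in E(d_1+d_2)$. Setting: $d\in\mathbb N$, $d_1,d_2\in\mathbb N_0$ with $d=d_1+d_2$; $\mathcal S$ is a $d_2$-dimensional space group; $\mathcal G$ is a discrete subgroup of $O(d_1)\oplus\mathcal S=\{A\oplus g: A\in O(d_1),g\in\mathcal S\}$ (understood as $O(d)$ if $d_1=d$ and as $\mathcal S$ if $d_1=0$) such that $\pi(\mathcal G)=\mathcal S$, where $\pi(A\oplus g)=g$. $\mathcal F=\ker(\pi|_{\mathcal G})$; $\mathcal T_{\mathcal S}$ is the group of translations of $\mathcal S$. $\mathcal T\subset\mathcal G$ is a fixed subset such that $\pi|_{\mathcal T}:\mathcal T\to\mathcal T_{\mathcal S}$ is bijective ($\mathcal T$ need not be a group). For a subset $X$ of a group, $X^n:=\{x^n:x\in X\}$. $M_0:=\{m\in\mathbb N:\mathcal T^m\text{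 is a normal subgroup of }\mathcal G\}$; an $m\in\mathbb N$ with $M_0=m\mathbb N$ exists and is unique. $\mathcal T\mathcal F=\{tf:t\in\mathcal T,f\in\mathcal F\}=(\pi|_{\mathcal G})^{-1}(\mathcal T_{\mathcal S})$ is a normal subgroup of $\mathcal G$ of finite index. Representations: a representation of a group $\mathcal H$ is a homomorphism $\rho:\mathcal H\to U(d_\rho)$ into a finite-dimensional unitary group; equivalence is unitary equivalence; $\widehat{\mathcal H}$ is the set of equivalence classes of irreducible representations. $\rho|_{\mathcal T^N}=I_{d_\rho}$ means $\rho(t)=I_{d_\rho}$ for all $t\in\mathcal T^N$. $\mathcal G$ acts on $\widehat{\mathcal T\mathcal F}$ by $(g\cdot\rho)(n)=\rho(g^{-1}ng)$. For a subgroup $\mathcal K\le\mathcal H$ of finite index, $\operatorname{Ind}_{\mathcal K}^{\mathcal H}\rho$ is the usual induced (unitary) representation, regarded up to equivalence; for a set $X$ of classes, $\operatorname{Ind}(X)=\{\operatorname{Ind}\rho:\rho\in X\}$. For $k\in\mathbb R^{d_2}$, $\chi_k\in\widehat{\mathcal T\mathcal F}$ is $\chi_k(g)=\exp(2\pi i\langle k,\tau(\pi(g))\rangle)$. On $\widehat{\mathcal T\mathcal F}$ the equivalence relation $\sim$ is: $\rho\sim\rho'$ iff there exist $g\in\mathcal G$ and $k\in\mathbb R^{d_2}$ with $g\cdot\rho=\chi_k\rho'$. For $\rho\in\widehat{\mathcal T\mathcal F}$, $\mathcal G_\rho:=\{(L(\pi(g)),k): g\in\mathcal G,\ k\in\mathbb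 R^{d_2},\ g\cdot\rho=\chi_k\rho\}\subset E(d_2)$, a subgroup of $E(d_2)$. $L_{\mathcal S}:=\tau(\mathcal T_{\mathcal S})$ is a lattice in $\mathbb R^{d_2}$ with dual lattice $L_{\mathcal S}^*=\{x\in\mathbb R^{d_2}:\langle x,y\rangle\in\mathbb Z\ \forall y\in L_{\mathcal S}\}$, and $L_{\mathcal S}^*/N=\{k/N:k\in L_{\mathcal S}^*\}$. For $\rho\in R$ and $N\in M_0$ the set $L_{\mathcal S}^*/N$ is invariant under $\mathcal G_\rho$. For a $\mathcal G_\rho$-invariant $X\subset\mathbb R^{d_2}$, $X/\mathcal G_\rho$ is the set of orbits $\mathcal G_\rho\cdot k$, $k\in X$. *)

theory Defs
  imports
    "HOL-Algebra.Coset"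
    "HOL-Algebra.Group_Action"
    "Jordan_Normal_Form.VS_Connect"
    "Jordan_Normal_Form.Schur_Decomposition"
begin

section \<open>Euclidean groups and space groups\<close>

text \<open>Explicitly dimensioned matrices and vectors are used because the dimensions
  \<open>d\<^sub>1\<close> and \<open>d\<^sub>2\<close> may be \<open>0\<close>.\<close>

type_synonym isom = "real mat \<times> real vec"

definition orthogonal_mats :: "nat \<Rightarrow> real mat set" where
  "orthogonal_mats d = {A \<in> carrier_mat d d. A * A\<^sup>T = 1\<^sub>m d}"

definition Euc :: "nat \<Rightarrow> isom monoid" where
  "Euc d = \<lparr>carrier = orthogonal_mats d \<times> carrier_vec d,
            monoid.mult = (\<lambda>(A\<^sub>1, b\<^sub>1) (A\<^sub>2, b\<^sub>2). (A\<^sub>1 * A\<^sub>2, b\<^sub>1 + A\<^sub>1 *\<^sub>v b\<^sub>2)),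
            one = (1\<^sub>m d, 0\<^sub>v d)\<rparr>"

definition euc_act :: "isom \<Rightarrow> real vec \<Rightarrow> real vec" where
  "euc_act = (\<lambda>(A, b) x. A *\<^sub>v x + b)"

text \<open>Discreteness of a subset of \<open>E(d)\<close> in the subspace topology; the topology of
  \<open>E(d)\<close> is that of entrywise convergence.\<close>

definition discrete_in_Euc :: "nat \<Rightarrow> isom set \<Rightarrow> bool" where
  "discrete_in_Euc d H \<longleftrightarrow>
     (\<forall>(A, b) \<in> H. \<exists>\<epsilon>>0. \<forall>(A', b') \<in> H.
        (\<forall>i<d. \<forall>j<d. \<bar>A' $$ (i, j) - A $$ (i, j)\<bar> < \<epsilon>) \<and> (\<forall>i<d. \<bar>b' $ i - b $ i\<bar> < \<epsilon>)
        \<longrightarrow> (A', b') = (A, b))"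

definition discrete_subgroup :: "nat \<Rightarrow> isom set \<Rightarrow> bool" where
  "discrete_subgroup d H \<longleftrightarrow> subgroup H (Euc d) \<and> discrete_in_Euc d H"

definition trans_subgroup :: "nat \<Rightarrow> isom set \<Rightarrow> isom set" where
  "trans_subgroup d S = {s \<in> S. fst s = 1\<^sub>m d}"

definition space_group :: "nat \<Rightarrow> isom set \<Rightarrow> bool" where
  "space_group d S \<longleftrightarrow> discrete_subgroup d S \<and>
     (\<exists>V. V \<subseteq> snd ` trans_subgroup d S \<and> finite V \<and> card V = d \<and>
          \<not> LinearCombinations.module.lin_dep class_ring (module_vec TYPE(real) d) V)"

definition osum :: "real mat \<Rightarrow> isom \<Rightarrow> isom" where
  "osum A\<^sub>1 = (\<lambda>(A\<^sub>2, b\<^sub>2).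
     (four_block_mat A\<^sub>1 (0\<^sub>m (dim_row A\<^sub>1) (dim_col A\<^sub>2)) (0\<^sub>m (dim_row A\<^sub>2) (dim_col A\<^sub>1)) A\<^sub>2,
      0\<^sub>v (dim_row A\<^sub>1) @\<^sub>v b\<^sub>2))"

definition osum_set :: "nat \<Rightarrow> isom set \<Rightarrow> isom set" where
  "osum_set d\<^sub>1 S = {osum A g |A g. A \<in> orthogonal_mats d\<^sub>1 \<and> g \<in> S}"

text \<open>The projection \<open>\<pi>(A \<oplus> g) = g\<close>, made total by reading off the lower right
  \<open>d\<^sub>2 \<times> d\<^sub>2\<close> block and the last \<open>d\<^sub>2\<close> coordinates.\<close>

definition proj :: "nat \<Rightarrow> nat \<Rightarrow> isom \<Rightarrow> isom" where
  "proj d\<^sub>1 d\<^sub>2 = (\<lambda>(A, b). (mat d\<^sub>2 d\<^sub>2 (\<lambda>(i, j). A $$ (d\<^sub>1 + i, d\<^sub>1 + j)), vec d\<^sub>2 (\<lambda>i. b $ (d\<^sub>1 + i))))"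

lemma proj_osum:
  assumes "A \<in> orthogonal_mats d\<^sub>1" and "g \<in> carrier (Euc d\<^sub>2)"
  shows "proj d\<^sub>1 d\<^sub>2 (osum A g) = g"
  using assms by (cases g) (auto simp: proj_def osum_def orthogonal_mats_def Euc_def)

definition pow_set :: "nat \<Rightarrow> isom set \<Rightarrow> nat \<Rightarrow> isom set" where
  "pow_set d X n = (\<lambda>x. x [^]\<^bsub>Euc d\<^esub> n) ` X"

definition M0 :: "nat \<Rightarrow> isom set \<Rightarrow> isom set \<Rightarrow> nat set" where
  "M0 d G T = {n. 0 < n \<and> pow_set d T n \<lhd> (Euc d\<lparr>carrier := G\<rparr>)}"

definition TF :: "nat \<Rightarrow> nat \<Rightarrow> isom set \<Rightarrow> isom set \<Rightarrow> isom set" where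
  "TF d\<^sub>1 d\<^sub>2 G T =
     T <#>\<^bsub>Euc (d\<^sub>1 + d\<^sub>2)\<^esub> kernel (Euc (d\<^sub>1 + d\<^sub>2)\<lparr>carrier := G\<rparr>) (Euc d\<^sub>2) (proj d\<^sub>1 d\<^sub>2)"

definition dual_lattice :: "nat \<Rightarrow> isom set \<Rightarrow> real vec set" where
  "dual_lattice d S = {x \<in> carrier_vec d. \<forall>y \<in> snd ` trans_subgroup d S. x \<bullet> y \<in> \<int>}"

definition scaled_dual_lattice :: "nat \<Rightarrow> isom set \<Rightarrow> nat \<Rightarrow> real vec set" where
  "scaled_dual_lattice d S N = (\<lambda>k. (1 / real N) \<cdot>\<^sub>v k) ` dual_lattice d S"

section \<open>Finite-dimensional unitary representations\<close>

definition unitary_group :: "nat \<Rightarrow> complex mat monoid" where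
  "unitary_group n = \<lparr>carrier = {U \<in> carrier_mat n n. U * mat_adjoint U = 1\<^sub>m n},
                      monoid.mult = (*), one = 1\<^sub>m n\<rparr>"

definition unitary_rep :: "('g, 'b) monoid_scheme \<Rightarrow> ('g \<Rightarrow> complex mat) \<Rightarrow> bool" where
  "unitary_rep H \<rho> \<longleftrightarrow> (\<exists>n. \<rho> \<in> hom H (unitary_group n))"

definition rep_dim :: "('g, 'b) monoid_scheme \<Rightarrow> ('g \<Rightarrow> complex mat) \<Rightarrow> nat" where
  "rep_dim H \<rho> = dim_row (\<rho> \<one>\<^bsub>H\<^esub>)"

definition irreducible_rep :: "('g, 'b) monoid_scheme \<Rightarrow> ('g \<Rightarrow> complex mat) \<Rightarrow> bool" where
  "irreducible_rep H \<rho> \<longleftrightarrow> unitary_rep H \<rho> \<and> rep_dim H \<rho> > 0 \<and>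
     (\<forall>W. VectorSpace.subspace class_ring W (module_vec TYPE(complex) (rep_dim H \<rho>)) \<and>
          (\<forall>h \<in> carrier H. \<forall>w \<in> W. \<rho> h *\<^sub>v w \<in> W)
          \<longrightarrow> W = {0\<^sub>v (rep_dim H \<rho>)} \<or> W = carrier_vec (rep_dim H \<rho>))"

text \<open>Unitary equivalence of representations. Representations are functions on the whole
  type whose values outside \<^term>\<open>carrier H\<close> are irrelevant; in particular functions
  that agree on \<^term>\<open>carrier H\<close> are equivalent.\<close>

definition rep_rel ::
    "('g, 'b) monoid_scheme \<Rightarrow> (('g \<Rightarrow> complex mat) \<times> ('g \<Rightarrow> complex mat)) set" where
  "rep_rel H = {(\<rho>, \<sigma>). unitary_rep H \<rho> \<and> unitary_rep H \<sigma> \<and>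
     (\<exists>U \<in> carrier (unitary_group (rep_dim H \<rho>)).
        \<forall>h \<in> carrier H. \<sigma> h = U * \<rho> h * mat_adjoint U)}"

definition irreps :: "('g, 'b) monoid_scheme \<Rightarrow> ('g \<Rightarrow> complex mat) set set" where
  "irreps H = {\<rho>. irreducible_rep H \<rho>} // rep_rel H"

text \<open>Operations on representations are lifted to equivalence classes by taking the union of
  the classes of all results, as is usual for quotients.\<close>

definition trivial_on :: "'g set \<Rightarrow> ('g \<Rightarrow> complex mat) set \<Rightarrow> bool" where
  "trivial_on X C \<longleftrightarrow> (\<forall>\<rho> \<in> C. \<forall>x \<in> X. \<rho> x = 1\<^sub>m (dim_row (\<rho> x)))"

definition conj_class ::
    "('g, 'b) monoid_scheme \<Rightarrow> 'g set \<Rightarrow> 'g \<Rightarrow> ('g \<Rightarrow> complex mat) set \<Rightarrow> ('g \<Rightarrow> complex mat) set" where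
  "conj_class H K g C =
     (\<Union>\<rho>\<in>C. rep_rel (H\<lparr>carrier := K\<rparr>) `` {\<lambda>n. \<rho> (inv\<^bsub>H\<^esub> g \<otimes>\<^bsub>H\<^esub> n \<otimes>\<^bsub>H\<^esub> g)})"

definition left_transversal :: "('g, 'b) monoid_scheme \<Rightarrow> 'g set \<Rightarrow> 'g list \<Rightarrow> bool" where
  "left_transversal H K hs \<longleftrightarrow> set hs \<subseteq> carrier H \<and>
     (\<forall>h \<in> carrier H. \<exists>!i. i < length hs \<and> h \<in> hs ! i <#\<^bsub>H\<^esub> K)"

text \<open>The induced representation acts on the direct sum of the copies \<open>h\<^sub>i W\<close> of the
  representation space \<open>W\<close> of \<open>\<rho>\<close>, where the \<open>h\<^sub>i\<close> represent the left cosets of \<open>K\<close>: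
  the \<open>(i, j)\<close> block at \<open>h\<close> is \<open>\<rho> (h\<^sub>i\<^sup>-\<^sup>1 h h\<^sub>j)\<close> if the argument lies in \<open>K\<close>, and \<open>0\<close> otherwise.\<close>

definition ind_rep ::
    "('g, 'b) monoid_scheme \<Rightarrow> 'g set \<Rightarrow> 'g list \<Rightarrow> ('g \<Rightarrow> complex mat) \<Rightarrow> 'g \<Rightarrow> complex mat" where
  "ind_rep H K hs \<rho> h =
     (let n = rep_dim H \<rho>; r = length hs in
      mat (r * n) (r * n) (\<lambda>(p, q).
        let x = inv\<^bsub>H\<^esub> (hs ! (p div n)) \<otimes>\<^bsub>H\<^esub> h \<otimes>\<^bsub>H\<^esub> hs ! (q div n) in
        if x \<in> K then \<rho> x $$ (p mod n, q mod n) else 0))"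

definition Ind ::
    "('g, 'b) monoid_scheme \<Rightarrow> 'g set \<Rightarrow> ('g \<Rightarrow> complex mat) set \<Rightarrow> ('g \<Rightarrow> complex mat) set" where
  "Ind H K C = (\<Union>\<rho>\<in>C. \<Union>hs\<in>{hs. left_transversal H K hs}. rep_rel H `` {ind_rep H K hs \<rho>})"

definition representation_set :: "'a set \<Rightarrow> 'a set \<Rightarrow> ('a \<times> 'a) set \<Rightarrow> bool" where
  "representation_set R X r \<longleftrightarrow> R \<subseteq> X \<and> (\<forall>c \<in> X // Restr r X. \<exists>!x. x \<in> R \<inter> c)"

section \<open>Twisting by characters\<close>

definition chi :: "nat \<Rightarrow> nat \<Rightarrow> real vec \<Rightarrow> isom \<Rightarrow> complex" where
  "chi d\<^sub>1 d\<^sub>2 k g = exp (2 * complex_of_real pi * \<i> * complex_of_real (k \<bullet> snd (proj d\<^sub>1 d\<^sub>2 g)))"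

definition twist ::
    "nat \<Rightarrow> nat \<Rightarrow> isom set \<Rightarrow> real vec \<Rightarrow> (isom \<Rightarrow> complex mat) set \<Rightarrow> (isom \<Rightarrow> complex mat) set" where
  "twist d\<^sub>1 d\<^sub>2 K k C =
     (\<Union>\<rho>\<in>C. rep_rel (Euc (d\<^sub>1 + d\<^sub>2)\<lparr>carrier := K\<rparr>) `` {\<lambda>n. chi d\<^sub>1 d\<^sub>2 k n \<cdot>\<^sub>m \<rho> n})"

definition sim ::
    "nat \<Rightarrow> nat \<Rightarrow> isom set \<Rightarrow> isom set \<Rightarrow> ((isom \<Rightarrow> complex mat) set \<times> (isom \<Rightarrow> complex mat) set) set" where
  "sim d\<^sub>1 d\<^sub>2 G K =
     {(C, C'). C \<in> irreps (Euc (d\<^sub>1 + d\<^sub>2)\<lparr>carrier := K\<rparr>) \<and>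
               C' \<in> irreps (Euc (d\<^sub>1 + d\<^sub>2)\<lparr>carrier := K\<rparr>) \<and>
               (\<exists>g \<in> G. \<exists>k \<in> carrier_vec d\<^sub>2.
                  conj_class (Euc (d\<^sub>1 + d\<^sub>2)) K g C = twist d\<^sub>1 d\<^sub>2 K k C')}"

definition G_rho :: "nat \<Rightarrow> nat \<Rightarrow> isom set \<Rightarrow> isom set \<Rightarrow> (isom \<Rightarrow> complex mat) set \<Rightarrow> isom set" where
  "G_rho d\<^sub>1 d\<^sub>2 G K C =
     {(fst (proj d\<^sub>1 d\<^sub>2 g), k) |g k. g \<in> G \<and> k \<in> carrier_vec d\<^sub>2 \<and>
        conj_class (Euc (d\<^sub>1 + d\<^sub>2)) K g C = twist d\<^sub>1 d\<^sub>2 K k C}"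

abbreviation G_rho_group ::
    "nat \<Rightarrow> nat \<Rightarrow> isom set \<Rightarrow> isom set \<Rightarrow> (isom \<Rightarrow> complex mat) set \<Rightarrow> isom monoid" where
  "G_rho_group d\<^sub>1 d\<^sub>2 G K C \<equiv> Euc d\<^sub>2\<lparr>carrier := G_rho d\<^sub>1 d\<^sub>2 G K C\<rparr>"

text \<open>\<open>\<Squnion>\<^bsub>\<rho>\<in>R\<^esub> X / G\<^sub>\<rho>\<close> as a set of pairs (orbit, \<open>\<rho>\<close>).\<close>

definition orbit_union ::
    "nat \<Rightarrow> nat \<Rightarrow> isom set \<Rightarrow> isom set \<Rightarrow> (isom \<Rightarrow> complex mat) set set \<Rightarrow> real vec set
      \<Rightarrow> (real vec set \<times> (isom \<Rightarrow> complex mat) set) set" where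
  "orbit_union d\<^sub>1 d\<^sub>2 G K R X =
     {(Q, \<rho>). \<rho> \<in> R \<and> Q \<in> orbits (G_rho_group d\<^sub>1 d\<^sub>2 G K \<rho>) X euc_act}"

end

theory Submission
  imports
    Defs
    "Jordan_Normal_Form.DL_Rank"
    "Jordan_Normal_Form.Spectral_Radius"
begin

text \<open>By Schur's lemma and Mackey's argument, for a normal subgroup of finite index the classes
  \<open>Ind \<rho>\<close> and \<open>Ind \<sigma>\<close> of irreducible representations agree iff \<open>\<sigma>\<close> is a conjugate of \<open>\<rho>\<close>.
  Since \<open>g \<cdot> (\<chi>\<^sub>k \<rho>) = \<chi>\<^bsub>L(g)k\<^esub> (g \<cdot> \<rho>)\<close>, this says that \<open>Ind (\<chi>\<^sub>k \<rho>) = Ind (\<chi>\<^bsub>k'\<^esub> \<rho>')\<close> iff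
  \<open>g \<cdot> \<rho> = \<chi>\<^sub>l \<rho>'\<close> with \<open>k' = L(g)k + l\<close> for some \<open>g\<close> and \<open>l\<close>. For \<open>\<rho> = \<rho>'\<close> the right-hand side
  describes the orbits of \<open>\<G>\<^sub>\<rho>\<close>, and in general it forces \<open>\<rho> \<sim> \<rho>'\<close>. For surjectivity,
  \<open>\<T>\<^sup>m\<close> is central in \<open>\<T>\<F>\<close>, so an irreducible \<open>\<sigma>\<close> acts on it by scalars. These form a character
  of the lattice, which is the restriction of some \<open>\<chi>\<^sub>k\<close>, and \<open>\<chi>\<^bsub>-k\<^esub> \<sigma>\<close> is trivial on \<open>\<T>\<^sup>m\<close>.\<close>

text \<open>As \<open>T\<close> need not be a group, \<G> contains no distinguished copy of the
  lattice. For N in \<open>M0\<close>, however, \<open>T\<close>^N is a group on which \<pi> is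
  injective, so it is a copy of N times the lattice; characters are compared and triviality is
  tested there. An element t^N has translation vector N tau(t), so \<chi>_k is trivial on
  \<open>T\<close>^N exactly for k in L*/N. Surjectivity at level N needs more than untwisting,
  because the k that untwists at level m is an arbitrary vector. Once a conjugate of \<sigma> is
  equivalent to \<chi>_l \<rho> with \<rho> in R, both \<sigma> and \<rho> are trivial on
  \<open>T\<close>^N (m divides N, and \<open>T\<close>^N is normal). Hence \<chi>_l is trivial
  there too, and l lies in L*/N. Each orbit of \<G>_\<rho> is identified with a fibre of k -> Ind
  (\<chi>_k \<rho>), so well-definedness and injectivity come together. The finite index of
  \<open>T\<close> \<F> comes from the finiteness of the point group: its elements are isometries
  that map d independent lattice vectors to lattice vectors of the same length.\<close>

section \<open>Unitary matrices\<close>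

lemma mat_adjoint_dim [simp]:
  "dim_row (mat_adjoint A) = dim_col A" "dim_col (mat_adjoint A) = dim_row A"
  by (auto simp: mat_adjoint_def)

lemma mat_adjoint_carrier [simp]: "A \<in> carrier_mat n m \<Longrightarrow> mat_adjoint A \<in> carrier_mat m n"
  by (rule carrier_matI) auto

lemma mat_adjoint_index [simp]:
  "i < dim_col A \<Longrightarrow> j < dim_row A \<Longrightarrow> mat_adjoint A $$ (i, j) = conjugate (A $$ (j, i))"
  by (auto simp: mat_adjoint_def mat_of_rows_def)

lemma mat_adjoint_mult:
  fixes A B :: "complex mat"
  assumes "A \<in> carrier_mat n m" "B \<in> carrier_mat m k"
  shows "mat_adjoint (A * B) = mat_adjoint B * mat_adjoint A"
  using assms by (intro eq_matI) (auto simp: scalar_prod_def mult.commute intro!: sum.cong)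

lemma mat_adjoint_adjoint [simp]: "mat_adjoint (mat_adjoint (A :: complex mat)) = A"
  by (rule eq_matI) auto

lemma mat_adjoint_one [simp]: "mat_adjoint (1\<^sub>m n :: complex mat) = 1\<^sub>m n"
  by (rule eq_matI) auto

lemma mat_adjoint_zero [simp]: "mat_adjoint (0\<^sub>m n m :: complex mat) = 0\<^sub>m m n"
  by (rule eq_matI) auto

lemma mat_adjoint_smult: "mat_adjoint (c \<cdot>\<^sub>m (A :: complex mat)) = cnj c \<cdot>\<^sub>m mat_adjoint A"
  by (rule eq_matI) auto

lemma unitary_groupD:
  assumes "U \<in> carrier (unitary_group n)"
  shows "U \<in> carrier_mat n n" "U * mat_adjoint U = 1\<^sub>m n" "mat_adjoint U * U = 1\<^sub>m n"
proof -
  show *: "U \<in> carrier_mat n n" "U * mat_adjoint U = 1\<^sub>m n"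
    using assms by (auto simp: unitary_group_def)
  show "mat_adjoint U * U = 1\<^sub>m n"
    using mat_mult_left_right_inverse[OF *(1) mat_adjoint_carrier[OF *(1)] *(2)] .
qed

lemma unitary_groupI:
  "U \<in> carrier_mat n n \<Longrightarrow> U * mat_adjoint U = 1\<^sub>m n \<Longrightarrow> U \<in> carrier (unitary_group n)"
  by (auto simp: unitary_group_def)

lemma unitary_group_simps [simp]:
  "x \<otimes>\<^bsub>unitary_group n\<^esub> y = x * y" "\<one>\<^bsub>unitary_group n\<^esub> = 1\<^sub>m n"
  by (auto simp: unitary_group_def)

lemma unitary_group_adjoint:
  "U \<in> carrier (unitary_group n) \<Longrightarrow> mat_adjoint U \<in> carrier (unitary_group n)"
  using unitary_groupD[of U n] by (auto intro!: unitary_groupI)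

lemma group_unitary_group: "group (unitary_group n)"
proof (rule groupI)
  fix x y assume x: "x \<in> carrier (unitary_group n)" and y: "y \<in> carrier (unitary_group n)"
  note X = unitary_groupD[OF x] and Y = unitary_groupD[OF y]
  have "(x * y) * mat_adjoint (x * y) = (x * y) * (mat_adjoint y * mat_adjoint x)"
    using X(1) Y(1) by (simp add: mat_adjoint_mult)
  also have "\<dots> = x * ((y * mat_adjoint y) * mat_adjoint x)"
    using X(1) Y(1) by (simp add: assoc_mult_mat[of _ n n _ n _ n] mult_carrier_mat[of _ n n _ n])
  also have "\<dots> = 1\<^sub>m n" using X Y by simp
  finally show "x \<otimes>\<^bsub>unitary_group n\<^esub> y \<in> carrier (unitary_group n)"
    using X(1) Y(1) by (auto intro!: unitary_groupI)
next
  fix x assume x: "x \<in> carrier (unitary_group n)"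
  show "\<exists>y\<in>carrier (unitary_group n). y \<otimes>\<^bsub>unitary_group n\<^esub> x = \<one>\<^bsub>unitary_group n\<^esub>"
    using unitary_group_adjoint[OF x] unitary_groupD[OF x] by auto
next
  fix x y z assume "x \<in> carrier (unitary_group n)" "y \<in> carrier (unitary_group n)"
    "z \<in> carrier (unitary_group n)"
  then show "x \<otimes>\<^bsub>unitary_group n\<^esub> y \<otimes>\<^bsub>unitary_group n\<^esub> z =
      x \<otimes>\<^bsub>unitary_group n\<^esub> (y \<otimes>\<^bsub>unitary_group n\<^esub> z)"
    by (auto dest!: unitary_groupD(1) simp: assoc_mult_mat[of _ n n _ n _ n])
qed (auto simp: unitary_group_def)

lemma inv_unitary_group:
  assumes "U \<in> carrier (unitary_group n)"
  shows "inv\<^bsub>unitary_group n\<^esub> U = mat_adjoint U"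
  using group.inv_equality[OF group_unitary_group, of n "mat_adjoint U" U]
    unitary_groupD[OF assms] unitary_group_adjoint[OF assms] assms by auto

section \<open>Unitary representations and their equivalence\<close>

text \<open>The dimension is a parameter here, while \<open>unitary_rep\<close> hides it behind an
  existential quantifier. Two representations can thus be required to act on the same space.\<close>

locale unitary_representation = group H for H (structure) +
  fixes n :: nat and \<rho> :: "'a \<Rightarrow> complex mat"
  assumes rep_hom: "\<rho> \<in> hom H (unitary_group n)"
begin

lemma closed: "x \<in> carrier H \<Longrightarrow> \<rho> x \<in> carrier (unitary_group n)"
  using rep_hom by (auto simp: hom_def)

lemma carrier [simp]: "x \<in> carrier H \<Longrightarrow> \<rho> x \<in> carrier_mat n n"
  using closed unitary_groupD by blast

lemma dims [simp]: "x \<in> carrier H \<Longrightarrow> dim_row (\<rho> x) = n" "x \<in> carrier H \<Longrightarrow> dim_col (\<rho> x) = n"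
  using carrier by blast+

lemma mult: "x \<in> carrier H \<Longrightarrow> y \<in> carrier H \<Longrightarrow> \<rho> (x \<otimes> y) = \<rho> x * \<rho> y"
  using rep_hom by (auto simp: hom_def)

sublocale hom: group_hom H "unitary_group n" \<rho>
  by (intro group_hom.intro group_hom_axioms.intro is_group group_unitary_group rep_hom)

lemma one: "\<rho> \<one> = 1\<^sub>m n"
  using hom.hom_one by simp

lemma inverse: "x \<in> carrier H \<Longrightarrow> \<rho> (inv x) = mat_adjoint (\<rho> x)"
  using hom.hom_inv inv_unitary_group closed by simp

lemma rep_dim: "rep_dim H \<rho> = n"
  by (simp add: rep_dim_def one)

lemma unitary_rep: "unitary_rep H \<rho>"
  unfolding unitary_rep_def using rep_hom by blast

end

lemma (in group) unitary_repE:
  assumes "unitary_rep G \<rho>"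
  shows "unitary_representation G (rep_dim G \<rho>) \<rho>"
proof -
  from assms obtain n where n: "\<rho> \<in> hom G (unitary_group n)" by (auto simp: unitary_rep_def)
  interpret unitary_representation G n \<rho> by unfold_locales fact
  show ?thesis unfolding rep_dim by unfold_locales
qed

text \<open>The intertwining form of equivalence: without the adjoint such equations compose by
  associativity alone, and it is the form that Schur's lemma and the block matrices deliver.\<close>

lemma rep_relI:
  assumes "unitary_representation H n \<rho>" "unitary_representation H n \<sigma>"
    and U: "U \<in> carrier (unitary_group n)"
    and eq: "\<And>h. h \<in> carrier H \<Longrightarrow> \<sigma> h * U = U * \<rho> h"
  shows "(\<rho>, \<sigma>) \<in> rep_rel H"
proof -
  interpret r: unitary_representation H n \<rho> by fact
  interpret s: unitary_representation H n \<sigma> by fact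
  note U' = unitary_groupD[OF U]
  have "\<sigma> h = U * \<rho> h * mat_adjoint U" if h: "h \<in> carrier H" for h
  proof -
    have "U * \<rho> h * mat_adjoint U = \<sigma> h * U * mat_adjoint U" using eq[OF h] by simp
    also have "\<dots> = \<sigma> h * (U * mat_adjoint U)"
      using U'(1) s.carrier[OF h] by (intro assoc_mult_mat) auto
    also have "\<dots> = \<sigma> h" using U' s.carrier[OF h] by simp
    finally show ?thesis by simp
  qed
  then show ?thesis using U r.unitary_rep s.unitary_rep
    by (auto simp: rep_rel_def r.rep_dim)
qed

lemma (in group) rep_relE:
  assumes "(\<rho>, \<sigma>) \<in> rep_rel G"
  obtains n U where "unitary_representation G n \<rho>" "unitary_representation G n \<sigma>"
    "U \<in> carrier (unitary_group n)" "\<And>h. h \<in> carrier G \<Longrightarrow> \<sigma> h * U = U * \<rho> h"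
    "\<And>h. h \<in> carrier G \<Longrightarrow> \<sigma> h = U * \<rho> h * mat_adjoint U"
proof -
  define n where "n = rep_dim G \<rho>"
  from assms obtain U where U: "U \<in> carrier (unitary_group n)"
    and eq: "\<And>h. h \<in> carrier G \<Longrightarrow> \<sigma> h = U * \<rho> h * mat_adjoint U"
    and u: "unitary_rep G \<rho>" "unitary_rep G \<sigma>"
    by (auto simp: rep_rel_def n_def)
  note U' = unitary_groupD[OF U]
  interpret r: unitary_representation G n \<rho> using unitary_repE[OF u(1)] by (simp add: n_def)
  interpret s: unitary_representation G "rep_dim G \<sigma>" \<sigma> using unitary_repE[OF u(2)] .
  \<comment> \<open>At the unit the relation gives U times its adjoint, which is the identity. So
    equivalent representations have the same dimension, although \<open>rep_rel\<close> mentions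
    only that of \<rho>.\<close>
  have "\<sigma> \<one> = 1\<^sub>m n" using eq[of \<one>] U' by (simp add: r.one)
  then have n: "rep_dim G \<sigma> = n" unfolding rep_dim_def by (metis index_one_mat(2))
  have "\<sigma> h * U = U * \<rho> h" if h: "h \<in> carrier G" for h
  proof -
    have "\<sigma> h * U = U * \<rho> h * mat_adjoint U * U" using eq[OF h] by simp
    also have "\<dots> = U * \<rho> h * (mat_adjoint U * U)"
      using U'(1) r.carrier[OF h] by (intro assoc_mult_mat[of _ n n _ n _ n]) auto
    also have "\<dots> = U * \<rho> h" using U' r.carrier[OF h] by simp
    finally show ?thesis .
  qed
  with that[of n U] eq U r.unitary_representation_axioms s.unitary_representation_axioms n
  show ?thesis by auto
qed

lemma (in group) rep_rel_refl: "unitary_rep G \<rho> \<Longrightarrow> (\<rho>, \<rho>) \<in> rep_rel G"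
proof -
  assume "unitary_rep G \<rho>"
  then interpret r: unitary_representation G "rep_dim G \<rho>" \<rho> by (rule unitary_repE)
  show ?thesis
    by (rule rep_relI[of _ "rep_dim G \<rho>" _ _ "1\<^sub>m (rep_dim G \<rho>)"])
       (auto simp: unitary_group_def r.unitary_representation_axioms intro!: left_mult_one_mat right_mult_one_mat)
qed

lemma (in group) rep_rel_sym:
  assumes "(\<rho>, \<sigma>) \<in> rep_rel G" shows "(\<sigma>, \<rho>) \<in> rep_rel G"
proof -
  from assms obtain n U where r: "unitary_representation G n \<rho>" and s: "unitary_representation G n \<sigma>"
    and U: "U \<in> carrier (unitary_group n)" and eq: "\<And>h. h \<in> carrier G \<Longrightarrow> \<sigma> h * U = U * \<rho> h"
    by (rule rep_relE) blast
  interpret r: unitary_representation G n \<rho> by (rule r)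
  interpret s: unitary_representation G n \<sigma> by (rule s)
  note U' = unitary_groupD[OF U]
  show ?thesis
  proof (rule rep_relI[OF s r unitary_group_adjoint[OF U]])
    fix h assume h: "h \<in> carrier G"
    note c = U'(1) mat_adjoint_carrier[OF U'(1)] r.carrier[OF h] s.carrier[OF h]
    have "\<rho> h * mat_adjoint U = (mat_adjoint U * U) * \<rho> h * mat_adjoint U" using U' c by simp
    also have "\<dots> = mat_adjoint U * (U * \<rho> h) * mat_adjoint U"
      using c by (simp add: assoc_mult_mat[of _ n n _ n _ n])
    also have "\<dots> = mat_adjoint U * (\<sigma> h * U) * mat_adjoint U" using eq[OF h] by simp
    also have "\<dots> = mat_adjoint U * (\<sigma> h * (U * mat_adjoint U))"
      using c by (simp add: assoc_mult_mat[of _ n n _ n _ n] mult_carrier_mat[of _ n n _ n])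
    finally show "\<rho> h * mat_adjoint U = mat_adjoint U * \<sigma> h" using U' c by simp
  qed
qed

lemma (in group) rep_rel_trans:
  assumes "(\<rho>, \<sigma>) \<in> rep_rel G" "(\<sigma>, \<tau>) \<in> rep_rel G" shows "(\<rho>, \<tau>) \<in> rep_rel G"
proof -
  from assms(1) obtain n U where r: "unitary_representation G n \<rho>" and s: "unitary_representation G n \<sigma>"
    and U: "U \<in> carrier (unitary_group n)" and eq: "\<And>h. h \<in> carrier G \<Longrightarrow> \<sigma> h * U = U * \<rho> h"
    by (rule rep_relE) blast
  from assms(2) obtain n' V where s': "unitary_representation G n' \<sigma>" and t: "unitary_representation G n' \<tau>"
    and V: "V \<in> carrier (unitary_group n')" and eq': "\<And>h. h \<in> carrier G \<Longrightarrow> \<tau> h * V = V * \<sigma> h"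
    by (rule rep_relE) blast
  have n: "n' = n" using unitary_representation.rep_dim[OF s] unitary_representation.rep_dim[OF s'] by simp
  interpret r: unitary_representation G n \<rho> by (rule r)
  interpret s: unitary_representation G n \<sigma> by (rule s)
  interpret t: unitary_representation G n \<tau> using t n by simp
  note U' = unitary_groupD[OF U] and V' = unitary_groupD[OF V[unfolded n]]
  show ?thesis
  proof (rule rep_relI[OF r t[unfolded n]])
    show "V * U \<in> carrier (unitary_group n)" 
      using monoid.m_closed[OF group.is_monoid[OF group_unitary_group] V[unfolded n] U] by simp
    fix h assume h: "h \<in> carrier G"
    note c = U'(1) V'(1) r.carrier[OF h] s.carrier[OF h] t.carrier[OF h]
    have "\<tau> h * (V * U) = (\<tau> h * V) * U" using c by simp
    also have "\<dots> = V * (\<sigma> h * U)" using c eq'[OF h] by simp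
    also have "\<dots> = V * U * \<rho> h" using c eq[OF h] by simp
    finally show "\<tau> h * (V * U) = V * U * \<rho> h" .
  qed
qed

lemma (in group) equiv_rep_rel: "equiv {\<rho>. unitary_rep G \<rho>} (rep_rel G)"
proof (rule equivI)
  show "rep_rel G \<subseteq> {\<rho>. unitary_rep G \<rho>} \<times> {\<rho>. unitary_rep G \<rho>}"
    by (auto simp: rep_rel_def)
  show "refl_on {\<rho>. unitary_rep G \<rho>} (rep_rel G)" by (auto intro!: refl_onI rep_rel_refl)
  show "sym (rep_rel G)" by (auto intro!: symI rep_rel_sym)
  show "trans (rep_rel G)" by (auto intro!: transI intro: rep_rel_trans)
qed

lemma (in group) rep_rel_class_eq_iff:
  assumes "unitary_rep G \<rho>"
  shows "rep_rel G `` {\<rho>} = rep_rel G `` {\<sigma>} \<longleftrightarrow> (\<rho>, \<sigma>) \<in> rep_rel G"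
proof
  assume "rep_rel G `` {\<rho>} = rep_rel G `` {\<sigma>}"
  then show "(\<rho>, \<sigma>) \<in> rep_rel G" using rep_rel_refl[OF assms] rep_rel_sym by blast
next
  assume "(\<rho>, \<sigma>) \<in> rep_rel G"
  then show "rep_rel G `` {\<rho>} = rep_rel G `` {\<sigma>}" by (rule equiv_class_eq[OF equiv_rep_rel])
qed

text \<open>Operations on classes are defined as unions over all members. When the resulting class
  does not depend on the member, the union collapses to the value at one representative.\<close>

lemma (in group) rep_rel_Union_class:
  assumes "unitary_rep G \<rho>" and "\<And>\<sigma>. (\<rho>, \<sigma>) \<in> rep_rel G \<Longrightarrow> f \<sigma> = f \<rho>"
  shows "(\<Union>\<sigma>\<in>rep_rel G `` {\<rho>}. f \<sigma>) = f \<rho>"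
  using assms rep_rel_refl by blast

text \<open>The identity matrix intertwines them. Identities between conjugates and twists hold only
  pointwise on the carrier, and this turns them into equalities of classes.\<close>

lemma (in group) rep_rel_cong:
  assumes "unitary_rep G \<rho>" and "\<And>h. h \<in> carrier G \<Longrightarrow> \<sigma> h = \<rho> h"
  shows "(\<rho>, \<sigma>) \<in> rep_rel G"
proof -
  interpret r: unitary_representation G "rep_dim G \<rho>" \<rho> using assms(1) by (rule unitary_repE)
  have "unitary_representation G (rep_dim G \<rho>) \<sigma>"
    using r.rep_hom assms(2) by unfold_locales (auto simp: hom_def)
  then show ?thesis
    by (intro rep_relI[of _ "rep_dim G \<rho>" _ _ "1\<^sub>m (rep_dim G \<rho>)"])
       (auto simp: unitary_group_def r.unitary_representation_axioms assms(2)
         intro!: left_mult_one_mat right_mult_one_mat)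
qed

section \<open>Schur's lemma\<close>

lemma subspace_vecI:
  fixes W :: "'a :: field vec set"
  assumes "W \<subseteq> carrier_vec n" "0\<^sub>v n \<in> W" "\<And>v w. v \<in> W \<Longrightarrow> w \<in> W \<Longrightarrow> v + w \<in> W"
    "\<And>c v. v \<in> W \<Longrightarrow> c \<cdot>\<^sub>v v \<in> W"
  shows "VectorSpace.subspace class_ring W (module_vec TYPE('a) n)"
proof -
  interpret vec_space "TYPE('a)" n .
  show ?thesis
    unfolding VectorSpace.subspace_def LinearCombinations.submodule_def
    using assms vectorspace_axioms module_axioms
    by (auto simp: module_vec_def)
qed

lemma irreducible_rep_dim_pos: "irreducible_rep H \<rho> \<Longrightarrow> 0 < rep_dim H \<rho>"
  by (simp add: irreducible_rep_def)

lemma irreducible_rep_unitary: "irreducible_rep H \<rho> \<Longrightarrow> unitary_rep H \<rho>"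
  by (simp add: irreducible_rep_def)

text \<open>Irreducibility depends only on which subspaces are invariant. Closure under scalars is
  made available for twists, whose matrices are scalar multiples of the original ones.\<close>

lemma irreducible_rep_transfer:
  assumes "irreducible_rep H \<rho>" "unitary_rep H \<sigma>" "rep_dim H \<sigma> = rep_dim H \<rho>"
    and "\<And>W h. W \<subseteq> carrier_vec (rep_dim H \<rho>) \<Longrightarrow>
          (\<And>c v. v \<in> W \<Longrightarrow> c \<cdot>\<^sub>v v \<in> W) \<Longrightarrow>
          \<forall>h\<in>carrier H. \<forall>w\<in>W. \<sigma> h *\<^sub>v w \<in> W \<Longrightarrow> h \<in> carrier H \<Longrightarrow> \<forall>w\<in>W. \<rho> h *\<^sub>v w \<in> W"
  shows "irreducible_rep H \<sigma>"
  unfolding irreducible_rep_def assms(3)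
proof (intro conjI allI impI)
  fix W assume W: "VectorSpace.subspace class_ring W (module_vec TYPE(complex) (rep_dim H \<rho>)) \<and>
    (\<forall>h\<in>carrier H. \<forall>w\<in>W. \<sigma> h *\<^sub>v w \<in> W)"
  then have "W \<subseteq> carrier_vec (rep_dim H \<rho>)" "\<And>c v. v \<in> W \<Longrightarrow> c \<cdot>\<^sub>v v \<in> W"
    by (auto simp: VectorSpace.subspace_def LinearCombinations.submodule_def module_vec_def)
  then have "\<forall>h\<in>carrier H. \<forall>w\<in>W. \<rho> h *\<^sub>v w \<in> W" using assms(4)[of W] W by blast
  then show "W = {0\<^sub>v (rep_dim H \<rho>)} \<or> W = carrier_vec (rep_dim H \<rho>)"
    using assms(1) W by (auto simp: irreducible_rep_def)
qed (use assms in \<open>auto simp: irreducible_rep_def\<close>)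

text \<open>An eigenspace of \<open>P\<close> is invariant under \<rho> and nonzero, hence the whole
  space. An eigenvalue exists because the field is complex and n is positive.\<close>

lemma (in unitary_representation) schur_scalar:
  assumes irr: "irreducible_rep H \<rho>" and P: "P \<in> carrier_mat n n"
    and comm: "\<And>h. h \<in> carrier H \<Longrightarrow> P * \<rho> h = \<rho> h * P"
  obtains c where "P = c \<cdot>\<^sub>m 1\<^sub>m n"
proof -
  have n: "n > 0" using irreducible_rep_dim_pos[OF irr] rep_dim by simp
  from spectrum_non_empty[OF P n] obtain c v where v: "eigenvector P v c"
    by (auto simp: spectrum_def eigenvalue_def)
  define W where "W = {w \<in> carrier_vec n. P *\<^sub>v w = c \<cdot>\<^sub>v w}"
  have "VectorSpace.subspace class_ring W (module_vec TYPE(complex) n)"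
  proof (rule subspace_vecI)
    show "0\<^sub>v n \<in> W" using P by (auto simp: W_def)
    fix v w assume "v \<in> W" "w \<in> W"
    then show "v + w \<in> W"
      using P by (auto simp: W_def mult_add_distrib_mat_vec[OF P] smult_add_distrib_vec[of _ n])
  next
    fix a v assume "v \<in> W"
    then show "a \<cdot>\<^sub>v v \<in> W"
      using P by (auto simp: W_def mult_mat_vec[OF P] smult_smult_assoc mult.commute)
  qed (auto simp: W_def)
  moreover have "\<rho> h *\<^sub>v w \<in> W" if h: "h \<in> carrier H" and w: "w \<in> W" for h w
  proof -
    have wc: "w \<in> carrier_vec n" and Pw: "P *\<^sub>v w = c \<cdot>\<^sub>v w" using w by (auto simp: W_def)
    have "P *\<^sub>v (\<rho> h *\<^sub>v w) = (P * \<rho> h) *\<^sub>v w"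
      using P carrier[OF h] wc by (intro assoc_mult_mat_vec[symmetric])
    also have "\<dots> = \<rho> h *\<^sub>v (P *\<^sub>v w)"
      unfolding comm[OF h] using P carrier[OF h] wc by (intro assoc_mult_mat_vec)
    also have "\<dots> = c \<cdot>\<^sub>v (\<rho> h *\<^sub>v w)"
      unfolding Pw using carrier[OF h] wc by (intro mult_mat_vec)
    finally show ?thesis using carrier[OF h] wc by (auto simp: W_def intro!: mult_mat_vec_carrier)
  qed
  ultimately have "W = {0\<^sub>v n} \<or> W = carrier_vec n"
    using irr by (auto simp: irreducible_rep_def rep_dim)
  moreover have "v \<in> W" "v \<noteq> 0\<^sub>v n" using v P by (auto simp: eigenvector_def W_def)
  ultimately have W: "W = carrier_vec n" by blast
  have "P = c \<cdot>\<^sub>m 1\<^sub>m n"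
  proof (rule eq_matI)
    fix i j assume "i < dim_row (c \<cdot>\<^sub>m 1\<^sub>m n :: complex mat)" "j < dim_col (c \<cdot>\<^sub>m 1\<^sub>m n :: complex mat)"
    then have ij: "i < n" "j < n" by auto
    have "unit_vec n j \<in> W" using W by simp
    then have "(P *\<^sub>v unit_vec n j) $ i = (c \<cdot>\<^sub>v unit_vec n j) $ i" by (simp add: W_def)
    then show "P $$ (i, j) = (c \<cdot>\<^sub>m 1\<^sub>m n) $$ (i, j)"
      using ij P by simp
  qed (use P in auto)
  then show thesis by (rule that)
qed

text \<open>If \<open>B\<close> intertwines \<open>\<rho>\<close> and \<open>\<sigma>\<close>, then \<open>B\<^sup>* B\<close> commutes with \<open>\<rho>\<close>, so it is a scalar
  and a multiple of \<open>B\<close> is unitary.\<close>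

lemma schur_equivalent:
  assumes r: "unitary_representation H n \<rho>" and s: "unitary_representation H n \<sigma>"
    and irr: "irreducible_rep H \<rho>"
    and B: "B \<in> carrier_mat n n" and B0: "B \<noteq> 0\<^sub>m n n"
    and eq: "\<And>h. h \<in> carrier H \<Longrightarrow> \<sigma> h * B = B * \<rho> h"
  shows "(\<rho>, \<sigma>) \<in> rep_rel H"
proof -
  interpret r: unitary_representation H n \<rho> by (rule r)
  interpret s: unitary_representation H n \<sigma> by (rule s)
  let ?B' = "mat_adjoint B"
  have B': "?B' \<in> carrier_mat n n" using B by simp
  have eq': "?B' * \<sigma> h = \<rho> h * ?B'" if h: "h \<in> carrier H" for h
  proof -
    \<comment> \<open>The adjoint of the relation at the inverse of h reverses the order of the
      factors, and the values at the inverse are themselves adjoints.\<close>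
    have "mat_adjoint (\<sigma> (inv\<^bsub>H\<^esub> h) * B) = mat_adjoint (B * \<rho> (inv\<^bsub>H\<^esub> h))"
      using eq[of "inv\<^bsub>H\<^esub> h"] h by simp
    then show ?thesis
      using B B' h r.carrier[OF h] s.carrier[OF h] r.inverse[OF h] s.inverse[OF h]
      by (simp add: mat_adjoint_mult[of _ n n _ n])
  qed
  have "?B' * B * \<rho> h = \<rho> h * (?B' * B)" if h: "h \<in> carrier H" for h
  proof -
    note c = B B' r.carrier[OF h] s.carrier[OF h]
    have "?B' * B * \<rho> h = ?B' * (\<sigma> h * B)" 
      using c by (simp add: eq[OF h] assoc_mult_mat[of _ n n _ n _ n])
    also have "\<dots> = ?B' * \<sigma> h * B" using c by (simp add: assoc_mult_mat[of _ n n _ n _ n])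
    also have "\<dots> = \<rho> h * ?B' * B" using eq'[OF h] by simp
    also have "\<dots> = \<rho> h * (?B' * B)" using c by (simp add: assoc_mult_mat[of _ n n _ n _ n])
    finally show ?thesis .
  qed
  then obtain c where c: "?B' * B = c \<cdot>\<^sub>m 1\<^sub>m n"
    using r.schur_scalar[OF irr, of "?B' * B"] B B' by auto
  \<comment> \<open>The diagonal of the scalar matrix holds the squared column norms of
    \<open>B\<close>. So c is real, and it is positive because some column has a nonzero
    entry.\<close>
  have diag: "(\<Sum>i<n. complex_of_real ((cmod (B $$ (i, j)))\<^sup>2)) = c" if j: "j < n" for j
  proof -
    have "c = (?B' * B) $$ (j, j)" using j c by simp
    also have "\<dots> = (\<Sum>i<n. cnj (B $$ (i, j)) * B $$ (i, j))"
      using B j by (simp add: scalar_prod_def lessThan_atLeast0)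
    also have "\<dots> = (\<Sum>i<n. complex_of_real ((cmod (B $$ (i, j)))\<^sup>2))"
      by (intro sum.cong refl) (simp add: complex_norm_square mult.commute del: of_real_power)
    finally show ?thesis by simp
  qed
  obtain i j where ij: "i < n" "j < n" "B $$ (i, j) \<noteq> 0"
    using B B0 by (metis carrier_matD eq_matI index_zero_mat)
  define a where "a = (\<Sum>i<n. (cmod (B $$ (i, j)))\<^sup>2)"
  have ca: "c = complex_of_real a" using diag[OF ij(2)] by (simp add: a_def)
  have "a > 0" unfolding a_def using ij by (intro sum_pos2[of _ i]) auto
  \<comment> \<open>Scaling \<open>B\<close> by b multiplies the scalar c by the squared modulus of
    b, which is 1 / c.\<close>
  define b where "b = complex_of_real (1 / sqrt a)"
  have b: "cnj b * b * c = 1"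
  proof -
    have "cnj b * b * c = complex_of_real (1 / sqrt a * (1 / sqrt a) * a)"
      by (simp only: b_def ca complex_cnj_complex_of_real of_real_mult)
    also have "1 / sqrt a * (1 / sqrt a) * a = 1" using \<open>a > 0\<close> by (simp add: field_simps)
    finally show ?thesis by simp
  qed
  define U where "U = b \<cdot>\<^sub>m B"
  have U: "U \<in> carrier_mat n n" using B by (simp add: U_def)
  have "mat_adjoint U * U = b \<cdot>\<^sub>m (cnj b \<cdot>\<^sub>m (?B' * B))"
    using B B' by (simp add: U_def mat_adjoint_smult mult_smult_assoc_mat[of _ n n _ n]
        mult_smult_distrib[of _ n n _ n])
  also have "\<dots> = 1\<^sub>m n"
    unfolding c by (rule eq_matI) (use b in \<open>auto simp: mult_ac\<close>)
  finally have "U * mat_adjoint U = 1\<^sub>m n"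
    using mat_mult_left_right_inverse[OF mat_adjoint_carrier[OF U] U] by simp
  then have "U \<in> carrier (unitary_group n)" by (rule unitary_groupI[OF U])
  then show ?thesis
  proof (rule rep_relI[OF r s])
    fix h assume h: "h \<in> carrier H"
    show "\<sigma> h * U = U * \<rho> h"
      using eq[OF h] B r.carrier[OF h] s.carrier[OF h]
      by (simp add: U_def mult_smult_assoc_mat[of _ n n _ n] mult_smult_distrib[of _ n n _ n])
  qed
qed

section \<open>Block matrices\<close>

text \<open>Same \<open>div\<close> and \<open>mod\<close> indexing as in \<open>ind_rep\<close>, so
  that induced representations are block matrices on the nose.\<close>

definition block_mat :: "nat \<Rightarrow> nat \<Rightarrow> (nat \<Rightarrow> nat \<Rightarrow> 'a mat) \<Rightarrow> 'a mat" where
  "block_mat n r F =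
     mat (r * n) (r * n) (\<lambda>(p, q). F (p div n) (q div n) $$ (p mod n, q mod n))"

lemma block_index_less: "i < r \<Longrightarrow> a < n \<Longrightarrow> i * n + a < r * (n :: nat)"
  using mult_le_mono1[of "Suc i" r n] by simp

lemma div_mod_less:
  assumes "p < r * (n :: nat)" shows "p div n < r" "p mod n < n"
proof -
  have "n > 0" using assms by (cases n) auto
  then show "p div n < r" "p mod n < n" using assms by (simp_all add: less_mult_imp_div_less)
qed

text \<open>Regroups the inner sum of a matrix product into a sum of products of blocks.\<close>

lemma sum_div_mod:
  "(\<Sum>q<r * n. f (q div n) (q mod n)) = (\<Sum>i<r. \<Sum>a<n. f i (a :: nat) :: 'a :: comm_monoid_add)"
proof (induction r)
  case (Suc r)
  have "(\<Sum>q<Suc r * n. f (q div n) (q mod n)) =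
      (\<Sum>q<r * n. f (q div n) (q mod n)) + (\<Sum>q=r * n..<r * n + n. f (q div n) (q mod n))"
    by (simp add: lessThan_atLeast0 sum.atLeastLessThan_concat add.commute)
  also have "(\<Sum>q=r * n..<r * n + n. f (q div n) (q mod n)) = (\<Sum>a<n. f r a)"
    by (simp add: sum.atLeastLessThan_shift_0[of _ "r * n"] lessThan_atLeast0)
  finally show ?case using Suc.IH by simp
qed auto

lemma block_mat_carrier [simp]: "block_mat n r F \<in> carrier_mat (r * n) (r * n)"
  by (simp add: block_mat_def)

lemma block_mat_cong:
  assumes "\<And>i j. i < r \<Longrightarrow> j < r \<Longrightarrow> F i j = G i j"
  shows "block_mat n r F = block_mat n r G"
  using assms by (intro eq_matI) (auto simp: block_mat_def div_mod_less)

lemma block_mat_index: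
  assumes "i < r" "j < r" "a < n" "b < n"
  shows "block_mat n r F $$ (i * n + a, j * n + b) = F i j $$ (a, b)"
  using assms by (simp add: block_mat_def block_index_less)

lemma block_mat_inject:
  assumes "block_mat n r F = block_mat n r G" "i < r" "j < r"
    "F i j \<in> carrier_mat n n" "G i j \<in> carrier_mat n n"
  shows "F i j = G i j"
  using assms block_mat_index[of i r j _ n _ F] block_mat_index[of i r j _ n _ G]
  by (intro eq_matI) auto

text \<open>Covers the products in which a single middle index \<open>k i j\<close> contributes to
  each block: block diagonal factors on the left (k = i) or right (k = j), and factors with one
  nonzero block per column, as for induced representations.\<close>

lemma block_mat_mult:
  fixes F G :: "nat \<Rightarrow> nat \<Rightarrow> 'a :: semiring_0 mat"
  assumes F: "\<And>i k. i < r \<Longrightarrow> k < r \<Longrightarrow> F i k \<in> carrier_mat n n"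
    and G: "\<And>i k. i < r \<Longrightarrow> k < r \<Longrightarrow> G i k \<in> carrier_mat n n"
    and k0: "\<And>i j. i < r \<Longrightarrow> j < r \<Longrightarrow> k i j < r"
    and H: "\<And>i j. i < r \<Longrightarrow> j < r \<Longrightarrow> H i j = F i (k i j) * G (k i j) j"
    and z: "\<And>i j l. i < r \<Longrightarrow> j < r \<Longrightarrow> l < r \<Longrightarrow> l \<noteq> k i j \<Longrightarrow> F i l * G l j = 0\<^sub>m n n"
  shows "block_mat n r F * block_mat n r G = block_mat n r H"
proof (rule eq_matI)
  fix p q assume "p < dim_row (block_mat n r H)" "q < dim_col (block_mat n r H)"
  then have pq: "p < r * n" "q < r * n" by (auto simp: block_mat_def)
  define i a j b where ia: "i = p div n" "a = p mod n" "j = q div n" "b = q mod n"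
  have l: "i < r" "a < n" "j < r" "b < n" using pq div_mod_less by (auto simp: ia)
  have "(block_mat n r F * block_mat n r G) $$ (p, q) =
      (\<Sum>s<r * n. F i (s div n) $$ (a, s mod n) * G (s div n) j $$ (s mod n, b))"
    using pq by (simp add: block_mat_def scalar_prod_def lessThan_atLeast0 ia)
  also have "\<dots> = (\<Sum>l<r. \<Sum>c<n. F i l $$ (a, c) * G l j $$ (c, b))"
    by (rule sum_div_mod)
  also have "\<dots> = (\<Sum>l<r. (F i l * G l j) $$ (a, b))"
  proof (rule sum.cong[OF refl])
    fix m assume "m \<in> {..<r}"
    then have "F i m \<in> carrier_mat n n" "G m j \<in> carrier_mat n n" using F G l by auto
    then show "(\<Sum>c<n. F i m $$ (a, c) * G m j $$ (c, b)) = (F i m * G m j) $$ (a, b)"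
      using l by (simp add: scalar_prod_def lessThan_atLeast0)
  qed
  also have "\<dots> = (\<Sum>l<r. if l = k i j then H i j $$ (a, b) else 0)"
    using l z[of i j] H[of i j] by (intro sum.cong) auto
  also have "\<dots> = H i j $$ (a, b)" using k0 l by simp
  also have "\<dots> = block_mat n r H $$ (p, q)" using pq by (simp add: block_mat_def ia)
  finally show "(block_mat n r F * block_mat n r G) $$ (p, q) = block_mat n r H $$ (p, q)" .
qed (auto simp: block_mat_def)

lemma block_mat_adjoint:
  fixes F :: "nat \<Rightarrow> nat \<Rightarrow> complex mat"
  assumes "\<And>i k. i < r \<Longrightarrow> k < r \<Longrightarrow> F i k \<in> carrier_mat n n"
  shows "mat_adjoint (block_mat n r F) = block_mat n r (\<lambda>i j. mat_adjoint (F j i))"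
proof (rule eq_matI)
  fix p q assume "p < dim_row (block_mat n r (\<lambda>i j. mat_adjoint (F j i)))"
    "q < dim_col (block_mat n r (\<lambda>i j. mat_adjoint (F j i)))"
  then have pq: "p < r * n" "q < r * n" by (auto simp: block_mat_def)
  then show "mat_adjoint (block_mat n r F) $$ (p, q) = block_mat n r (\<lambda>i j. mat_adjoint (F j i)) $$ (p, q)"
    using assms[of "q div n" "p div n"] div_mod_less[OF pq(1)] div_mod_less[OF pq(2)]
    by (simp add: block_mat_def)
qed (auto simp: block_mat_def)

lemma block_mat_one: "block_mat n r (\<lambda>i j. if i = j then 1\<^sub>m n else 0\<^sub>m n n) = 1\<^sub>m (r * n)"
proof (rule eq_matI)
  fix p q assume "p < dim_row (1\<^sub>m (r * n))" "q < dim_col (1\<^sub>m (r * n))"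
  then have pq: "p < r * n" "q < r * n" by auto
  have "p = q \<longleftrightarrow> p div n = q div n \<and> p mod n = q mod n" by (metis div_mult_mod_eq)
  then show "block_mat n r (\<lambda>i j. if i = j then 1\<^sub>m n else 0\<^sub>m n n) $$ (p, q) = 1\<^sub>m (r * n) $$ (p, q)"
    using pq div_mod_less[OF pq(1)] div_mod_less[OF pq(2)] by (auto simp: block_mat_def)
qed (auto simp: block_mat_def)

text \<open>Lets an arbitrary intertwiner be cut into blocks.\<close>

lemma block_mat_surj:
  assumes "M \<in> carrier_mat (r * n) (r * n)"
  shows "M = block_mat n r (\<lambda>i j. mat n n (\<lambda>(a, b). M $$ (i * n + a, j * n + b)))"
  using assms div_mod_less by (intro eq_matI) (auto simp: block_mat_def)

section \<open>Induced representations\<close>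

context group
begin

lemma inv_mult_cancel:
  assumes "x \<in> carrier G" "y \<in> carrier G"
  shows "x \<otimes> (inv x \<otimes> y) = y" "inv x \<otimes> (x \<otimes> y) = y"
  using assms by (simp_all add: m_assoc[symmetric])

text \<open>Restates coset membership as the condition on inverse products that
  \<open>ind_rep\<close> tests.\<close>

lemma left_transversal_iff:
  assumes "subgroup K G"
  shows "left_transversal G K hs \<longleftrightarrow> set hs \<subseteq> carrier G \<and>
     (\<forall>h \<in> carrier G. \<exists>!i. i < length hs \<and> inv (hs ! i) \<otimes> h \<in> K)"
proof -
  interpret K: subgroup K G by fact
  have "h \<in> x <# K \<longleftrightarrow> inv x \<otimes> h \<in> K" if "x \<in> carrier G" "h \<in> carrier G" for x h
  proof
    assume "h \<in> x <# K"
    then obtain k where "k \<in> K" "h = x \<otimes> k" by (auto simp: l_coset_def)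
    then show "inv x \<otimes> h \<in> K" using that by (simp add: m_assoc[symmetric])
  next
    assume "inv x \<otimes> h \<in> K"
    moreover have "h = x \<otimes> (inv x \<otimes> h)" using that by (simp add: m_assoc[symmetric])
    ultimately show "h \<in> x <# K" by (auto simp: l_coset_def)
  qed
  note iff = this
  show ?thesis
  proof (cases "set hs \<subseteq> carrier G")
    case True
    then have "hs ! i \<in> carrier G" if "i < length hs" for i using that by auto
    then have "(i < length hs \<and> h \<in> hs ! i <# K) = (i < length hs \<and> inv (hs ! i) \<otimes> h \<in> K)"
      if "h \<in> carrier G" for h i
      using iff that by auto
    then show ?thesis unfolding left_transversal_def by simp
  qed (simp add: left_transversal_def)
qed

lemma left_transversal_nth:
  "left_transversal G K hs \<Longrightarrow> i < length hs \<Longrightarrow> hs ! i \<in> carrier G"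
  unfolding left_transversal_def by (metis nth_mem subsetD)

lemma left_transversal_ex:
  assumes "subgroup K G" "left_transversal G K hs" "h \<in> carrier G"
  obtains i where "i < length hs" "inv (hs ! i) \<otimes> h \<in> K"
  using assms left_transversal_iff by blast

lemma left_transversal_unique:
  assumes "subgroup K G" "left_transversal G K hs" "h \<in> carrier G"
    "i < length hs" "inv (hs ! i) \<otimes> h \<in> K" "j < length hs" "inv (hs ! j) \<otimes> h \<in> K"
  shows "i = j"
  using assms left_transversal_iff by blast

lemma inv_mult_mem_trans:
  assumes "subgroup K G" "x \<in> carrier G" "y \<in> carrier G" "z \<in> carrier G"
    "inv x \<otimes> y \<in> K" "inv y \<otimes> z \<in> K"
  shows "inv x \<otimes> z \<in> K"
proof -
  have "inv x \<otimes> z = (inv x \<otimes> y) \<otimes> (inv y \<otimes> z)"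
    using assms by (simp add: m_assoc inv_mult_cancel)
  then show ?thesis using assms subgroup.m_closed by metis
qed

lemma inv_mult_mem_sym:
  assumes "subgroup K G" "x \<in> carrier G" "y \<in> carrier G" "inv x \<otimes> y \<in> K"
  shows "inv y \<otimes> x \<in> K"
  using subgroup.m_inv_closed[OF assms(1,4)] assms(2,3) by (simp add: inv_mult_group)

lemma left_transversal_self:
  assumes "subgroup K G" "left_transversal G K hs" "i < length hs" "j < length hs"
    "inv (hs ! i) \<otimes> hs ! j \<in> K"
  shows "i = j"
proof -
  note m = left_transversal_nth[OF assms(2)]
  have "inv (hs ! j) \<otimes> hs ! j \<in> K" using m[OF assms(4)] subgroup.one_closed[OF assms(1)] by simp
  then show ?thesis using left_transversal_unique[OF assms(1,2) m[OF assms(4)]] assms by blast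
qed

text \<open>Sending each representative to the one of the same coset in the other list is injective,
  since two entries of one transversal never share a coset.\<close>

lemma left_transversal_length_le:
  assumes K: "subgroup K G" and hs: "left_transversal G K hs" and hs': "left_transversal G K hs'"
  shows "length hs \<le> length hs'"
proof -
  have "\<exists>j<length hs'. inv (hs' ! j) \<otimes> hs ! i \<in> K" if "i < length hs" for i
    using left_transversal_ex[OF K hs' left_transversal_nth[OF hs that]] by blast
  then obtain f where f: "f i < length hs'" "inv (hs' ! f i) \<otimes> hs ! i \<in> K" if "i < length hs" for i
    by metis
  have "inj_on f {..<length hs}"
  proof (rule inj_onI)
    fix i j assume ij: "i \<in> {..<length hs}" "j \<in> {..<length hs}" "f i = f j"
    have l: "i < length hs" "j < length hs" using ij by auto
    note m = left_transversal_nth[OF hs l(1)] left_transversal_nth[OF hs l(2)]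
      left_transversal_nth[OF hs' f(1)[OF l(1)]]
    have "inv (hs ! i) \<otimes> hs' ! f i \<in> K"
      by (rule inv_mult_mem_sym[OF K m(3) m(1) f(2)[OF l(1)]])
    moreover have "inv (hs' ! f i) \<otimes> hs ! j \<in> K" using f(2)[OF l(2)] ij(3) by simp
    ultimately have "inv (hs ! i) \<otimes> hs ! j \<in> K" by (rule inv_mult_mem_trans[OF K m(1,3,2)])
    then show "i = j" by (rule left_transversal_self[OF K hs l])
  qed
  moreover have "f ` {..<length hs} \<subseteq> {..<length hs'}" using f by auto
  ultimately have "card {..<length hs} \<le> card {..<length hs'}" by (intro card_inj_on_le) auto
  then show ?thesis by simp
qed

lemma left_transversal_length:
  assumes "subgroup K G" "left_transversal G K hs" "left_transversal G K hs'"
  shows "length hs = length hs'"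
  using left_transversal_length_le assms by (metis le_antisym)

text \<open>The function \<open>f\<close> is an invariant that separates the left cosets. With
  finitely many values, one preimage per value is a transversal; the linear part will serve as
  \<open>f\<close>.\<close>

lemma left_transversal_exists:
  assumes K: "subgroup K G" and fin: "finite (f ` carrier G)"
    and f: "\<And>x y. x \<in> carrier G \<Longrightarrow> y \<in> carrier G \<Longrightarrow> f x = f y \<longleftrightarrow> inv x \<otimes> y \<in> K"
  obtains hs where "left_transversal G K hs"
proof -
  obtain vs where vs: "set vs = f ` carrier G" "distinct vs" using finite_distinct_list[OF fin] by blast
  have "\<exists>x\<in>carrier G. f x = v" if "v \<in> set vs" for v using that vs(1) by auto
  then obtain g where g: "g v \<in> carrier G" "f (g v) = v" if "v \<in> set vs" for v
    by metis
  have "left_transversal G K (map g vs)"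
    unfolding left_transversal_iff[OF K]
  proof (intro conjI ballI)
    fix h assume h: "h \<in> carrier G"
    have iff: "inv (map g vs ! i) \<otimes> h \<in> K \<longleftrightarrow> vs ! i = f h" if "i < length vs" for i
      using that g[of "vs ! i"] f[of "g (vs ! i)" h] h by auto
    obtain i where i: "i < length vs" "vs ! i = f h" using h vs(1) by (metis imageI in_set_conv_nth)
    show "\<exists>!i. i < length (map g vs) \<and> inv (map g vs ! i) \<otimes> h \<in> K"
    proof (rule ex1I[of _ i])
      show "i < length (map g vs) \<and> inv (map g vs ! i) \<otimes> h \<in> K" using iff[OF i(1)] i by simp
      fix j assume j: "j < length (map g vs) \<and> inv (map g vs ! j) \<otimes> h \<in> K"
      then have "j < length vs" by simp
      with j have "vs ! j = f h" using iff[of j] by simp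
      then have "vs ! j = vs ! i" using i by simp
      then show "j = i" using j i(1) vs(2) by (simp add: nth_eq_iff_index_eq)
    qed
  qed (use g in auto)
  then show thesis by (rule that)
qed

end

section \<open>Induced representations as matrices of coset blocks\<close>

locale subgroup_representation = group H + K: subgroup K H +
  r: unitary_representation "H\<lparr>carrier := K\<rparr>" n \<rho> for H (structure) and K n \<rho>
begin

lemma subgroup: "subgroup K H" by unfold_locales

definition ext :: "'a \<Rightarrow> complex mat" where
  "ext x = (if x \<in> K then \<rho> x else 0\<^sub>m n n)"

text \<open>Two transversals are allowed so that one product formula serves two purposes: with equal
  lists this is the induced representation, and at the unit it is the change of basis between two
  transversals.\<close>

definition coset_block :: "'a list \<Rightarrow> 'a list \<Rightarrow> 'a \<Rightarrow> complex mat" where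
  "coset_block hs hs' h = block_mat n (length hs) (\<lambda>i j. ext (inv (hs ! i) \<otimes> h \<otimes> hs' ! j))"

lemma ext_carrier [simp]: "ext x \<in> carrier_mat n n"
  using r.carrier by (simp add: ext_def)

lemma rep_dim_H: "rep_dim H \<rho> = n"
  using r.rep_dim by (simp add: rep_dim_def)

text \<open>The element x may lie outside \<open>K\<close>: as y is in \<open>K\<close>, x and x
  \<otimes> y lie in \<open>K\<close> simultaneously, and otherwise both sides vanish. With both
  factors outside \<open>K\<close> the formula may fail.\<close>

lemma ext_mult_right:
  assumes "x \<in> carrier H" "y \<in> K"
  shows "ext x * ext y = ext (x \<otimes> y)"
proof (cases "x \<in> K")
  case True
  then show ?thesis using assms r.mult[of x y] by (simp add: ext_def)
next
  case False
  have "x \<otimes> y \<notin> K"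
  proof
    assume "x \<otimes> y \<in> K"
    then have "x \<otimes> y \<otimes> inv y \<in> K" using assms by blast
    then show False using assms False by (simp add: m_assoc)
  qed
  then show ?thesis using False assms r.carrier[of y] by (simp add: ext_def)
qed

lemma ext_adjoint: 
  assumes "x \<in> carrier H"
  shows "mat_adjoint (ext x) = ext (inv x)"
proof (cases "x \<in> K")
  case True
  have "\<rho> (inv x) = mat_adjoint (\<rho> x)"
    using r.inverse[of x] True m_inv_consistent[OF subgroup True] by simp
  then show ?thesis using True K.m_inv_closed[OF True] unfolding ext_def by simp
next
  case False
  have "inv x \<notin> K"
    using False K.m_inv_closed[of "inv x"] inv_inv[OF assms] by metis
  then show ?thesis using False by (simp add: ext_def)
qed

lemma ext_one: "ext \<one> = 1\<^sub>m n"
  using r.one by (simp add: ext_def)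

lemma coset_block_carrier: "coset_block hs hs' h \<in> carrier_mat (length hs * n) (length hs * n)"
  by (simp add: coset_block_def)

text \<open>For given j exactly one entry of the middle transversal lies in the left coset of h'
  \<otimes> \<open>hs'' ! j\<close>. Only this one contributes, and there the right-hand argument
  lies in \<open>K\<close>, so \<open>ext_mult_right\<close> applies.\<close>

lemma coset_block_mult:
  assumes hs: "left_transversal H K hs" and hs': "left_transversal H K hs'"
    and hs'': "left_transversal H K hs''" and h: "h \<in> carrier H" and h': "h' \<in> carrier H"
  shows "coset_block hs hs' h * coset_block hs' hs'' h' = coset_block hs hs'' (h \<otimes> h')"
proof -
  define r where "r = length hs"
  have l: "length hs = r" "length hs' = r" "length hs'' = r"
    using left_transversal_length[OF subgroup hs hs'] left_transversal_length[OF subgroup hs hs'']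
    by (auto simp: r_def)
  note m = left_transversal_nth[OF hs] left_transversal_nth[OF hs'] left_transversal_nth[OF hs'']
  have "\<exists>l<r. inv (hs' ! l) \<otimes> (h' \<otimes> hs'' ! j) \<in> K" if "j < r" for j
    using left_transversal_ex[OF subgroup hs', of "h' \<otimes> hs'' ! j"] h' m(3)[of j] that l
    by (metis m_closed)
  then obtain k where k: "k j < r" "inv (hs' ! k j) \<otimes> (h' \<otimes> hs'' ! j) \<in> K" if "j < r" for j
    by metis
  show ?thesis unfolding coset_block_def l
  proof (rule block_mat_mult[where k = "\<lambda>i j. k j"])
    fix i j assume ij: "i < r" "j < r"
    note c = m(1)[of i] m(2)[of "k j"] m(3)[of j] k[OF ij(2)] ij h h'
    have "ext (inv (hs ! i) \<otimes> h \<otimes> hs' ! k j) * ext (inv (hs' ! k j) \<otimes> h' \<otimes> hs'' ! j) =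
      ext (inv (hs ! i) \<otimes> h \<otimes> hs' ! k j \<otimes> (inv (hs' ! k j) \<otimes> h' \<otimes> hs'' ! j))"
      using c l by (intro ext_mult_right) (auto simp: m_assoc)
    also have "inv (hs ! i) \<otimes> h \<otimes> hs' ! k j \<otimes> (inv (hs' ! k j) \<otimes> h' \<otimes> hs'' ! j) =
        inv (hs ! i) \<otimes> (h \<otimes> h') \<otimes> hs'' ! j"
      using c l by (simp add: m_assoc inv_mult_cancel)
    finally show "ext (inv (hs ! i) \<otimes> (h \<otimes> h') \<otimes> hs'' ! j) =
      ext (inv (hs ! i) \<otimes> h \<otimes> hs' ! k j) * ext (inv (hs' ! k j) \<otimes> h' \<otimes> hs'' ! j)" ..
  next
    fix i j q assume ij: "i < r" "j < r" "q < r" "q \<noteq> k j"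
    note c = m(2)[of "k j"] m(2)[of q] m(3)[of j] k[OF ij(2)] ij h h'
    have "inv (hs' ! q) \<otimes> (h' \<otimes> hs'' ! j) \<notin> K"
      using c l left_transversal_unique[OF subgroup hs', of "h' \<otimes> hs'' ! j" q "k j"] by auto
    then have "ext (inv (hs' ! q) \<otimes> h' \<otimes> hs'' ! j) = 0\<^sub>m n n"
      using c l by (simp add: ext_def m_assoc)
    then show "ext (inv (hs ! i) \<otimes> h \<otimes> hs' ! q) * ext (inv (hs' ! q) \<otimes> h' \<otimes> hs'' ! j) = 0\<^sub>m n n"
      by (simp add: right_mult_zero_mat[OF ext_carrier])
  qed (use k in auto)
qed

lemma coset_block_adjoint:
  assumes hs: "left_transversal H K hs" and hs': "left_transversal H K hs'" and h: "h \<in> carrier H"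
  shows "mat_adjoint (coset_block hs hs' h) = coset_block hs' hs (inv h)"
proof -
  have l: "length hs' = length hs" using left_transversal_length[OF subgroup hs' hs] .
  show ?thesis unfolding coset_block_def l
    using h left_transversal_nth[OF hs] left_transversal_nth[OF hs'] l
    by (subst block_mat_adjoint)
       (auto intro!: block_mat_cong simp: ext_adjoint inv_mult_group m_assoc)
qed

lemma coset_block_one:
  assumes hs: "left_transversal H K hs"
  shows "coset_block hs hs \<one> = 1\<^sub>m (length hs * n)"
  unfolding coset_block_def block_mat_one[symmetric]
proof (rule block_mat_cong)
  fix i j assume ij: "i < length hs" "j < length hs"
  show "ext (inv (hs ! i) \<otimes> \<one> \<otimes> hs ! j) = (if i = j then 1\<^sub>m n else 0\<^sub>m n n)"
    using left_transversal_self[OF subgroup hs ij] ext_one left_transversal_nth[OF hs] ij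
    by (auto simp: ext_def)
qed

lemma coset_block_unitary:
  assumes hs: "left_transversal H K hs" and hs': "left_transversal H K hs'" and h: "h \<in> carrier H"
  shows "coset_block hs hs' h \<in> carrier (unitary_group (length hs * n))"
  using coset_block_carrier assms
  by (intro unitary_groupI) (auto simp: coset_block_adjoint coset_block_mult coset_block_one)

lemma ind_rep_eq: "ind_rep H K hs \<rho> h = coset_block hs hs h"
proof (rule eq_matI)
  fix p q assume "p < dim_row (coset_block hs hs h)" "q < dim_col (coset_block hs hs h)"
  then have pq: "p < length hs * n" "q < length hs * n" by (auto simp: coset_block_def block_mat_def)
  then show "ind_rep H K hs \<rho> h $$ (p, q) = coset_block hs hs h $$ (p, q)"
    using div_mod_less[OF pq(1)] div_mod_less[OF pq(2)]
    by (auto simp: ind_rep_def coset_block_def block_mat_def rep_dim_H Let_def ext_def)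
qed (auto simp: ind_rep_def coset_block_def block_mat_def rep_dim_H Let_def)

lemma ind_rep_representation:
  assumes hs: "left_transversal H K hs"
  shows "unitary_representation H (length hs * n) (ind_rep H K hs \<rho>)"
  using coset_block_unitary[OF hs hs] coset_block_mult[OF hs hs hs]
  by unfold_locales (auto simp: hom_def ind_rep_eq)

lemma ind_rep_transversal:
  assumes hs: "left_transversal H K hs" and hs': "left_transversal H K hs'"
  shows "(ind_rep H K hs \<rho>, ind_rep H K hs' \<rho>) \<in> rep_rel H"
proof (rule rep_relI[OF ind_rep_representation[OF hs]])
  show "unitary_representation H (length hs * n) (ind_rep H K hs' \<rho>)"
    using ind_rep_representation[OF hs'] left_transversal_length[OF subgroup hs hs'] by simp
  \<comment> \<open>The block matrix at the unit intertwines, because h \<otimes> \<one> and \<one>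
    \<otimes> h agree in the product formula.\<close>
  show "coset_block hs' hs \<one> \<in> carrier (unitary_group (length hs * n))"
    using coset_block_unitary[OF hs' hs] left_transversal_length[OF subgroup hs hs'] by simp
qed (auto simp: ind_rep_eq coset_block_mult hs hs')

end

lemma (in group) subgroup_representationI:
  assumes K: "subgroup K G" and "unitary_rep (G\<lparr>carrier := K\<rparr>) \<rho>"
  shows "subgroup_representation G K (rep_dim (G\<lparr>carrier := K\<rparr>) \<rho>) \<rho>"
  using assms group.unitary_repE[OF subgroup.subgroup_is_group[OF K is_group]]
  by (intro subgroup_representation.intro is_group) auto

text \<open>Repeating the intertwiner U along the block diagonal gives a unitary \<open>D\<close>.
  It intertwines the induced matrices because U also intertwines the extensions by zero.\<close>

lemma ind_rep_rel:
  assumes H: "group H" and K: "subgroup K H" and hs: "left_transversal H K hs"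
    and rel: "(\<rho>, \<sigma>) \<in> rep_rel (H\<lparr>carrier := K\<rparr>)"
  shows "(ind_rep H K hs \<rho>, ind_rep H K hs \<sigma>) \<in> rep_rel H"
proof -
  interpret H: group H by fact
  let ?K = "H\<lparr>carrier := K\<rparr>"
  interpret EK: group ?K using subgroup.subgroup_is_group[OF K H] .
  obtain n U where r: "unitary_representation ?K n \<rho>" and s: "unitary_representation ?K n \<sigma>"
    and U: "U \<in> carrier (unitary_group n)" and eq: "\<And>h. h \<in> carrier ?K \<Longrightarrow> \<sigma> h * U = U * \<rho> h"
    using rel by (rule EK.rep_relE) blast
  interpret r: subgroup_representation H K n \<rho>
    by (intro subgroup_representation.intro H K r)
  interpret s: subgroup_representation H K n \<sigma>
    by (intro subgroup_representation.intro H K s)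
  note U' = unitary_groupD[OF U]
  define r where "r = length hs"
  define D where "D = block_mat n r (\<lambda>i j. if i = j then U else 0\<^sub>m n n)"
  have D: "D \<in> carrier_mat (r * n) (r * n)" by (simp add: D_def)
  have D': "mat_adjoint D = block_mat n r (\<lambda>i j. if i = j then mat_adjoint U else 0\<^sub>m n n)"
    unfolding D_def using U' 
    by (subst block_mat_adjoint) (auto intro!: block_mat_cong)
  have "D * mat_adjoint D = block_mat n r (\<lambda>i j. if i = j then 1\<^sub>m n else 0\<^sub>m n n)"
    unfolding D' unfolding D_def using U'
    by (intro block_mat_mult[where k = "\<lambda>i j. j"]) auto
  then have DU: "D \<in> carrier (unitary_group (r * n))"
    using D by (intro unitary_groupI) (auto simp: block_mat_one)
  have ext: "s.ext x * U = U * r.ext x" for x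
    using eq[of x] U' by (auto simp: r.ext_def s.ext_def)
  show ?thesis
  proof (rule rep_relI[OF r.ind_rep_representation[OF hs] s.ind_rep_representation[OF hs] DU[unfolded r_def]])
    fix h assume h: "h \<in> carrier H"
    have "ind_rep H K hs \<sigma> h * D = block_mat n r (\<lambda>i j. s.ext (inv\<^bsub>H\<^esub> (hs ! i) \<otimes>\<^bsub>H\<^esub> h \<otimes>\<^bsub>H\<^esub> hs ! j) * U)"
      unfolding s.ind_rep_eq s.coset_block_def D_def r_def[symmetric] using U'
      by (intro block_mat_mult[where k = "\<lambda>i j. j"]) (auto simp: right_mult_zero_mat[OF s.ext_carrier])
    also have "\<dots> = D * ind_rep H K hs \<rho> h"
      unfolding r.ind_rep_eq r.coset_block_def D_def r_def[symmetric] using U' ext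
      by (intro block_mat_mult[where k = "\<lambda>i j. i", symmetric]) (auto simp: left_mult_zero_mat[OF r.ext_carrier])
    finally show "ind_rep H K hs \<sigma> h * D = D * ind_rep H K hs \<rho> h" .
  qed
qed

text \<open>Neither the representative nor the transversal affects the class, so the union defining
  \<open>Ind\<close> has a single value.\<close>

lemma Ind_class:
  assumes H: "group H" and K: "subgroup K H" and hs: "left_transversal H K hs"
    and u: "unitary_rep (H\<lparr>carrier := K\<rparr>) \<rho>"
  shows "Ind H K (rep_rel (H\<lparr>carrier := K\<rparr>) `` {\<rho>}) = rep_rel H `` {ind_rep H K hs \<rho>}"
proof -
  interpret H: group H by fact
  let ?K = "H\<lparr>carrier := K\<rparr>"
  interpret EK: group ?K using subgroup.subgroup_is_group[OF K H] .
  have "rep_rel H `` {ind_rep H K hs' \<sigma>} = rep_rel H `` {ind_rep H K hs \<rho>}"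
    if "(\<rho>, \<sigma>) \<in> rep_rel ?K" "left_transversal H K hs'" for \<sigma> hs'
  proof -
    have "unitary_rep ?K \<sigma>" using that by (auto simp: rep_rel_def)
    then interpret s: subgroup_representation H K "rep_dim ?K \<sigma>" \<sigma>
      by (rule H.subgroup_representationI[OF K])
    have "(ind_rep H K hs \<rho>, ind_rep H K hs' \<sigma>) \<in> rep_rel H"
      using ind_rep_rel[OF H K hs that(1)] s.ind_rep_transversal[OF hs that(2)]
      by (rule H.rep_rel_trans)
    then show ?thesis by (metis H.equiv_rep_rel equiv_class_eq)
  qed
  moreover have "(\<rho>, \<rho>) \<in> rep_rel ?K" using EK.rep_rel_refl[OF u] .
  ultimately show ?thesis unfolding Ind_def using hs by blast
qed

section \<open>Conjugate representations and Mackey's criterion\<close>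

definition conj_rep :: "('g, 'b) monoid_scheme \<Rightarrow> 'g \<Rightarrow> ('g \<Rightarrow> 'c) \<Rightarrow> 'g \<Rightarrow> 'c" where
  "conj_rep H g \<rho> = (\<lambda>n. \<rho> (inv\<^bsub>H\<^esub> g \<otimes>\<^bsub>H\<^esub> n \<otimes>\<^bsub>H\<^esub> g))"

context normal
begin

lemma conj_mem_iff:
  assumes "g \<in> carrier G" "x \<in> carrier G"
  shows "inv g \<otimes> x \<otimes> g \<in> H \<longleftrightarrow> x \<in> H"
proof
  assume "inv g \<otimes> x \<otimes> g \<in> H"
  then have "g \<otimes> (inv g \<otimes> x \<otimes> g) \<otimes> inv g \<in> H" using assms inv_op_closed2 by blast
  also have "g \<otimes> (inv g \<otimes> x \<otimes> g) \<otimes> inv g = x" using assms by (simp add: m_assoc inv_mult_cancel)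
  finally show "x \<in> H" .
qed (use assms inv_op_closed1 in blast)

lemma conj_mult:
  assumes "g \<in> carrier G" "x \<in> carrier G" "y \<in> carrier G"
  shows "(inv g \<otimes> x \<otimes> g) \<otimes> (inv g \<otimes> y \<otimes> g) = inv g \<otimes> (x \<otimes> y) \<otimes> g"
  using assms by (simp add: m_assoc inv_mult_cancel)

lemma conj_rep_comp:
  assumes "g \<in> carrier G" "g' \<in> carrier G" "x \<in> carrier G"
  shows "conj_rep G g (conj_rep G g' \<rho>) x = conj_rep G (g \<otimes> g') \<rho> x"
  using assms by (simp add: conj_rep_def m_assoc inv_mult_group)

lemma conj_rep_one: "x \<in> carrier G \<Longrightarrow> conj_rep G \<one> \<rho> x = \<rho> x"
  by (simp add: conj_rep_def)

lemma conj_rep_representation: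
  assumes "unitary_representation (G\<lparr>carrier := H\<rparr>) n \<rho>" "g \<in> carrier G"
  shows "unitary_representation (G\<lparr>carrier := H\<rparr>) n (conj_rep G g \<rho>)"
proof -
  interpret r: unitary_representation "G\<lparr>carrier := H\<rparr>" n \<rho> by fact
  show ?thesis
  proof unfold_locales
    show "conj_rep G g \<rho> \<in> hom (G\<lparr>carrier := H\<rparr>) (unitary_group n)"
    proof (rule homI)
      fix x assume "x \<in> carrier (G\<lparr>carrier := H\<rparr>)"
      then show "conj_rep G g \<rho> x \<in> carrier (unitary_group n)"
        using r.closed inv_op_closed1[OF assms(2)] by (simp add: conj_rep_def)
    next
      fix x y assume xy: "x \<in> carrier (G\<lparr>carrier := H\<rparr>)" "y \<in> carrier (G\<lparr>carrier := H\<rparr>)"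
      then have "x \<in> carrier G" "y \<in> carrier G" by auto
      from conj_mult[OF assms(2) this]
        r.mult[of "inv g \<otimes> x \<otimes> g" "inv g \<otimes> y \<otimes> g"] xy inv_op_closed1[OF assms(2)]
      show "conj_rep G g \<rho> (x \<otimes>\<^bsub>G\<lparr>carrier := H\<rparr>\<^esub> y) =
          conj_rep G g \<rho> x \<otimes>\<^bsub>unitary_group n\<^esub> conj_rep G g \<rho> y"
        by (simp add: conj_rep_def)
    qed
  qed
qed

lemma conj_rep_rel:
  assumes "(\<rho>, \<sigma>) \<in> rep_rel (G\<lparr>carrier := H\<rparr>)" "g \<in> carrier G"
  shows "(conj_rep G g \<rho>, conj_rep G g \<sigma>) \<in> rep_rel (G\<lparr>carrier := H\<rparr>)"
proof -
  interpret EK: group "G\<lparr>carrier := H\<rparr>" using subgroup_is_group is_group by blast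
  obtain n U where U: "unitary_representation (G\<lparr>carrier := H\<rparr>) n \<rho>"
    "unitary_representation (G\<lparr>carrier := H\<rparr>) n \<sigma>"
    "U \<in> carrier (unitary_group n)" "\<And>h. h \<in> carrier (G\<lparr>carrier := H\<rparr>) \<Longrightarrow> \<sigma> h * U = U * \<rho> h"
    using assms(1) by (rule EK.rep_relE) blast
  show ?thesis
    using U(4) inv_op_closed1[OF assms(2)]
    by (intro rep_relI[OF conj_rep_representation[OF U(1) assms(2)]
          conj_rep_representation[OF U(2) assms(2)] U(3)]) (simp add: conj_rep_def)
qed

text \<open>Conjugation by g permutes the normal subgroup, so the conjugate runs through the same
  matrices and has the same invariant subspaces.\<close>

lemma conj_rep_irreducible:
  assumes irr: "irreducible_rep (G\<lparr>carrier := H\<rparr>) \<rho>" and g: "g \<in> carrier G"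
  shows "irreducible_rep (G\<lparr>carrier := H\<rparr>) (conj_rep G g \<rho>)"
proof -
  let ?K = "G\<lparr>carrier := H\<rparr>"
  interpret EK: group ?K using subgroup_is_group is_group by blast
  interpret r: unitary_representation ?K "rep_dim ?K \<rho>" \<rho>
    using irreducible_rep_unitary[OF irr] by (rule EK.unitary_repE)
  interpret c: unitary_representation ?K "rep_dim ?K \<rho>" "conj_rep G g \<rho>"
    using conj_rep_representation[OF r.unitary_representation_axioms g] .
  show ?thesis
  proof (rule irreducible_rep_transfer[OF irr c.unitary_rep c.rep_dim])
    fix W h assume W: "\<forall>h\<in>carrier ?K. \<forall>w\<in>W. conj_rep G g \<rho> h *\<^sub>v w \<in> W" and h: "h \<in> carrier ?K"
    have "g \<otimes> h \<otimes> inv g \<in> carrier ?K" using inv_op_closed2[OF g] h by simp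
    note bspec[OF W this]
    moreover have "conj_rep G g \<rho> (g \<otimes> h \<otimes> inv g) = \<rho> h"
      using g h by (simp add: conj_rep_def m_assoc inv_mult_cancel)
    ultimately show "\<forall>w\<in>W. \<rho> h *\<^sub>v w \<in> W" by simp
  qed
qed

text \<open>By normality, right translation permutes the left cosets: the membership test for the
  translated list is the g-conjugate of the test for the old list at h \<otimes> inv g.\<close>

lemma left_transversal_translate:
  assumes hs: "left_transversal G H hs" and g: "g \<in> carrier G"
  shows "left_transversal G H (map (\<lambda>x. x \<otimes> g) hs)"
  unfolding left_transversal_iff[OF subgroup_axioms]
proof (intro conjI ballI)
  note m = left_transversal_nth[OF hs]
  show "set (map (\<lambda>x. x \<otimes> g) hs) \<subseteq> carrier G"
    using g hs by (auto simp: left_transversal_def)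
  fix h assume h: "h \<in> carrier G"
  have iff: "inv (map (\<lambda>x. x \<otimes> g) hs ! i) \<otimes> h \<in> H \<longleftrightarrow> inv (hs ! i) \<otimes> (h \<otimes> inv g) \<in> H"
    if "i < length hs" for i
  proof -
    have "inv (map (\<lambda>x. x \<otimes> g) hs ! i) \<otimes> h = inv g \<otimes> (inv (hs ! i) \<otimes> (h \<otimes> inv g)) \<otimes> g"
      using that g h m[OF that] by (simp add: inv_mult_group m_assoc)
    then show ?thesis using conj_mem_iff[OF g, of "inv (hs ! i) \<otimes> (h \<otimes> inv g)"] g h m[OF that] by simp
  qed
  have "h \<otimes> inv g \<in> carrier G" using g h by simp
  then have "\<exists>!i. i < length hs \<and> inv (hs ! i) \<otimes> (h \<otimes> inv g) \<in> H"
    using hs unfolding left_transversal_iff[OF subgroup_axioms] by blast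
  moreover have "(i < length (map (\<lambda>x. x \<otimes> g) hs) \<and> inv (map (\<lambda>x. x \<otimes> g) hs ! i) \<otimes> h \<in> H) =
    (i < length hs \<and> inv (hs ! i) \<otimes> (h \<otimes> inv g) \<in> H)" for i
    using iff[of i] by auto
  ultimately show "\<exists>!i. i < length (map (\<lambda>x. x \<otimes> g) hs) \<and> inv (map (\<lambda>x. x \<otimes> g) hs ! i) \<otimes> h \<in> H"
    by simp
qed

text \<open>Inducing a conjugate is inducing \<rho> itself along a translated transversal, so
  conjugation invariance reduces to independence of the transversal.\<close>

lemma ind_rep_conj:
  assumes "unitary_representation (G\<lparr>carrier := H\<rparr>) n \<rho>"
    and hs: "left_transversal G H hs" and g: "g \<in> carrier G" and h: "h \<in> carrier G"
  shows "ind_rep G H hs (conj_rep G g \<rho>) h = ind_rep G H (map (\<lambda>x. x \<otimes> g) hs) \<rho> h"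
proof -
  interpret r: subgroup_representation G H n \<rho>
    by (intro subgroup_representation.intro is_group subgroup_axioms assms(1))
  interpret c: subgroup_representation G H n "conj_rep G g \<rho>"
    by (intro subgroup_representation.intro is_group subgroup_axioms conj_rep_representation[OF assms(1) g])
  have ext: "c.ext x = r.ext (inv g \<otimes> x \<otimes> g)" if "x \<in> carrier G" for x
    unfolding c.ext_def r.ext_def using conj_mem_iff[OF g that] by (simp add: conj_rep_def)
  show ?thesis
    unfolding c.ind_rep_eq r.ind_rep_eq c.coset_block_def r.coset_block_def length_map
    using left_transversal_nth[OF hs] g h
    by (intro block_mat_cong) (simp add: ext inv_mult_group m_assoc)
qed

lemma ind_rep_conj_equivalent:
  assumes r: "unitary_representation (G\<lparr>carrier := H\<rparr>) n \<rho>"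
    and hs: "left_transversal G H hs" and g: "g \<in> carrier G"
  shows "(ind_rep G H hs \<rho>, ind_rep G H hs (conj_rep G g \<rho>)) \<in> rep_rel G"
proof -
  interpret r: subgroup_representation G H n \<rho>
    by (intro subgroup_representation.intro is_group subgroup_axioms r)
  let ?hs = "map (\<lambda>x. x \<otimes> g) hs"
  note hs' = left_transversal_translate[OF hs g]
  have "(ind_rep G H ?hs \<rho>, ind_rep G H hs (conj_rep G g \<rho>)) \<in> rep_rel G"
    using unitary_representation.unitary_rep[OF r.ind_rep_representation[OF hs']]
    by (rule rep_rel_cong) (rule ind_rep_conj[OF r hs g])
  then show ?thesis using r.ind_rep_transversal[OF hs hs'] rep_rel_trans by blast
qed

text \<open>The blocks of an intertwiner of the induced representations intertwine conjugates of
  \<open>\<rho>\<close> and \<open>\<sigma>\<close>, and they cannot all vanish.\<close>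

lemma ind_rep_equivalentD:
  assumes irr: "irreducible_rep (G\<lparr>carrier := H\<rparr>) \<rho>" and su: "unitary_rep (G\<lparr>carrier := H\<rparr>) \<sigma>"
    and hs: "left_transversal G H hs"
    and rel: "(ind_rep G H hs \<rho>, ind_rep G H hs \<sigma>) \<in> rep_rel G"
  obtains g where "g \<in> carrier G" "(conj_rep G g \<rho>, \<sigma>) \<in> rep_rel (G\<lparr>carrier := H\<rparr>)"
proof -
  let ?K = "G\<lparr>carrier := H\<rparr>"
  interpret EK: group ?K using subgroup_is_group is_group by blast
  define n where "n = rep_dim ?K \<rho>"
  have n: "n > 0" using irreducible_rep_dim_pos[OF irr] by (simp add: n_def)
  interpret r: subgroup_representation G H n \<rho>
    unfolding n_def using irreducible_rep_unitary[OF irr] by (rule subgroup_representationI[OF subgroup_axioms])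
  note s = subgroup_representationI[OF subgroup_axioms su]
  define r where "r = length hs"
  note m = left_transversal_nth[OF hs, folded r_def]
  have r: "r > 0" by (rule left_transversal_ex[OF subgroup_axioms hs one_closed]) (auto simp: r_def)
  obtain N M where R: "unitary_representation G N (ind_rep G H hs \<rho>)"
    and S: "unitary_representation G N (ind_rep G H hs \<sigma>)"
    and M: "M \<in> carrier (unitary_group N)"
    and eq: "\<And>h. h \<in> carrier G \<Longrightarrow> ind_rep G H hs \<sigma> h * M = M * ind_rep G H hs \<rho> h"
    using rel by (rule rep_relE) blast
  have N: "N = r * n"
    using unitary_representation.rep_dim[OF R] 
      unitary_representation.rep_dim[OF r.ind_rep_representation[OF hs]] by (simp add: r_def)
  \<comment> \<open>Both induced dimensions are r times the original ones, so equivalence of the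
    induced representations forces \<rho> and \<sigma> to have equal dimension.\<close>
  have "N = r * rep_dim ?K \<sigma>"
    using unitary_representation.rep_dim[OF S] 
      unitary_representation.rep_dim[OF subgroup_representation.ind_rep_representation[OF s hs]] by (simp add: r_def)
  then have sn: "rep_dim ?K \<sigma> = n" using N r by simp
  interpret s: subgroup_representation G H n \<sigma>
    using s sn by simp
  have Mc: "M \<in> carrier_mat (r * n) (r * n)" using unitary_groupD(1)[OF M] N by simp
  define B where "B i j = mat n n (\<lambda>(a, b). M $$ (i * n + a, j * n + b))" for i j
  have Bc: "B i j \<in> carrier_mat n n" for i j by (simp add: B_def)
  have MB: "M = block_mat n r B" using block_mat_surj[OF Mc] by (simp add: B_def[abs_def])
  have "\<exists>i j. i < r \<and> j < r \<and> B i j \<noteq> 0\<^sub>m n n"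
  proof (rule ccontr)
    assume "\<nexists>i j. i < r \<and> j < r \<and> B i j \<noteq> 0\<^sub>m n n"
    then have z: "B i j = 0\<^sub>m n n" if "i < r" "j < r" for i j using that by blast
    have "M = 0\<^sub>m (r * n) (r * n)"
      unfolding MB by (rule eq_matI) (auto simp: block_mat_def z div_mod_less)
    then have "0\<^sub>m (r * n) (r * n) = (1\<^sub>m (r * n) :: complex mat)"
      using unitary_groupD(2)[OF M] N by (simp add: left_mult_zero_mat)
    then have "(0 :: complex) = 1" using r n by (metis index_one_mat(1) index_zero_mat(1) mult_pos_pos)
    then show False by simp
  qed
  then obtain i j where ij: "i < r" "j < r" and Bij: "B i j \<noteq> 0\<^sub>m n n" by blast
  \<comment> \<open>On the normal subgroup both induced matrices are block diagonal, so the
    intertwining equation decouples into one equation for each block of \<open>M\<close>.\<close>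
  have diag: "x \<in> H \<Longrightarrow> i < r \<Longrightarrow> j < r \<Longrightarrow> inv (hs ! i) \<otimes> x \<otimes> hs ! j \<in> H \<longleftrightarrow> i = j" for x i j
  proof
    assume x: "x \<in> H" and ij: "i < r" "j < r" and mem: "inv (hs ! i) \<otimes> x \<otimes> hs ! j \<in> H"
    have "inv (inv (hs ! i) \<otimes> x \<otimes> hs ! i) \<in> H" using x m ij inv_op_closed1 by blast
    then have "inv (inv (hs ! i) \<otimes> x \<otimes> hs ! i) \<otimes> (inv (hs ! i) \<otimes> x \<otimes> hs ! j) \<in> H"
      using mem by blast
    moreover have "inv (inv (hs ! i) \<otimes> x \<otimes> hs ! i) \<otimes> (inv (hs ! i) \<otimes> x \<otimes> hs ! j) = inv (hs ! i) \<otimes> hs ! j"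
      using x m ij by (simp add: inv_mult_group m_assoc inv_mult_cancel)
    ultimately show "i = j" using left_transversal_self[OF subgroup_axioms hs] ij by (simp add: r_def)
  qed (use m inv_op_closed1 in auto)
  have "conj_rep G (hs ! i) \<sigma> x * B i j = B i j * conj_rep G (hs ! j) \<rho> x" if x: "x \<in> H" for x
  proof -
    let ?E = "\<lambda>f i j. if i = j then conj_rep G (hs ! i) f x else 0\<^sub>m n n"
    have c: "conj_rep G (hs ! i) \<sigma> x \<in> carrier_mat n n" "conj_rep G (hs ! i) \<rho> x \<in> carrier_mat n n"
      if "i < r" for i
      using inv_op_closed1[OF m[OF that] x] s.r.carrier r.r.carrier by (auto simp: conj_rep_def)
    have "ind_rep G H hs \<sigma> x = block_mat n r (?E \<sigma>)" "ind_rep G H hs \<rho> x = block_mat n r (?E \<rho>)"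
      unfolding s.ind_rep_eq s.coset_block_def r.ind_rep_eq r.coset_block_def r_def[symmetric]
        s.ext_def r.ext_def
      using diag[OF x] by (auto intro!: block_mat_cong simp: conj_rep_def)
    then have "block_mat n r (?E \<sigma>) * block_mat n r B = block_mat n r B * block_mat n r (?E \<rho>)"
      using eq[of x] x MB by simp
    also have "block_mat n r (?E \<sigma>) * block_mat n r B =
        block_mat n r (\<lambda>i j. conj_rep G (hs ! i) \<sigma> x * B i j)"
      using c Bc by (intro block_mat_mult[where k = "\<lambda>i j. i"]) (auto simp: left_mult_zero_mat[OF Bc])
    also have "block_mat n r B * block_mat n r (?E \<rho>) =
        block_mat n r (\<lambda>i j. B i j * conj_rep G (hs ! j) \<rho> x)"
      using c Bc by (intro block_mat_mult[where k = "\<lambda>i j. j"]) (auto simp: right_mult_zero_mat[OF Bc])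
    finally show ?thesis
      using mult_carrier_mat[OF c(1)[OF ij(1)] Bc] mult_carrier_mat[OF Bc c(2)[OF ij(2)]]
      by (rule block_mat_inject[OF _ ij])
  qed
  then have "(conj_rep G (hs ! j) \<rho>, conj_rep G (hs ! i) \<sigma>) \<in> rep_rel ?K"
    using conj_rep_representation[OF r.r.unitary_representation_axioms m[OF ij(2)]]
      conj_rep_representation[OF s.r.unitary_representation_axioms m[OF ij(1)]]
      conj_rep_irreducible[OF irr m[OF ij(2)]] Bc Bij
    by (intro schur_equivalent[where B = "B i j"]) auto
  \<comment> \<open>Conjugating by the inverse of \<open>hs ! i\<close> removes the conjugation from
    \<sigma>. The group element sought is thus inv (\<open>hs ! i\<close>) \<otimes>
    \<open>hs ! j\<close>.\<close>
  then have *: "(conj_rep G (inv (hs ! i)) (conj_rep G (hs ! j) \<rho>),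
      conj_rep G (inv (hs ! i)) (conj_rep G (hs ! i) \<sigma>)) \<in> rep_rel ?K"
    using m ij by (intro conj_rep_rel) auto
  have a: "(conj_rep G (inv (hs ! i)) (conj_rep G (hs ! i) \<sigma>), \<sigma>) \<in> rep_rel ?K"
    using * m ij by (intro EK.rep_rel_cong) (auto simp: rep_rel_def conj_rep_comp conj_rep_one)
  have b: "(conj_rep G (inv (hs ! i) \<otimes> hs ! j) \<rho>, conj_rep G (inv (hs ! i)) (conj_rep G (hs ! j) \<rho>)) \<in> rep_rel ?K"
    using * m ij by (intro EK.rep_rel_sym[OF EK.rep_rel_cong]) (auto simp: rep_rel_def conj_rep_comp)
  have "(conj_rep G (inv (hs ! i) \<otimes> hs ! j) \<rho>, \<sigma>) \<in> rep_rel ?K"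
    using EK.rep_rel_trans[OF EK.rep_rel_trans[OF b *] a] .
  moreover have "inv (hs ! i) \<otimes> hs ! j \<in> carrier G" using m ij by simp
  ultimately show thesis by (rule that[rotated])
qed

theorem Ind_class_eq_iff:
  assumes irr: "irreducible_rep (G\<lparr>carrier := H\<rparr>) \<rho>" and su: "unitary_rep (G\<lparr>carrier := H\<rparr>) \<sigma>"
    and hs: "left_transversal G H hs"
  shows "Ind G H (rep_rel (G\<lparr>carrier := H\<rparr>) `` {\<rho>}) = Ind G H (rep_rel (G\<lparr>carrier := H\<rparr>) `` {\<sigma>}) \<longleftrightarrow>
    (\<exists>g\<in>carrier G. (conj_rep G g \<rho>, \<sigma>) \<in> rep_rel (G\<lparr>carrier := H\<rparr>))"
proof -
  let ?K = "G\<lparr>carrier := H\<rparr>"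
  interpret EK: group ?K using subgroup_is_group is_group by blast
  note ru = irreducible_rep_unitary[OF irr]
  interpret r: subgroup_representation G H "rep_dim ?K \<rho>" \<rho>
    using ru by (rule subgroup_representationI[OF subgroup_axioms])
  have "Ind G H (rep_rel ?K `` {\<rho>}) = Ind G H (rep_rel ?K `` {\<sigma>}) \<longleftrightarrow>
      (ind_rep G H hs \<rho>, ind_rep G H hs \<sigma>) \<in> rep_rel G"
    unfolding Ind_class[OF is_group subgroup_axioms hs ru] Ind_class[OF is_group subgroup_axioms hs su]
    using unitary_representation.unitary_rep[OF r.ind_rep_representation[OF hs]]
    by (rule rep_rel_class_eq_iff)
  also have "\<dots> \<longleftrightarrow> (\<exists>g\<in>carrier G. (conj_rep G g \<rho>, \<sigma>) \<in> rep_rel ?K)"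
  proof
    assume "(ind_rep G H hs \<rho>, ind_rep G H hs \<sigma>) \<in> rep_rel G"
    with irr su hs obtain g where "g \<in> carrier G" "(conj_rep G g \<rho>, \<sigma>) \<in> rep_rel ?K"
      by (rule ind_rep_equivalentD)
    then show "\<exists>g\<in>carrier G. (conj_rep G g \<rho>, \<sigma>) \<in> rep_rel ?K" ..
  next
    assume "\<exists>g\<in>carrier G. (conj_rep G g \<rho>, \<sigma>) \<in> rep_rel ?K"
    then obtain g where g: "g \<in> carrier G" "(conj_rep G g \<rho>, \<sigma>) \<in> rep_rel ?K" ..
    show "(ind_rep G H hs \<rho>, ind_rep G H hs \<sigma>) \<in> rep_rel G"
      using ind_rep_conj_equivalent[OF r.r.unitary_representation_axioms hs g(1)]
        ind_rep_rel[OF is_group subgroup_axioms hs g(2)]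
      by (rule rep_rel_trans)
  qed
  finally show ?thesis .
qed

end

section \<open>Characters of lattices\<close>

text \<open>The exponential in \<open>chi\<close>, with period 1: its kernel is exactly the
  integers, so triviality of a character becomes integrality of scalar products.\<close>

definition unit_exp :: "real \<Rightarrow> complex" where
  "unit_exp x = exp (2 * complex_of_real pi * \<i> * complex_of_real x)"

lemma unit_exp_cis: "unit_exp x = cis (2 * pi * x)"
  by (simp add: unit_exp_def cis_conv_exp mult_ac)

lemma unit_exp_add: "unit_exp (x + y) = unit_exp x * unit_exp y"
  by (simp add: unit_exp_cis cis_mult distrib_left)

lemma unit_exp_0 [simp]: "unit_exp 0 = 1"
  by (simp add: unit_exp_cis)

lemma cnj_unit_exp: "cnj (unit_exp x) = unit_exp (- x)"
  by (simp add: unit_exp_cis cis_cnj)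

lemma unit_exp_minus: "unit_exp x * unit_exp (- x) = 1" "unit_exp (- x) * unit_exp x = 1"
  by (simp_all add: unit_exp_add[symmetric])

lemma unit_exp_diff: "unit_exp (x - y) = unit_exp x * unit_exp (- y)"
  using unit_exp_add[of x "- y"] by simp

lemma unit_exp_eq_1_iff: "unit_exp x = 1 \<longleftrightarrow> x \<in> \<int>"
proof
  assume "unit_exp x = 1"
  then have "cos (2 * pi * x) = 1" by (auto simp: unit_exp_cis complex_eq_iff)
  then obtain n :: int where "2 * pi * x = of_int n * 2 * pi" using cos_one_2pi_int by blast
  then have "x = of_int n" by simp
  then show "x \<in> \<int>" by simp
next
  assume "x \<in> \<int>"
  then show "unit_exp x = 1" by (auto simp: unit_exp_cis elim!: Ints_cases)
qed

lemma unit_exp_surj: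
  assumes "cmod z = 1"
  obtains x where "z = unit_exp x"
proof -
  have "z = cis (Arg z)" using rcis_cmod_Arg[of z] assms by (simp add: rcis_def)
  then have "z = unit_exp (Arg z / (2 * pi))" by (simp add: unit_exp_cis)
  then show thesis by (rule that)
qed

lemma additive_int_multiple:
  fixes L :: "(nat \<Rightarrow> real) set"
  assumes "(\<lambda>i. 0) \<in> L" "\<And>v w. v \<in> L \<Longrightarrow> w \<in> L \<Longrightarrow> (\<lambda>i. v i + w i) \<in> L"
    "\<And>v w. v \<in> L \<Longrightarrow> w \<in> L \<Longrightarrow> (\<lambda>i. v i - w i) \<in> L" and v: "v \<in> L"
  shows "(\<lambda>i. of_int z * v i) \<in> L"
proof (induction z rule: int_induct[where k = 0])
  case (step1 i)
  then show ?case using assms(2)[OF step1(2) v] by (simp add: distrib_right)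
next
  case (step2 i)
  then show ?case using assms(3)[OF step2(2) v] by (simp add: left_diff_distrib)
qed (use assms in simp)

text \<open>Induction over the subgroups \<open>L\<^sub>j\<close> of the elements supported on the first \<open>j\<close> coordinates:
  \<open>L\<^bsub>j+1\<^esub>\<close> is generated by \<open>L\<^sub>j\<close> and an element \<open>w\<close> whose \<open>j\<close>-th coordinate is positive and
  minimal.\<close>

lemma coordinate_lattice_character:
  fixes L :: "(nat \<Rightarrow> real) set" and \<phi> :: "(nat \<Rightarrow> real) \<Rightarrow> complex"
  assumes zero: "(\<lambda>i. 0) \<in> L"
    and add: "\<And>v w. v \<in> L \<Longrightarrow> w \<in> L \<Longrightarrow> (\<lambda>i. v i + w i) \<in> L"
    and diff: "\<And>v w. v \<in> L \<Longrightarrow> w \<in> L \<Longrightarrow> (\<lambda>i. v i - w i) \<in> L"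
    and unit: "\<And>j. j < d \<Longrightarrow> (\<lambda>i. if i = j then 1 else 0) \<in> L"
    and supp: "\<And>v i. v \<in> L \<Longrightarrow> d \<le> i \<Longrightarrow> v i = 0"
    and fin: "finite {v \<in> L. \<forall>i<d. \<bar>v i\<bar> \<le> 1}"
    and hom: "\<And>v w. v \<in> L \<Longrightarrow> w \<in> L \<Longrightarrow> \<phi> (\<lambda>i. v i + w i) = \<phi> v * \<phi> w"
    and norm: "\<And>v. v \<in> L \<Longrightarrow> cmod (\<phi> v) = 1"
  obtains \<kappa> where "\<And>v. v \<in> L \<Longrightarrow> \<phi> v = unit_exp (\<Sum>i<d. \<kappa> i * v i)"
proof -
  have smult: "(\<lambda>i. of_int z * v i) \<in> L" if "v \<in> L" for v z
    using additive_int_multiple[of L v z] zero add diff that by blast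
  \<comment> \<open>Subtracting integer multiples of unit vectors brings the first j coordinates
    into [0, 1). This is how elements of \<open>L\<close> are moved into the finite box of
    \<open>fin\<close>.\<close>
  have reduce: "\<exists>x'\<in>L. \<forall>i. x' i = (if i < j then frac (x i) else x i)"
    if x: "x \<in> L" and "j \<le> d" for x j
    using \<open>j \<le> d\<close>
  proof (induction j)
    case (Suc j)
    then obtain x' where x': "x' \<in> L" "\<And>i. x' i = (if i < j then frac (x i) else x i)" by auto
    have u: "(\<lambda>i. if i = j then 1 else 0) \<in> L" using unit Suc.prems by simp
    show ?case
    proof (intro bexI allI)
      show "(\<lambda>i. x' i - of_int \<lfloor>x j\<rfloor> * (if i = j then 1 else 0)) \<in> L"
        by (rule diff[OF x'(1) smult[OF u]])
      show "x' i - of_int \<lfloor>x j\<rfloor> * (if i = j then 1 else 0) = (if i < Suc j then frac (x i) else x i)" for i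
        using x'(2)[of i] by (auto simp: frac_def less_Suc_eq)
    qed
  qed (use x in auto)
  have "\<exists>\<kappa>. \<forall>v\<in>L. (\<forall>i\<ge>j. v i = 0) \<longrightarrow> \<phi> v = unit_exp (\<Sum>i<d. \<kappa> i * v i)" if "j \<le> d" for j
    using that
  proof (induction j)
    case 0
    have "\<phi> (\<lambda>i. 0) * \<phi> (\<lambda>i. 0) = \<phi> (\<lambda>i. 0)" using hom[OF zero zero] by simp
    moreover have "\<phi> (\<lambda>i. 0) \<noteq> 0" using norm[OF zero] by auto
    ultimately have \<phi>0: "\<phi> (\<lambda>i. 0) = 1" by simp
    show ?case
    proof (intro exI[of _ "\<lambda>i. 0"] ballI impI)
      fix v :: "nat \<Rightarrow> real" assume "\<forall>i\<ge>0. v i = 0"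
      then have "v = (\<lambda>i. 0)" by auto
      with \<phi>0 show "\<phi> v = unit_exp (\<Sum>i<d. 0 * v i)" by simp
    qed
  next
    case (Suc j)
    then obtain \<kappa> where \<kappa>: "\<And>v. v \<in> L \<Longrightarrow> \<forall>i\<ge>j. v i = 0 \<Longrightarrow> \<phi> v = unit_exp (\<Sum>i<d. \<kappa> i * v i)"
      by auto
    have jd: "j < d" using Suc.prems by simp
    \<comment> \<open>The restriction to the box makes this set finite, and the j-th unit vector
      makes it nonempty, so a minimal j-th coordinate is attained.\<close>
    define F where "F = {v \<in> L. (\<forall>i<d. \<bar>v i\<bar> \<le> 1) \<and> (\<forall>i>j. v i = 0) \<and> 0 < v j}"
    have "finite F" using fin by (rule finite_subset[rotated]) (auto simp: F_def)
    have uF: "(\<lambda>i. if i = j then 1 else 0) \<in> F" using unit[OF jd] by (auto simp: F_def)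
    then have "F \<noteq> {}" by blast
    define w where "w = arg_min_on (\<lambda>v. v j) F"
    have wF: "w \<in> F" unfolding w_def by (rule arg_min_if_finite) fact+
    have wmin: "w j \<le> v j" if "v \<in> F" for v
      unfolding w_def using \<open>finite F\<close> \<open>F \<noteq> {}\<close> that by (rule arg_min_least)
    have w: "w \<in> L" "0 < w j" "\<And>i. i > j \<Longrightarrow> w i = 0" using wF by (auto simp: F_def)
    \<comment> \<open>An element whose j-th coordinate lies strictly between 0 and that of w would,
      after reduction of the lower coordinates, belong to \<open>F\<close> and beat the
      minimum.\<close>
    have gap: "x j = 0" if x: "x \<in> L" "\<And>i. i > j \<Longrightarrow> x i = 0" "0 \<le> x j" "x j < w j" for x
    proof (rule ccontr)
      assume "x j \<noteq> 0"
      obtain x' where x': "x' \<in> L" "\<And>i. x' i = (if i < j then frac (x i) else x i)"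
        using reduce[OF x(1), of j] jd by auto
      have "x j < 1" using x(4) wmin[OF uF] by simp
      have "x' \<in> F" unfolding F_def
      proof (intro CollectI conjI allI impI)
        fix i assume "i < d"
        show "\<bar>x' i\<bar> \<le> 1"
        proof (cases "i < j")
          case True
          then have "x' i = frac (x i)" using x'(2) by simp
          then show ?thesis using frac_ge_0[of "x i"] frac_lt_1[of "x i"] by linarith
        next
          case False
          then have "x' i = x i" using x'(2) by simp
          then show ?thesis using x(2)[of i] x(3) \<open>x j < 1\<close> False by (cases "i = j") auto
        qed
      qed (use x'(1) x'(2)[of j] x(3) \<open>x j \<noteq> 0\<close> in \<open>auto simp: x'(2) x(2)\<close>)
      then show False using wmin[of x'] x'(2)[of j] x(4) by simp
    qed
    obtain s where s: "\<phi> w = unit_exp s" using norm[OF w(1)] unit_exp_surj by blast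
    \<comment> \<open>Changing only coordinate j preserves the formula on elements whose j-th
      coordinate vanishes. The correction is chosen to give w the exponent s; exponents are real, so
      division by \<open>w j\<close> is harmless.\<close>
    define \<kappa>' where "\<kappa>' = \<kappa>(j := \<kappa> j + (s - (\<Sum>i<d. \<kappa> i * w i)) / w j)"
    have sum': "(\<Sum>i<d. \<kappa>' i * v i) = (\<Sum>i<d. \<kappa> i * v i) + (s - (\<Sum>i<d. \<kappa> i * w i)) / w j * v j" for v
    proof -
      have "(\<Sum>i<d. \<kappa>' i * v i) = (\<Sum>i<d. \<kappa> i * v i + (if i = j then (s - (\<Sum>i<d. \<kappa> i * w i)) / w j * v j else 0))"
        by (intro sum.cong) (auto simp: \<kappa>'_def distrib_right)
      then show ?thesis using jd by (simp add: sum.distrib)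
    qed
    \<comment> \<open>The quotient of \<phi> by the candidate character, to be shown equal to 1 on
      multiples of w and on the smaller subgroup.\<close>
    define f where "f v = \<phi> v * unit_exp (- (\<Sum>i<d. \<kappa>' i * v i))" for v
    have f_add: "f (\<lambda>i. v i + u i) = f v * f u" if "v \<in> L" "u \<in> L" for v u
      using hom[OF that] by (simp add: f_def distrib_left sum.distrib unit_exp_add unit_exp_diff)
    have "f w = 1"
      using w(2) s unit_exp_minus(1)[of s] by (simp add: f_def sum')
    have f_int: "f (\<lambda>i. of_int z * w i) = 1" for z
    proof (induction z rule: int_induct[where k = 0])
      case base
      have "f (\<lambda>i. of_int 0 * w i) * f w = f w" using f_add[OF smult[OF w(1), of 0] w(1)] by simp
      then show ?case using \<open>f w = 1\<close> by simp
    next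
      case (step1 i)
      then show ?case using f_add[OF smult[OF w(1), of i] w(1)] \<open>f w = 1\<close> by (simp add: distrib_right)
    next
      case (step2 i)
      then show ?case using f_add[OF smult[OF w(1), of "i - 1"] w(1)] \<open>f w = 1\<close> by (simp add: left_diff_distrib)
    qed
    have "\<phi> x = unit_exp (\<Sum>i<d. \<kappa>' i * x i)" if x: "x \<in> L" "\<forall>i\<ge>Suc j. x i = 0" for x
    proof -
      \<comment> \<open>Division with remainder in coordinate j: the remainder y has
        \<open>y j\<close> in [0, \<open>w j\<close>), hence \<open>y j\<close> = 0 by
        \<open>gap\<close>.\<close>
      define z where "z = \<lfloor>x j / w j\<rfloor>"
      define y where "y = (\<lambda>i. x i - of_int z * w i)"
      have zw: "(\<lambda>i. of_int z * w i) \<in> L" by (rule smult[OF w(1)])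
      have yL: "y \<in> L" unfolding y_def by (rule diff[OF x(1) zw])
      have y0: "y i = 0" if "i > j" for i using that x(2) w(3) by (simp add: y_def)
      have "of_int z \<le> x j / w j" "x j / w j < of_int z + 1"
        unfolding z_def by linarith+
      then have "of_int z * w j \<le> x j" "x j < (of_int z + 1) * w j"
        using w(2) by (simp_all only: pos_le_divide_eq pos_divide_less_eq)
      then have "y j = 0" by (intro gap[OF yL y0]) (auto simp: y_def algebra_simps)
      then have y0': "\<forall>i\<ge>j. y i = 0" using y0 by (metis le_neq_implies_less)
      have "f y = 1"
        using \<kappa>[OF yL y0'] \<open>y j = 0\<close> by (simp add: f_def sum' unit_exp_minus)
      have "x = (\<lambda>i. y i + of_int z * w i)" by (simp add: y_def)
      then have "f x = 1" using f_add[OF yL zw] f_int \<open>f y = 1\<close> by simp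
      then have "\<phi> x * (unit_exp (- (\<Sum>i<d. \<kappa>' i * x i)) * unit_exp (\<Sum>i<d. \<kappa>' i * x i)) =
          unit_exp (\<Sum>i<d. \<kappa>' i * x i)"
        unfolding f_def by (simp add: mult.assoc[symmetric])
      then show ?thesis by (simp add: unit_exp_minus)
    qed
    then show ?case by blast
  qed
  from this[of d] obtain \<kappa> where "\<forall>v\<in>L. (\<forall>i\<ge>d. v i = 0) \<longrightarrow> \<phi> v = unit_exp (\<Sum>i<d. \<kappa> i * v i)"
    by blast
  then show thesis using that supp by blast
qed

section \<open>Space groups\<close>

lemma orthogonal_matsD:
  assumes "A \<in> orthogonal_mats d"
  shows "A \<in> carrier_mat d d" "A * A\<^sup>T = 1\<^sub>m d" "A\<^sup>T * A = 1\<^sub>m d"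
proof -
  show *: "A \<in> carrier_mat d d" "A * A\<^sup>T = 1\<^sub>m d" using assms by (auto simp: orthogonal_mats_def)
  show "A\<^sup>T * A = 1\<^sub>m d" by (rule mat_mult_left_right_inverse[OF *(1) _ *(2)]) (use * in simp)
qed

lemma orthogonal_mats_transpose: "A \<in> orthogonal_mats d \<Longrightarrow> A\<^sup>T \<in> orthogonal_mats d"
  using orthogonal_matsD(1,3)[of A d] by (simp add: orthogonal_mats_def)

lemma orthogonal_mats_mult:
  assumes "A \<in> orthogonal_mats d" "B \<in> orthogonal_mats d"
  shows "A * B \<in> orthogonal_mats d"
proof -
  note A = orthogonal_matsD[OF assms(1)] and B = orthogonal_matsD[OF assms(2)]
  have "(A * B) * (A * B)\<^sup>T = A * (B * B\<^sup>T) * A\<^sup>T"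
    using A(1) B(1) by (simp add: transpose_mult[of _ d d _ d] assoc_mult_mat[of _ d d _ d _ d]
        mult_carrier_mat[of _ d d _ d])
  also have "\<dots> = 1\<^sub>m d" using A B by simp
  finally show ?thesis using A(1) B(1) by (auto simp: orthogonal_mats_def)
qed

lemma orthogonal_mats_one: "1\<^sub>m d \<in> orthogonal_mats d"
  by (simp add: orthogonal_mats_def)

lemma Euc_simps [simp]:
  "(A, b) \<otimes>\<^bsub>Euc d\<^esub> (A', b') = (A * A', b + A *\<^sub>v b')"
  "\<one>\<^bsub>Euc d\<^esub> = (1\<^sub>m d, 0\<^sub>v d)"
  "(A, b) \<in> carrier (Euc d) \<longleftrightarrow> A \<in> orthogonal_mats d \<and> b \<in> carrier_vec d"
  by (auto simp: Euc_def)

lemma group_Euc: "group (Euc d)"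
proof (rule groupI)
  fix x y assume "x \<in> carrier (Euc d)" "y \<in> carrier (Euc d)"
  then show "x \<otimes>\<^bsub>Euc d\<^esub> y \<in> carrier (Euc d)"
    by (cases x; cases y) (auto intro: orthogonal_mats_mult dest: orthogonal_matsD(1))
next
  fix x y z assume xyz: "x \<in> carrier (Euc d)" "y \<in> carrier (Euc d)" "z \<in> carrier (Euc d)"
  obtain A a B b C c where e: "x = (A, a)" "y = (B, b)" "z = (C, c)" by (metis surj_pair)
  have "A \<in> carrier_mat d d" "B \<in> carrier_mat d d" "C \<in> carrier_mat d d"
    "a \<in> carrier_vec d" "b \<in> carrier_vec d" "c \<in> carrier_vec d"
    using xyz by (auto simp: e dest: orthogonal_matsD(1))
  then show "x \<otimes>\<^bsub>Euc d\<^esub> y \<otimes>\<^bsub>Euc d\<^esub> z = x \<otimes>\<^bsub>Euc d\<^esub> (y \<otimes>\<^bsub>Euc d\<^esub> z)"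
    by (simp add: e assoc_mult_mat[of _ d d _ d _ d] mult_add_distrib_mat_vec[of _ d d]
        assoc_mult_mat_vec[of _ d d _ d] assoc_add_vec[of _ d])
next
  fix x assume x: "x \<in> carrier (Euc d)"
  obtain A a where e: "x = (A, a)" by (cases x)
  have "A \<in> orthogonal_mats d" "a \<in> carrier_vec d" using x by (auto simp: e)
  note A = orthogonal_matsD[OF this(1)] orthogonal_mats_transpose[OF this(1)] this(2)
  show "\<exists>y\<in>carrier (Euc d). y \<otimes>\<^bsub>Euc d\<^esub> x = \<one>\<^bsub>Euc d\<^esub>"
    using A by (intro bexI[of _ "(A\<^sup>T, - (A\<^sup>T *\<^sub>v a))"]) (auto simp: e)
qed (auto simp: orthogonal_mats_one left_mult_one_mat[OF orthogonal_matsD(1)])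

lemma inv_Euc:
  assumes "(A, a) \<in> carrier (Euc d)"
  shows "inv\<^bsub>Euc d\<^esub> (A, a) = (A\<^sup>T, - (A\<^sup>T *\<^sub>v a))"
proof -
  have "A \<in> orthogonal_mats d" "a \<in> carrier_vec d" using assms by auto
  note A = orthogonal_matsD[OF this(1)] orthogonal_mats_transpose[OF this(1)] this(2)
  show ?thesis
    using A assms by (intro group.inv_equality[OF group_Euc]) auto
qed

lemma orthogonal_mats_scalar_prod:
  assumes "A \<in> orthogonal_mats d" "v \<in> carrier_vec d" "w \<in> carrier_vec d"
  shows "(A *\<^sub>v v) \<bullet> w = v \<bullet> (A\<^sup>T *\<^sub>v w)" "(A *\<^sub>v v) \<bullet> (A *\<^sub>v w) = v \<bullet> w"
proof -
  note A = orthogonal_matsD[OF assms(1)]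
  have *: "(A *\<^sub>v v) \<bullet> w = v \<bullet> (A\<^sup>T *\<^sub>v w)" if "w \<in> carrier_vec d" for w
    using transpose_vec_mult_scalar[of "A\<^sup>T" d d w v] A(1) assms(2) that by simp
  show "(A *\<^sub>v v) \<bullet> w = v \<bullet> (A\<^sup>T *\<^sub>v w)" using *[OF assms(3)] .
  have "A\<^sup>T *\<^sub>v (A *\<^sub>v w) = w"
    using A assms(3) assoc_mult_mat_vec[of "A\<^sup>T" d d A d w] by simp
  then show "(A *\<^sub>v v) \<bullet> (A *\<^sub>v w) = v \<bullet> w" using *[of "A *\<^sub>v w"] A(1) assms(3) by simp
qed

section \<open>The translation lattice and the finite point group\<close>

locale space_group_lattice =
  fixes d :: nat and S :: "isom set"
  assumes space_group: "space_group d S"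
begin

lemma subgroup: "subgroup S (Euc d)"
  using space_group by (simp add: space_group_def discrete_subgroup_def)

abbreviation L :: "real vec set" where "L \<equiv> snd ` trans_subgroup d S"

lemma mem_carrier: "(A, b) \<in> S \<Longrightarrow> A \<in> orthogonal_mats d \<and> b \<in> carrier_vec d"
  using subgroup.subset[OF subgroup] by auto

lemma L_iff: "v \<in> L \<longleftrightarrow> (1\<^sub>m d, v) \<in> S"
  by (force simp: trans_subgroup_def)

lemma L_carrier: "v \<in> L \<Longrightarrow> v \<in> carrier_vec d"
  using mem_carrier unfolding L_iff by blast

lemma L_zero: "0\<^sub>v d \<in> L"
  unfolding L_iff using subgroup.one_closed[OF subgroup] by simp

lemma L_add:
  assumes "v \<in> L" "w \<in> L" shows "v + w \<in> L"
  using subgroup.m_closed[OF subgroup, of "(1\<^sub>m d, v)" "(1\<^sub>m d, w)"] L_carrier[OF assms(1)] L_carrier[OF assms(2)] assms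
  unfolding L_iff by simp

lemma L_uminus:
  assumes "v \<in> L" shows "- v \<in> L"
  using subgroup.m_inv_closed[OF subgroup, of "(1\<^sub>m d, v)"] L_carrier[OF assms] assms
  unfolding L_iff by (simp add: inv_Euc orthogonal_mats_one)

lemma L_diff:
  assumes "v \<in> L" "w \<in> L" shows "v - w \<in> L"
  using L_add[OF assms(1) L_uminus[OF assms(2)]] L_carrier[OF assms(1)] L_carrier[OF assms(2)]
  by (simp add: minus_add_uminus_vec[of _ d])

text \<open>Conjugating the translation by v with (A, b) gives the translation by A v.\<close>

lemma L_action:
  assumes "(A, b) \<in> S" "v \<in> L"
  shows "A *\<^sub>v v \<in> L"
proof -
  have c: "A \<in> orthogonal_mats d" "b \<in> carrier_vec d" using mem_carrier assms by auto
  note A = orthogonal_matsD[OF c(1)] and v = L_carrier[OF assms(2)]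
  have "(A, b) \<otimes>\<^bsub>Euc d\<^esub> (1\<^sub>m d, v) \<otimes>\<^bsub>Euc d\<^esub> inv\<^bsub>Euc d\<^esub> (A, b) \<in> S"
    using assms L_iff subgroup.m_closed[OF subgroup] subgroup.m_inv_closed[OF subgroup] by meson
  moreover have "A *\<^sub>v (A\<^sup>T *\<^sub>v b) = b"
    using A c assoc_mult_mat_vec[of A d d "A\<^sup>T" d b] by simp
  moreover have "A *\<^sub>v (- u) = - (A *\<^sub>v u)" if "u \<in> carrier_vec d" for u
    using A(1) that by (intro eq_vecI) auto
  moreover have "b + u + - b = u" if "u \<in> carrier_vec d" for u
    using c(2) that by (intro eq_vecI) auto
  ultimately show ?thesis using A c v unfolding L_iff by (simp add: inv_Euc)
qed

lemma L_discrete: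
  obtains \<epsilon> where "\<epsilon> > 0" "\<And>v. v \<in> L \<Longrightarrow> (\<And>i. i < d \<Longrightarrow> \<bar>v $ i\<bar> < \<epsilon>) \<Longrightarrow> v = 0\<^sub>v d"
proof -
  have "discrete_in_Euc d S" using space_group by (simp add: space_group_def discrete_subgroup_def)
  moreover have "(1\<^sub>m d, 0\<^sub>v d) \<in> S" using L_zero L_iff by simp
  ultimately obtain \<epsilon> where e: "\<epsilon> > 0" "\<And>A b. (A, b) \<in> S \<Longrightarrow>
      (\<forall>i<d. \<forall>j<d. \<bar>A $$ (i, j) - 1\<^sub>m d $$ (i, j)\<bar> < \<epsilon>) \<Longrightarrow> (\<forall>i<d. \<bar>b $ i - 0\<^sub>v d $ i\<bar> < \<epsilon>) \<Longrightarrow>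
      (A, b) = (1\<^sub>m d, 0\<^sub>v d)"
    unfolding discrete_in_Euc_def by fast
  have "v = 0\<^sub>v d" if "v \<in> L" "\<And>i. i < d \<Longrightarrow> \<bar>v $ i\<bar> < \<epsilon>" for v
    using e(2)[of "1\<^sub>m d" v] e(1) that L_iff by simp
  with e(1) show thesis by (rule that)
qed

text \<open>Pigeonhole: two lattice vectors in the same cell of side \<open>\<epsilon>\<close> differ by a lattice vector
  shorter than the minimal distance.\<close>

lemma finite_bounded_L: "finite {v \<in> L. \<forall>i<d. \<bar>v $ i\<bar> \<le> M}"
proof -
  obtain \<epsilon> where e: "\<epsilon> > 0" "\<And>v. v \<in> L \<Longrightarrow> (\<And>i. i < d \<Longrightarrow> \<bar>v $ i\<bar> < \<epsilon>) \<Longrightarrow> v = 0\<^sub>v d"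
    using L_discrete by blast
  define f where "f v = map (\<lambda>i. \<lfloor>v $ i / \<epsilon>\<rfloor>) [0..<d]" for v :: "real vec"
  define K where "K = \<lceil>\<bar>M\<bar> / \<epsilon>\<rceil>"
  let ?B = "{v \<in> L. \<forall>i<d. \<bar>v $ i\<bar> \<le> M}"
  have "f ` ?B \<subseteq> {xs. set xs \<subseteq> {- K - 1..K} \<and> length xs = d}"
  proof (clarsimp simp: f_def simp del: atLeastAtMost_iff)
    fix v i assume v: "\<forall>i<d. \<bar>v $ i\<bar> \<le> M" and i: "i < d"
    have "\<bar>v $ i / \<epsilon>\<bar> \<le> \<bar>M\<bar> / \<epsilon>" using v i e(1) by (auto simp: divide_right_mono intro: order_trans)
    then show "\<lfloor>v $ i / \<epsilon>\<rfloor> \<in> {- K - 1..K}" unfolding K_def atLeastAtMost_iff by linarith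
  qed
  then have "finite (f ` ?B)" by (rule finite_subset) (rule finite_lists_length_eq, simp)
  moreover have "inj_on f ?B"
  proof (rule inj_onI)
    fix v w assume v: "v \<in> ?B" and w: "w \<in> ?B" and eq: "f v = f w"
    note c = L_carrier[of v] L_carrier[of w]
    have "\<bar>(v - w) $ i\<bar> < \<epsilon>" if "i < d" for i
    proof -
      have "\<lfloor>v $ i / \<epsilon>\<rfloor> = \<lfloor>w $ i / \<epsilon>\<rfloor>" using eq that by (auto simp: f_def)
      then have "\<bar>v $ i / \<epsilon> - w $ i / \<epsilon>\<bar> < 1" by linarith
      then have "\<bar>v $ i - w $ i\<bar> / \<epsilon> < 1" using e(1) by (simp add: diff_divide_distrib[symmetric])
      then show ?thesis using c v w that e(1) by simp
    qed
    then have "v - w = 0\<^sub>v d" using e(2)[of "v - w"] L_diff v w by blast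
    then have "(v - w) $ i = 0" if "i < d" for i using that by simp
    then show "v = w" using c v w by (intro eq_vecI) auto
  qed
  ultimately show ?thesis using finite_imageD by blast
qed

text \<open>The columns of \<open>V\<close> are the independent translations from the definition of
  a space group. They span the space but need not generate \<open>L\<close>; they only provide
  coordinates in which \<open>L\<close> contains all integer vectors.\<close>

lemma L_basis:
  obtains V B where "V \<in> carrier_mat d d" "B \<in> carrier_mat d d" "V * B = 1\<^sub>m d" "B * V = 1\<^sub>m d"
    "\<And>j. j < d \<Longrightarrow> col V j \<in> L"
proof -
  interpret vec_space "TYPE(real)" d .
  obtain X where X: "X \<subseteq> L" "finite X" "card X = d" "\<not> lin_dep X"
    using space_group by (auto simp: space_group_def)
  obtain xs where xs: "set xs = X" "distinct xs" using finite_distinct_list[OF X(2)] by blast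
  have len: "length xs = d" using xs X(3) distinct_card by fastforce
  have xc: "set xs \<subseteq> carrier_vec d" using xs X(1) L_carrier by blast
  define V where "V = mat_of_cols d xs"
  have V: "V \<in> carrier_mat d d" using len by (auto simp: V_def)
  have cols: "cols V = xs" using xc by (simp add: V_def)
  have "rank V = d"
    by (rule lin_indpt_full_rank[OF V]) (use cols xs X(4) in auto)
  then have "det V \<noteq> 0" using det_rank_iff[OF V] by simp
  from det_non_zero_imp_unit[OF V this, of "()"] obtain B
    where "B \<in> carrier_mat d d" "B * V = 1\<^sub>m d" "V * B = 1\<^sub>m d"
    by (auto simp: Units_def ring_mat_def)
  moreover have "col V j \<in> L" if "j < d" for j
    using cols_nth[of j V] V that cols xs X(1) len by (metis carrier_matD(2) nth_mem subsetD)
  ultimately show thesis using that V by blast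
qed

text \<open>A linear part is determined by its values on the columns of \<open>V\<close>. It
  preserves \<open>L\<close> and lengths, so these values lie in a bounded, hence finite, part of
  \<open>L\<close>.\<close>

lemma finite_point_group: "finite (fst ` S)"
proof -
  obtain V B where V: "V \<in> carrier_mat d d" and B: "B \<in> carrier_mat d d" "V * B = 1\<^sub>m d"
    and cV: "\<And>j. j < d \<Longrightarrow> col V j \<in> L"
    using L_basis by metis
  \<comment> \<open>The sum of the nonnegative column lengths dominates each of them, and it is
    defined for d = 0 as well.\<close>
  define M where "M = (\<Sum>j<d. sqrt (col V j \<bullet> col V j))"
  let ?F = "{v \<in> L. \<forall>i<d. \<bar>v $ i\<bar> \<le> M}"
  define f where "f A = map (\<lambda>j. A *\<^sub>v col V j) [0..<d]" for A :: "real mat"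
  have "A *\<^sub>v col V j \<in> ?F" if "(A, b) \<in> S" "j < d" for A b j
  proof -
    have A: "A \<in> orthogonal_mats d" using mem_carrier that(1) by blast
    have vc: "col V j \<in> carrier_vec d" by (rule carrier_vecI) (use V in simp)
    have "\<bar>(A *\<^sub>v col V j) $ i\<bar> \<le> M" if i: "i < d" for i
    proof -
      let ?w = "A *\<^sub>v col V j"
      have wc: "?w \<in> carrier_vec d" using orthogonal_matsD(1)[OF A] vc by simp
      have "(?w $ i)\<^sup>2 \<le> (\<Sum>i<d. (?w $ i)\<^sup>2)" using i by (intro member_le_sum) auto
      also have "\<dots> = ?w \<bullet> ?w"
        unfolding scalar_prod_def carrier_vecD[OF wc] power2_eq_square lessThan_atLeast0 ..
      also have "\<dots> = col V j \<bullet> col V j" using orthogonal_mats_scalar_prod(2)[OF A vc vc] .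
      finally have "\<bar>?w $ i\<bar> \<le> sqrt (col V j \<bullet> col V j)" using real_le_rsqrt by (metis power2_abs)
      also have "\<dots> \<le> M" unfolding M_def using \<open>j < d\<close> V
        by (intro member_le_sum) (auto simp: scalar_prod_def intro!: sum_nonneg)
      finally show ?thesis .
    qed
    then show ?thesis using L_action[OF that(1) cV[OF that(2)]] by blast
  qed
  then have "f ` fst ` S \<subseteq> {xs. set xs \<subseteq> ?F \<and> length xs = d}" by (auto simp: f_def)
  then have "finite (f ` fst ` S)"
    by (rule finite_subset) (rule finite_lists_length_eq, rule finite_bounded_L)
  moreover have "inj_on f (fst ` S)"
  proof (rule inj_onI, clarify)
    fix A b A' b' assume S: "(A, b) \<in> S" "(A', b') \<in> S" and "f (fst (A, b)) = f (fst (A', b'))"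
    then have eq: "A *\<^sub>v col V j = A' *\<^sub>v col V j" if "j < d" for j using that by (auto simp: f_def)
    have A: "A \<in> carrier_mat d d" "A' \<in> carrier_mat d d"
      using mem_carrier S orthogonal_matsD(1) by blast+
    have "A * V = A' * V"
    proof (rule mat_col_eqI)
      fix j assume "j < dim_col (A' * V)"
      then have j: "j < d" using V by simp
      show "col (A * V) j = col (A' * V) j"
        unfolding col_mult2[OF A(1) V j] col_mult2[OF A(2) V j] by (rule eq[OF j])
    qed (use A V in auto)
    then have "A * (V * B) = A' * (V * B)"
      using assoc_mult_mat[OF A(1) V B(1)] assoc_mult_mat[OF A(2) V B(1)] by simp
    then show "fst (A, b) = fst (A', b')" using A B by simp
  qed
  ultimately show ?thesis using finite_imageD by blast
qed

text \<open>Transports the coordinate version along \<open>V\<close>: there the columns become unit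
  vectors, and boundedness of coordinates gives boundedness in \<open>L\<close>, hence finiteness of
  the unit box.\<close>

lemma L_character:
  fixes \<phi> :: "real vec \<Rightarrow> complex"
  assumes hom: "\<And>v w. v \<in> L \<Longrightarrow> w \<in> L \<Longrightarrow> \<phi> (v + w) = \<phi> v * \<phi> w"
    and norm: "\<And>v. v \<in> L \<Longrightarrow> cmod (\<phi> v) = 1"
  obtains k where "k \<in> carrier_vec d" "\<And>v. v \<in> L \<Longrightarrow> \<phi> v = unit_exp (k \<bullet> v)"
proof -
  obtain V B where V: "V \<in> carrier_mat d d" and B: "B \<in> carrier_mat d d" and VB: "V * B = 1\<^sub>m d" "B * V = 1\<^sub>m d"
    and cV: "\<And>j. j < d \<Longrightarrow> col V j \<in> L"
    using L_basis by metis
  define w where "w f = V *\<^sub>v vec d f" for f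
  \<comment> \<open>Vanishing from d on makes a function recoverable from \<open>vec d\<close>, so
    this is \<open>L\<close> in the coordinates of \<open>V\<close>.\<close>
  define \<Lambda> where "\<Lambda> = {f. (\<forall>i\<ge>d. f i = 0) \<and> w f \<in> L}"
  have w_add: "w (\<lambda>i. f i + g i) = w f + w g" for f g
  proof -
    have "vec d (\<lambda>i. f i + g i) = vec d f + vec d g" by (intro eq_vecI) auto
    then show ?thesis using V by (simp add: w_def mult_add_distrib_mat_vec[of _ d d])
  qed
  have w_diff: "w (\<lambda>i. f i - g i) = w f - w g" for f g
  proof -
    have "vec d (\<lambda>i. f i - g i) = vec d f - vec d g" by (intro eq_vecI) auto
    then show ?thesis using V by (simp add: w_def mult_minus_distrib_mat_vec[of _ d d])
  qed
  have w_0: "w (\<lambda>i. 0) = 0\<^sub>v d"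
  proof -
    have "vec d (\<lambda>i. 0 :: real) = 0\<^sub>v d" by (intro eq_vecI) auto
    then show ?thesis using V by (intro eq_vecI) (auto simp: w_def scalar_prod_def)
  qed
  have Bw: "B *\<^sub>v w f = vec d f" for f
    using V B VB assoc_mult_mat_vec[of B d d V d "vec d f"] by (simp add: w_def)
  have wB: "w (\<lambda>i. if i < d then (B *\<^sub>v v) $ i else 0) = v" if "v \<in> carrier_vec d" for v
  proof -
    have "vec d (\<lambda>i. if i < d then (B *\<^sub>v v) $ i else 0) = B *\<^sub>v v" using B by (intro eq_vecI) auto
    then show ?thesis using V B VB that assoc_mult_mat_vec[of V d d B d v] by (simp add: w_def)
  qed
  have unit: "(\<lambda>i. if i = j then 1 else 0) \<in> \<Lambda>" if "j < d" for j
  proof -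
    have "vec d (\<lambda>i. if i = j then 1 else 0 :: real) = unit_vec d j" by (intro eq_vecI) (auto simp: that)
    then have "w (\<lambda>i. if i = j then 1 else 0) = col V j"
      using V that by (intro eq_vecI) (auto simp: w_def)
    then show ?thesis using cV that by (auto simp: \<Lambda>_def)
  qed
  have "finite {f \<in> \<Lambda>. \<forall>i<d. \<bar>f i\<bar> \<le> 1}"
  proof -
    define M where "M = (\<Sum>i<d. \<Sum>j<d. \<bar>V $$ (i, j)\<bar>)"
    have "w ` {f \<in> \<Lambda>. \<forall>i<d. \<bar>f i\<bar> \<le> 1} \<subseteq> {v \<in> L. \<forall>i<d. \<bar>v $ i\<bar> \<le> M}"
    proof (clarify, intro conjI allI impI)
      fix f i assume f: "f \<in> \<Lambda>" "\<forall>i<d. \<bar>f i\<bar> \<le> 1" and i: "i < d"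
      have "\<bar>w f $ i\<bar> = \<bar>\<Sum>j<d. V $$ (i, j) * f j\<bar>"
        using V i by (simp add: w_def scalar_prod_def lessThan_atLeast0)
      also have "\<dots> \<le> (\<Sum>j<d. \<bar>V $$ (i, j)\<bar>)"
        using f(2) by (intro order_trans[OF sum_abs] sum_mono) (auto simp: abs_mult intro: mult_left_le)
      also have "\<dots> \<le> M" unfolding M_def
        using i by (intro member_le_sum[where f = "\<lambda>i. \<Sum>j<d. \<bar>V $$ (i, j)\<bar>"]) (auto intro: sum_nonneg)
      finally show "\<bar>w f $ i\<bar> \<le> M" .
    qed (auto simp: \<Lambda>_def)
    then have "finite (w ` {f \<in> \<Lambda>. \<forall>i<d. \<bar>f i\<bar> \<le> 1})" using finite_bounded_L finite_subset by blast
    moreover have "inj_on w {f \<in> \<Lambda>. \<forall>i<d. \<bar>f i\<bar> \<le> 1}"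
    proof (rule inj_onI)
      fix f g assume fg: "f \<in> {f \<in> \<Lambda>. \<forall>i<d. \<bar>f i\<bar> \<le> 1}" "g \<in> {f \<in> \<Lambda>. \<forall>i<d. \<bar>f i\<bar> \<le> 1}" "w f = w g"
      then have "vec d f = vec d g" using Bw by metis
      then have "f i = g i" if "i < d" for i using that by (metis index_vec)
      moreover have "f i = g i" if "\<not> i < d" for i using fg that by (auto simp: \<Lambda>_def)
      ultimately show "f = g" by blast
    qed
    ultimately show ?thesis using finite_imageD by blast
  qed
  note fin = this
  have mem: "f \<in> \<Lambda> \<Longrightarrow> w f \<in> L" for f by (simp add: \<Lambda>_def)
  have "(\<lambda>i. 0) \<in> \<Lambda>" using w_0 L_zero by (simp add: \<Lambda>_def)
  moreover have "(\<lambda>i. f i + g i) \<in> \<Lambda>" if "f \<in> \<Lambda>" "g \<in> \<Lambda>" for f g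
    using that L_add[OF mem[OF that(1)] mem[OF that(2)]] unfolding \<Lambda>_def mem_Collect_eq w_add by simp
  moreover have "(\<lambda>i. f i - g i) \<in> \<Lambda>" if "f \<in> \<Lambda>" "g \<in> \<Lambda>" for f g
    using that L_diff[OF mem[OF that(1)] mem[OF that(2)]] unfolding \<Lambda>_def mem_Collect_eq w_diff by simp
  moreover have "f i = 0" if "f \<in> \<Lambda>" "d \<le> i" for f i using that by (simp add: \<Lambda>_def)
  moreover have "\<phi> (w (\<lambda>i. f i + g i)) = \<phi> (w f) * \<phi> (w g)" if "f \<in> \<Lambda>" "g \<in> \<Lambda>" for f g
    unfolding w_add by (rule hom[OF mem[OF that(1)] mem[OF that(2)]])
  moreover have "cmod (\<phi> (w f)) = 1" if "f \<in> \<Lambda>" for f by (rule norm[OF mem[OF that]])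
  ultimately obtain \<kappa> where \<kappa>: "\<And>f. f \<in> \<Lambda> \<Longrightarrow> \<phi> (w f) = unit_exp (\<Sum>i<d. \<kappa> i * f i)"
    using coordinate_lattice_character[of \<Lambda> d "\<lambda>f. \<phi> (w f)"] unit fin by blast
  \<comment> \<open>The exponent pairs \<kappa> with the coordinates \<open>B *\<^sub>v v\<close>;
    moving \<open>B\<close> to the other side of the scalar product transposes it.\<close>
  define k where "k = B\<^sup>T *\<^sub>v vec d \<kappa>"
  have "k \<in> carrier_vec d" using B by (simp add: k_def)
  moreover have "\<phi> v = unit_exp (k \<bullet> v)" if v: "v \<in> L" for v
  proof -
    note vc = L_carrier[OF v]
    let ?f = "\<lambda>i. if i < d then (B *\<^sub>v v) $ i else 0"
    have "?f \<in> \<Lambda>" using wB[OF vc] v by (simp add: \<Lambda>_def)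
    then have "\<phi> v = unit_exp (\<Sum>i<d. \<kappa> i * ?f i)" using \<kappa> wB[OF vc] by fastforce
    also have "(\<Sum>i<d. \<kappa> i * ?f i) = vec d \<kappa> \<bullet> (B *\<^sub>v v)"
      using B vc by (simp add: scalar_prod_def lessThan_atLeast0)
    also have "\<dots> = k \<bullet> v"
      unfolding k_def using transpose_vec_mult_scalar[OF B vc, of "vec d \<kappa>"] by simp
    finally show ?thesis .
  qed
  ultimately show thesis by (rule that)
qed

end

section \<open>The extension of a space group\<close>

lemma osum_mult:
  assumes A: "A \<in> carrier_mat d\<^sub>1 d\<^sub>1" "A' \<in> carrier_mat d\<^sub>1 d\<^sub>1"
    and g: "g \<in> carrier (Euc d\<^sub>2)" "g' \<in> carrier (Euc d\<^sub>2)"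
  shows "osum A g \<otimes>\<^bsub>Euc (d\<^sub>1 + d\<^sub>2)\<^esub> osum A' g' = osum (A * A') (g \<otimes>\<^bsub>Euc d\<^sub>2\<^esub> g')"
proof -
  obtain B b B' b' where e: "g = (B, b)" "g' = (B', b')" by (metis surj_pair)
  have c: "B \<in> carrier_mat d\<^sub>2 d\<^sub>2" "B' \<in> carrier_mat d\<^sub>2 d\<^sub>2" "b \<in> carrier_vec d\<^sub>2" "b' \<in> carrier_vec d\<^sub>2"
    using g by (auto simp: e dest: orthogonal_matsD(1))
  have "four_block_mat A (0\<^sub>m d\<^sub>1 d\<^sub>2) (0\<^sub>m d\<^sub>2 d\<^sub>1) B * four_block_mat A' (0\<^sub>m d\<^sub>1 d\<^sub>2) (0\<^sub>m d\<^sub>2 d\<^sub>1) B' =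
      four_block_mat (A * A') (0\<^sub>m d\<^sub>1 d\<^sub>2) (0\<^sub>m d\<^sub>2 d\<^sub>1) (B * B')"
    using A c by (subst mult_four_block_mat[of _ d\<^sub>1 d\<^sub>1 _ d\<^sub>2 _ d\<^sub>2]) (auto simp: mult_carrier_mat[of _ _ d\<^sub>1] mult_carrier_mat[of _ _ d\<^sub>2])
  moreover have "(0\<^sub>v d\<^sub>1 @\<^sub>v b) + four_block_mat A (0\<^sub>m d\<^sub>1 d\<^sub>2) (0\<^sub>m d\<^sub>2 d\<^sub>1) B *\<^sub>v (0\<^sub>v d\<^sub>1 @\<^sub>v b') =
      0\<^sub>v d\<^sub>1 @\<^sub>v (b + B *\<^sub>v b')"
  proof -
    have "four_block_mat A (0\<^sub>m d\<^sub>1 d\<^sub>2) (0\<^sub>m d\<^sub>2 d\<^sub>1) B *\<^sub>v (0\<^sub>v d\<^sub>1 @\<^sub>v b') = A *\<^sub>v 0\<^sub>v d\<^sub>1 @\<^sub>v B *\<^sub>v b'"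
      using A c by (intro mult_mat_vec_split) auto
    moreover have "A *\<^sub>v 0\<^sub>v d\<^sub>1 = 0\<^sub>v d\<^sub>1" using A by (intro eq_vecI) (auto simp: scalar_prod_def)
    ultimately show ?thesis using c by (intro eq_vecI) auto
  qed
  ultimately show ?thesis using A c by (simp add: osum_def e)
qed

locale osum_space_group = space_group_lattice d\<^sub>2 S for d\<^sub>2 S +
  fixes d\<^sub>1 :: nat and G T :: "isom set"
  assumes G_subgroup: "subgroup G (Euc (d\<^sub>1 + d\<^sub>2))"
    and G_osum: "G \<subseteq> osum_set d\<^sub>1 S"
    and proj_G: "proj d\<^sub>1 d\<^sub>2 ` G = S"
    and T_G: "T \<subseteq> G"
    and proj_T: "bij_betw (proj d\<^sub>1 d\<^sub>2) T (trans_subgroup d\<^sub>2 S)"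
begin

abbreviation "E \<equiv> Euc (d\<^sub>1 + d\<^sub>2)"
abbreviation "EG \<equiv> E\<lparr>carrier := G\<rparr>"
abbreviation "K \<equiv> TF d\<^sub>1 d\<^sub>2 G T"
abbreviation "EK \<equiv> E\<lparr>carrier := K\<rparr>"
abbreviation "p \<equiv> proj d\<^sub>1 d\<^sub>2"
abbreviation "rot x \<equiv> fst (p x)"
abbreviation "tau x \<equiv> snd (p x)"

sublocale E: group E by (rule group_Euc)

sublocale EG: group EG using subgroup.subgroup_is_group[OF G_subgroup E.is_group] .

lemma p_mult:
  assumes "x \<in> G" "y \<in> G"
  shows "p (x \<otimes>\<^bsub>E\<^esub> y) = p x \<otimes>\<^bsub>Euc d\<^sub>2\<^esub> p y"
proof -
  obtain A g where x: "x = osum A g" "A \<in> orthogonal_mats d\<^sub>1" "g \<in> S"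
    using assms(1) G_osum by (auto simp: osum_set_def)
  obtain B h where y: "y = osum B h" "B \<in> orthogonal_mats d\<^sub>1" "h \<in> S"
    using assms(2) G_osum by (auto simp: osum_set_def)
  have c: "g \<in> carrier (Euc d\<^sub>2)" "h \<in> carrier (Euc d\<^sub>2)"
    using x y subgroup.subset[OF subgroup] by auto
  have "x \<otimes>\<^bsub>E\<^esub> y = osum (A * B) (g \<otimes>\<^bsub>Euc d\<^sub>2\<^esub> h)"
    unfolding x(1) y(1) using x(2) y(2) c by (intro osum_mult) (auto dest: orthogonal_matsD(1))
  then show ?thesis
    using x y c orthogonal_mats_mult group.subgroup_self[OF group_Euc] monoid.m_closed[OF group.is_monoid[OF group_Euc]]
    by (simp add: proj_osum)
qed

sublocale p: group_hom EG "Euc d\<^sub>2" p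
proof (intro group_hom.intro group_hom_axioms.intro EG.is_group group_Euc homI)
  fix x assume "x \<in> carrier EG"
  then show "p x \<in> carrier (Euc d\<^sub>2)" using proj_G subgroup.subset[OF subgroup] by auto
qed (simp add: p_mult)

declare p.hom_inv [simp del]

lemma G_closed [simp]: "x \<in> G \<Longrightarrow> inv\<^bsub>EG\<^esub> x \<in> G" "x \<in> G \<Longrightarrow> y \<in> G \<Longrightarrow> x \<otimes>\<^bsub>E\<^esub> y \<in> G"
  using EG.inv_closed[of x] EG.m_closed[of x y] by auto

lemma inv_EG: "x \<in> G \<Longrightarrow> inv\<^bsub>EG\<^esub> x = inv\<^bsub>E\<^esub> x"
  using E.m_inv_consistent[OF G_subgroup] by simp

lemma rot_orthogonal: "x \<in> G \<Longrightarrow> rot x \<in> orthogonal_mats d\<^sub>2"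
  using p.hom_closed[of x] by (cases "p x") auto

lemma rot_carrier [simp]: "x \<in> G \<Longrightarrow> rot x \<in> carrier_mat d\<^sub>2 d\<^sub>2"
  using rot_orthogonal orthogonal_matsD(1) by blast

lemma tau_carrier [simp]: "x \<in> G \<Longrightarrow> tau x \<in> carrier_vec d\<^sub>2"
  using p.hom_closed[of x] by (cases "p x") auto

lemma rot_mult: "x \<in> G \<Longrightarrow> y \<in> G \<Longrightarrow> rot (x \<otimes>\<^bsub>E\<^esub> y) = rot x * rot y"
  by (cases "p x"; cases "p y") (simp add: p_mult)

lemma tau_mult: "x \<in> G \<Longrightarrow> y \<in> G \<Longrightarrow> tau (x \<otimes>\<^bsub>E\<^esub> y) = tau x + rot x *\<^sub>v tau y"
  by (cases "p x"; cases "p y") (simp add: p_mult)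

lemma p_inv: "x \<in> G \<Longrightarrow> p (inv\<^bsub>EG\<^esub> x) = ((rot x)\<^sup>T, - ((rot x)\<^sup>T *\<^sub>v tau x))"
  using p.hom_inv[of x] p.hom_closed[of x] by (cases "p x") (simp add: inv_Euc)

lemma rot_inv: "x \<in> G \<Longrightarrow> rot (inv\<^bsub>EG\<^esub> x) = (rot x)\<^sup>T"
  by (simp add: p_inv)

lemma tau_L:
  assumes "x \<in> G" "rot x = 1\<^sub>m d\<^sub>2" shows "tau x \<in> L"
proof -
  have "p x \<in> S" using assms(1) proj_G by blast
  then show ?thesis unfolding L_iff using assms(2) by (metis prod.collapse)
qed

section \<open>Lifts of translations and the normal subgroup of finite index\<close>

lemma T_p: "t \<in> T \<Longrightarrow> p t \<in> trans_subgroup d\<^sub>2 S"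
  using proj_T by (auto simp: bij_betw_def)

lemma T_rot: "t \<in> T \<Longrightarrow> rot t = 1\<^sub>m d\<^sub>2"
  using T_p by (auto simp: trans_subgroup_def)

lemma T_lift:
  assumes "v \<in> L" obtains t where "t \<in> T" "tau t = v"
proof -
  have "(1\<^sub>m d\<^sub>2, v) \<in> p ` T" using assms proj_T L_iff by (auto simp: bij_betw_def trans_subgroup_def)
  then show thesis using that by (metis imageE snd_conv)
qed

lemma T_tau_inj: "t \<in> T \<Longrightarrow> t' \<in> T \<Longrightarrow> tau t = tau t' \<Longrightarrow> t = t'"
  using proj_T T_rot unfolding bij_betw_def inj_on_def by (metis prod.collapse)

text \<open>Describes \<open>K\<close> as the kernel of the linear part, from which normality and
  finite index can be read off. Given x, the factor in \<open>T\<close> is the lift of its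
  translation, and the quotient lies in the kernel of \<pi>.\<close>

lemma K_eq: "K = {x \<in> G. rot x = 1\<^sub>m d\<^sub>2}"
proof (intro subset_antisym subsetI)
  fix x assume "x \<in> K"
  then obtain t f where t: "t \<in> T" and f: "f \<in> G" "p f = (1\<^sub>m d\<^sub>2, 0\<^sub>v d\<^sub>2)" and x: "x = t \<otimes>\<^bsub>E\<^esub> f"
    by (auto simp: TF_def set_mult_def kernel_def)
  have "x \<in> G" using subgroup.m_closed[OF G_subgroup] t f T_G x by blast
  moreover have "rot x = 1\<^sub>m d\<^sub>2" using rot_mult[of t f] t f T_G x T_rot by auto
  ultimately show "x \<in> {x \<in> G. rot x = 1\<^sub>m d\<^sub>2}" by simp
next
  fix x assume "x \<in> {x \<in> G. rot x = 1\<^sub>m d\<^sub>2}"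
  then have x: "x \<in> G" "rot x = 1\<^sub>m d\<^sub>2" by auto
  obtain t where t: "t \<in> T" "tau t = tau x" using T_lift[OF tau_L[OF x]] by blast
  have tG: "t \<in> G" using t(1) T_G by blast
  have pt: "p t = p x" using t T_rot[OF t(1)] x(2) by (simp add: prod_eq_iff)
  define f where "f = inv\<^bsub>EG\<^esub> t \<otimes>\<^bsub>E\<^esub> x"
  have fG: "f \<in> G" using EG.m_closed[of "inv\<^bsub>EG\<^esub> t" x] tG x by (simp add: f_def)
  have "p f = inv\<^bsub>Euc d\<^sub>2\<^esub> p t \<otimes>\<^bsub>Euc d\<^sub>2\<^esub> p x"
    unfolding f_def using EG.inv_closed[of t] p.hom_inv[of t] tG x(1) by (subst p_mult) auto
  also have "\<dots> = \<one>\<^bsub>Euc d\<^sub>2\<^esub>"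
    unfolding pt using p.hom_closed[of x] x(1) by (intro group.l_inv[OF group_Euc]) simp
  finally have "f \<in> kernel EG (Euc d\<^sub>2) p" using fG by (simp add: kernel_def)
  moreover have "x = t \<otimes>\<^bsub>E\<^esub> f"
    using EG.inv_mult_cancel(1)[of t x] tG x by (simp add: f_def)
  ultimately show "x \<in> K" using t(1) by (auto simp: TF_def set_mult_def)
qed

lemma K_G: "x \<in> K \<Longrightarrow> x \<in> G" and K_rot: "x \<in> K \<Longrightarrow> rot x = 1\<^sub>m d\<^sub>2"
  by (auto simp: K_eq)

lemma T_K: "T \<subseteq> K"
  using T_G T_rot by (auto simp: K_eq)

lemma K_subgroup: "subgroup K EG"
proof (rule EG.subgroupI)
  have "\<one>\<^bsub>EG\<^esub> \<in> K" unfolding K_eq using EG.one_closed p.hom_one by simp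
  then show "K \<noteq> {}" by blast
  fix x assume x: "x \<in> K"
  then show "inv\<^bsub>EG\<^esub> x \<in> K"
    using EG.inv_closed[of x] rot_inv[of x] by (simp add: K_eq)
  fix y assume y: "y \<in> K"
  then show "x \<otimes>\<^bsub>EG\<^esub> y \<in> K"
    using x EG.m_closed[of x y] rot_mult[of x y] by (simp add: K_eq)
qed (auto simp: K_eq)

sublocale K: normal K EG
proof -
  have "x \<otimes>\<^bsub>EG\<^esub> h \<otimes>\<^bsub>EG\<^esub> inv\<^bsub>EG\<^esub> x \<in> K" if x: "x \<in> carrier EG" and h: "h \<in> K" for x h
  proof -
    have G: "x \<in> G" "h \<in> G" "inv\<^bsub>EG\<^esub> x \<in> G" "x \<otimes>\<^bsub>E\<^esub> h \<in> G"
      using x K_G[OF h] EG.inv_closed[of x] EG.m_closed[of x h] by auto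
    have "rot (x \<otimes>\<^bsub>E\<^esub> h \<otimes>\<^bsub>E\<^esub> inv\<^bsub>EG\<^esub> x) = rot x * rot h * (rot x)\<^sup>T"
      using G by (simp add: rot_mult rot_inv)
    also have "\<dots> = 1\<^sub>m d\<^sub>2"
      using K_rot[OF h] orthogonal_matsD[OF rot_orthogonal[OF G(1)]] by simp
    finally show ?thesis using EG.m_closed[of "x \<otimes>\<^bsub>E\<^esub> h" "inv\<^bsub>EG\<^esub> x"] G by (simp add: K_eq)
  qed
  then show "K \<lhd> EG" using EG.normal_inv_iff K_subgroup by blast
qed

sublocale EK: group EK
  using subgroup.subgroup_is_group[OF K_subgroup EG.is_group] by simp

text \<open>The linear part separates the cosets of \<open>K\<close> and takes values in the finite
  point group.\<close>

lemma transversal: obtains hs where "left_transversal EG K hs"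
proof (rule EG.left_transversal_exists[OF K_subgroup, of rot])
  have "rot ` carrier EG = fst ` S" using proj_G by force
  then show "finite (rot ` carrier EG)" using finite_point_group by simp
next
  fix x y assume "x \<in> carrier EG" "y \<in> carrier EG"
  then have G: "x \<in> G" "y \<in> G" "inv\<^bsub>EG\<^esub> x \<in> G" using EG.inv_closed[of x] by auto
  note A = orthogonal_matsD[OF rot_orthogonal[OF G(1)]] and B = orthogonal_matsD[OF rot_orthogonal[OF G(2)]]
  have r: "rot (inv\<^bsub>EG\<^esub> x \<otimes>\<^bsub>E\<^esub> y) = (rot x)\<^sup>T * rot y" using G by (simp add: rot_mult rot_inv)
  have "rot x = rot y \<longleftrightarrow> (rot x)\<^sup>T * rot y = 1\<^sub>m d\<^sub>2"
  proof
    assume "(rot x)\<^sup>T * rot y = 1\<^sub>m d\<^sub>2"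
    then have "rot x * ((rot x)\<^sup>T * rot y) = rot x" using A by simp
    moreover have "rot x * ((rot x)\<^sup>T * rot y) = rot x * (rot x)\<^sup>T * rot y"
      using A(1) B(1) by (intro assoc_mult_mat[symmetric]) auto
    ultimately show "rot x = rot y" using A B by simp
  qed (use A in simp)
  then show "rot x = rot y \<longleftrightarrow> inv\<^bsub>EG\<^esub> x \<otimes>\<^bsub>EG\<^esub> y \<in> K"
    using EG.m_closed[of "inv\<^bsub>EG\<^esub> x" y] G by (simp add: K_eq r)
qed

lemma tau_mult_K: "x \<in> K \<Longrightarrow> y \<in> G \<Longrightarrow> tau (x \<otimes>\<^bsub>E\<^esub> y) = tau x + tau y"
  using tau_mult[of x y] K_rot[of x] K_G[of x] by simp

text \<open>The translation part of g enters twice with opposite signs and cancels, because x has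
  trivial linear part.\<close>

lemma tau_conj:
  assumes g: "g \<in> G" and x: "x \<in> K"
  shows "tau (inv\<^bsub>EG\<^esub> g \<otimes>\<^bsub>E\<^esub> x \<otimes>\<^bsub>E\<^esub> g) = (rot g)\<^sup>T *\<^sub>v tau x"
proof -
  have G: "inv\<^bsub>EG\<^esub> g \<in> G" "x \<in> G" "inv\<^bsub>EG\<^esub> g \<otimes>\<^bsub>E\<^esub> x \<in> G"
    using g K_G[OF x] EG.inv_closed[of g] EG.m_closed[of "inv\<^bsub>EG\<^esub> g" x] by auto
  have c: "(rot g)\<^sup>T \<in> carrier_mat d\<^sub>2 d\<^sub>2" "tau g \<in> carrier_vec d\<^sub>2" "tau x \<in> carrier_vec d\<^sub>2"
    using g G by auto
  let ?a = "(rot g)\<^sup>T *\<^sub>v tau g" and ?b = "(rot g)\<^sup>T *\<^sub>v tau x"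
  have "tau (inv\<^bsub>EG\<^esub> g \<otimes>\<^bsub>E\<^esub> x \<otimes>\<^bsub>E\<^esub> g) = - ?a + ?b + ?a"
    using G g K_rot[OF x] by (simp add: tau_mult rot_mult p_inv right_mult_one_mat[OF c(1)])
  also have "?a \<in> carrier_vec d\<^sub>2" "?b \<in> carrier_vec d\<^sub>2" using c by auto
  then have "- ?a + ?b + ?a = ?b" by (intro eq_vecI) auto
  finally show ?thesis .
qed

text \<open>On \<open>K\<close> the translation part is additive; membership is carried along
  because the induction step uses this additivity.\<close>

lemma tau_pow:
  assumes x: "x \<in> K"
  shows "x [^]\<^bsub>E\<^esub> (n :: nat) \<in> K \<and> tau (x [^]\<^bsub>E\<^esub> n) = real n \<cdot>\<^sub>v tau x"
proof (induction n)
  case 0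
  have "\<one>\<^bsub>E\<^esub> \<in> K" using K.one_closed by simp
  moreover have "0 \<cdot>\<^sub>v tau x = 0\<^sub>v d\<^sub>2" using tau_carrier[OF K_G[OF x]] by (intro eq_vecI) auto
  ultimately show ?case using p.hom_one by simp
next
  case (Suc n)
  have "x [^]\<^bsub>E\<^esub> n \<otimes>\<^bsub>E\<^esub> x \<in> K" using K.m_closed Suc x by auto
  moreover have "real n \<cdot>\<^sub>v tau x + tau x = real (Suc n) \<cdot>\<^sub>v tau x"
    using tau_carrier[OF K_G[OF x]] by (intro eq_vecI) (auto simp: distrib_right)
  ultimately show ?case using Suc x tau_mult_K K_G by simp
qed

lemma pow_set_K: "pow_set (d\<^sub>1 + d\<^sub>2) T n \<subseteq> K"
  using tau_pow T_K by (auto simp: pow_set_def)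

text \<open>The translation part of t^n is n times that of t. For n > 0 it determines the
  translation of t, and hence t, since \<pi> is injective on \<open>T\<close>.\<close>

lemma pow_set_inj:
  assumes "0 < n" "z \<in> pow_set (d\<^sub>1 + d\<^sub>2) T n" "z' \<in> pow_set (d\<^sub>1 + d\<^sub>2) T n" "tau z = tau z'"
  shows "z = z'"
proof -
  obtain t t' where t: "t \<in> T" "z = t [^]\<^bsub>E\<^esub> n" "t' \<in> T" "z' = t' [^]\<^bsub>E\<^esub> n"
    using assms by (auto simp: pow_set_def)
  have tK: "t \<in> K" "t' \<in> K" using t T_K by auto
  have eq: "real n \<cdot>\<^sub>v tau t = real n \<cdot>\<^sub>v tau t'" using tau_pow tK t assms(4) by auto
  have "tau t = tau t'"
  proof (rule eq_vecI)
    fix i assume "i < dim_vec (tau t')"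
    then have "i < d\<^sub>2" using tau_carrier K_G tK by (metis carrier_vecD)
    then show "tau t $ i = tau t' $ i"
      using arg_cong[OF eq, of "\<lambda>v. v $ i"] tau_carrier[OF K_G[OF tK(1)]] tau_carrier[OF K_G[OF tK(2)]] assms(1) by simp
  qed (use tau_carrier K_G tK in \<open>metis carrier_vecD\<close>)
  then show ?thesis using T_tau_inj t by blast
qed

lemma M0_iff: "N \<in> M0 (d\<^sub>1 + d\<^sub>2) G T \<longleftrightarrow> 0 < N \<and> pow_set (d\<^sub>1 + d\<^sub>2) T N \<lhd> EG"
  by (simp add: M0_def)

text \<open>\<open>x z x\<^sup>-\<^sup>1\<close> and \<open>z\<close> both lie in the normal subgroup \<open>\<T>\<^sup>N\<close>, on which \<open>\<pi>\<close> is injective, and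
  have the same image because translations commute.\<close>

lemma pow_set_central:
  assumes N: "N \<in> M0 (d\<^sub>1 + d\<^sub>2) G T" and z: "z \<in> pow_set (d\<^sub>1 + d\<^sub>2) T N" and x: "x \<in> K"
  shows "x \<otimes>\<^bsub>E\<^esub> z = z \<otimes>\<^bsub>E\<^esub> x"
proof -
  have "z \<in> K" using z pow_set_K by blast
  then have zK: "z \<in> K" "x \<otimes>\<^bsub>E\<^esub> z \<in> K" using K.m_closed[OF x] by auto
  have G: "x \<in> G" "z \<in> G" "inv\<^bsub>EG\<^esub> x \<in> G" "x \<otimes>\<^bsub>E\<^esub> z \<in> G"
    using K_G x zK by auto
  have "x \<otimes>\<^bsub>E\<^esub> z \<otimes>\<^bsub>E\<^esub> inv\<^bsub>EG\<^esub> x \<in> pow_set (d\<^sub>1 + d\<^sub>2) T N"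
    using normal.inv_op_closed2[of "pow_set (d\<^sub>1 + d\<^sub>2) T N" EG x z] N z G by (simp add: M0_iff)
  moreover have "tau (x \<otimes>\<^bsub>E\<^esub> z \<otimes>\<^bsub>E\<^esub> inv\<^bsub>EG\<^esub> x) = tau z"
  proof -
    have "tau (x \<otimes>\<^bsub>E\<^esub> z \<otimes>\<^bsub>E\<^esub> inv\<^bsub>EG\<^esub> x) = tau x + tau z + - tau x"
      using G x zK K_rot[OF x] by (simp add: tau_mult_K p_inv)
    also have "\<dots> = tau z" using tau_carrier[OF G(1)] tau_carrier[OF G(2)] by (intro eq_vecI) auto
    finally show ?thesis .
  qed
  ultimately have "x \<otimes>\<^bsub>E\<^esub> z \<otimes>\<^bsub>E\<^esub> inv\<^bsub>EG\<^esub> x = z"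
    using pow_set_inj[OF _ _ z] N M0_iff by blast
  then show ?thesis using EG.inv_solve_right[of z "x \<otimes>\<^bsub>E\<^esub> z" x] G by simp
qed

end

section \<open>Twisting by characters\<close>

lemma unitary_group_smult:
  assumes "U \<in> carrier (unitary_group n)"
  shows "unit_exp s \<cdot>\<^sub>m U \<in> carrier (unitary_group n)"
proof -
  note U = unitary_groupD[OF assms]
  have "(unit_exp s \<cdot>\<^sub>m U) * mat_adjoint (unit_exp s \<cdot>\<^sub>m U) =
      unit_exp (- s) \<cdot>\<^sub>m (unit_exp s \<cdot>\<^sub>m (U * mat_adjoint U))"
    using U(1) by (simp add: mat_adjoint_smult cnj_unit_exp mult_smult_assoc_mat[of _ n n _ n]
        mult_smult_distrib[of _ n n _ n])
  also have "\<dots> = 1\<^sub>m n" unfolding U(2)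
    by (rule eq_matI) (auto simp: mult.assoc[symmetric] unit_exp_minus)
  finally show ?thesis using U(1) by (intro unitary_groupI) auto
qed

context osum_space_group
begin

abbreviation "\<chi> \<equiv> chi d\<^sub>1 d\<^sub>2"
abbreviation "cl \<rho> \<equiv> rep_rel EK `` {\<rho>}"
abbreviation "conj_by \<equiv> conj_rep EG"
abbreviation "twist_class \<equiv> twist d\<^sub>1 d\<^sub>2 K"
abbreviation "conj_cls \<equiv> conj_class E K"

definition twist_rep :: "real vec \<Rightarrow> (isom \<Rightarrow> complex mat) \<Rightarrow> isom \<Rightarrow> complex mat" where
  "twist_rep k \<rho> = (\<lambda>x. \<chi> k x \<cdot>\<^sub>m \<rho> x)"

lemma chi_unit_exp: "\<chi> k x = unit_exp (k \<bullet> tau x)"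
  by (simp add: chi_def unit_exp_def)

lemma chi_mult:
  assumes "k \<in> carrier_vec d\<^sub>2" "x \<in> K" "y \<in> K"
  shows "\<chi> k (x \<otimes>\<^bsub>E\<^esub> y) = \<chi> k x * \<chi> k y"
  using assms K_G tau_carrier
  by (simp add: chi_unit_exp tau_mult_K unit_exp_add scalar_prod_add_distrib[of _ d\<^sub>2])

lemma chi_add:
  assumes "k \<in> carrier_vec d\<^sub>2" "l \<in> carrier_vec d\<^sub>2" "x \<in> K"
  shows "\<chi> (k + l) x = \<chi> k x * \<chi> l x"
  using assms K_G tau_carrier
  by (simp add: chi_unit_exp unit_exp_add add_scalar_prod_distrib[of _ d\<^sub>2])

lemma chi_zero: "x \<in> K \<Longrightarrow> \<chi> (0\<^sub>v d\<^sub>2) x = 1"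
  using K_G tau_carrier by (simp add: chi_unit_exp)

lemma twist_rep_representation:
  assumes "unitary_representation EK n \<rho>" "k \<in> carrier_vec d\<^sub>2"
  shows "unitary_representation EK n (twist_rep k \<rho>)"
proof -
  interpret r: unitary_representation EK n \<rho> by fact
  show ?thesis
  proof unfold_locales
    show "twist_rep k \<rho> \<in> hom EK (unitary_group n)"
    proof (rule homI)
      fix x assume "x \<in> carrier EK"
      then show "twist_rep k \<rho> x \<in> carrier (unitary_group n)"
        using r.closed unitary_group_smult by (simp add: twist_rep_def chi_unit_exp)
    next
      fix x y assume xy: "x \<in> carrier EK" "y \<in> carrier EK"
      then have c: "\<rho> x \<in> carrier_mat n n" "\<rho> y \<in> carrier_mat n n" by auto
      have "\<chi> k x * \<chi> k y \<cdot>\<^sub>m (\<rho> x * \<rho> y) = \<chi> k x \<cdot>\<^sub>m \<rho> x * (\<chi> k y \<cdot>\<^sub>m \<rho> y)"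
        using c by (intro eq_matI) auto
      then show "twist_rep k \<rho> (x \<otimes>\<^bsub>EK\<^esub> y) = twist_rep k \<rho> x \<otimes>\<^bsub>unitary_group n\<^esub> twist_rep k \<rho> y"
        using xy r.mult[OF xy] assms(2) by (simp add: twist_rep_def chi_mult)
    qed
  qed
qed

lemma twist_rep_unitary: "unitary_rep EK \<rho> \<Longrightarrow> k \<in> carrier_vec d\<^sub>2 \<Longrightarrow> unitary_rep EK (twist_rep k \<rho>)"
  using EK.unitary_repE twist_rep_representation unitary_representation.unitary_rep by blast

lemma conj_by_unitary: "unitary_rep EK \<rho> \<Longrightarrow> g \<in> G \<Longrightarrow> unitary_rep EK (conj_by g \<rho>)"
  using unitary_representation.unitary_rep[OF K.conj_rep_representation[of _ \<rho> g]] EK.unitary_repE[of \<rho>]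
  by simp

lemma conj_by_rel: "(\<rho>, \<sigma>) \<in> rep_rel EK \<Longrightarrow> g \<in> G \<Longrightarrow> (conj_by g \<rho>, conj_by g \<sigma>) \<in> rep_rel EK"
  using K.conj_rep_rel[of \<rho> \<sigma> g] by simp

lemma twist_rep_rel:
  assumes "(\<rho>, \<sigma>) \<in> rep_rel EK" "k \<in> carrier_vec d\<^sub>2"
  shows "(twist_rep k \<rho>, twist_rep k \<sigma>) \<in> rep_rel EK"
proof -
  obtain n U where U: "unitary_representation EK n \<rho>" "unitary_representation EK n \<sigma>"
    "U \<in> carrier (unitary_group n)" "\<And>h. h \<in> carrier EK \<Longrightarrow> \<sigma> h * U = U * \<rho> h"
    using assms(1) by (rule EK.rep_relE) blast
  interpret r: unitary_representation EK n \<rho> by fact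
  interpret s: unitary_representation EK n \<sigma> by fact
  show ?thesis
  proof (rule rep_relI[OF twist_rep_representation[OF U(1) assms(2)]
        twist_rep_representation[OF U(2) assms(2)] U(3)])
    fix h assume h: "h \<in> carrier EK"
    show "twist_rep k \<sigma> h * U = U * twist_rep k \<rho> h"
      unfolding twist_rep_def mult_smult_assoc_mat[OF s.carrier[OF h] unitary_groupD(1)[OF U(3)]]
        mult_smult_distrib[OF unitary_groupD(1)[OF U(3)] r.carrier[OF h]] U(4)[OF h] ..
  qed
qed

text \<open>Each value changes only by a nonzero scalar, which a subspace absorbs; multiplying by
  the inverse scalar recovers \<rho>.\<close>

lemma twist_rep_irreducible:
  assumes irr: "irreducible_rep EK \<rho>" and k: "k \<in> carrier_vec d\<^sub>2"
  shows "irreducible_rep EK (twist_rep k \<rho>)"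
proof -
  interpret r: unitary_representation EK "rep_dim EK \<rho>" \<rho>
    using irreducible_rep_unitary[OF irr] by (rule EK.unitary_repE)
  interpret t: unitary_representation EK "rep_dim EK \<rho>" "twist_rep k \<rho>"
    using twist_rep_representation[OF r.unitary_representation_axioms k] .
  show ?thesis
  proof (rule irreducible_rep_transfer[OF irr t.unitary_rep t.rep_dim], intro ballI)
    fix W h w assume W: "W \<subseteq> carrier_vec (rep_dim EK \<rho>)" and smult: "\<And>c v. v \<in> W \<Longrightarrow> c \<cdot>\<^sub>v v \<in> W"
      and inv: "\<forall>h\<in>carrier EK. \<forall>w\<in>W. twist_rep k \<rho> h *\<^sub>v w \<in> W" and h: "h \<in> carrier EK" and w: "w \<in> W"
    have wc: "w \<in> carrier_vec (rep_dim EK \<rho>)" using W w by blast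
    have "unit_exp (- (k \<bullet> tau h)) \<cdot>\<^sub>v (twist_rep k \<rho> h *\<^sub>v w) \<in> W" using inv h w smult by blast
    also have "twist_rep k \<rho> h *\<^sub>v w = unit_exp (k \<bullet> tau h) \<cdot>\<^sub>v (\<rho> h *\<^sub>v w)"
      using r.carrier[OF h] wc by (intro eq_vecI) (auto simp: twist_rep_def chi_unit_exp)
    also have "unit_exp (- (k \<bullet> tau h)) \<cdot>\<^sub>v (unit_exp (k \<bullet> tau h) \<cdot>\<^sub>v (\<rho> h *\<^sub>v w)) = \<rho> h *\<^sub>v w"
      by (simp add: smult_smult_assoc unit_exp_minus)
    finally show "\<rho> h *\<^sub>v w \<in> W" .
  qed
qed

lemma twist_rep_twist_rep:
  assumes "k \<in> carrier_vec d\<^sub>2" "l \<in> carrier_vec d\<^sub>2" "x \<in> K"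
  shows "twist_rep k (twist_rep l \<rho>) x = twist_rep (k + l) \<rho> x"
  by (rule eq_matI) (auto simp: twist_rep_def chi_add[OF assms])

lemma twist_rep_zero: "x \<in> K \<Longrightarrow> twist_rep (0\<^sub>v d\<^sub>2) \<rho> x = \<rho> x"
  by (rule eq_matI) (auto simp: twist_rep_def chi_zero)

text \<open>Conjugation applies the transpose of \<open>rot g\<close> to the translation; in the
  scalar product it moves to k as \<open>rot g\<close>.\<close>

lemma conj_twist_rep:
  assumes g: "g \<in> G" and k: "k \<in> carrier_vec d\<^sub>2" and x: "x \<in> K"
  shows "conj_by g (twist_rep k \<rho>) x = twist_rep (rot g *\<^sub>v k) (conj_by g \<rho>) x"
proof -
  have "k \<bullet> ((rot g)\<^sup>T *\<^sub>v tau x) = (rot g *\<^sub>v k) \<bullet> tau x"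
    using orthogonal_mats_scalar_prod(1)[OF rot_orthogonal[OF g] k tau_carrier[OF K_G[OF x]]] by simp
  then show ?thesis
    by (simp add: conj_rep_def twist_rep_def chi_unit_exp tau_conj[OF g x])
qed

lemma cl_eq_iff: "unitary_rep EK \<rho> \<Longrightarrow> cl \<rho> = cl \<sigma> \<longleftrightarrow> (\<rho>, \<sigma>) \<in> rep_rel EK"
  by (rule EK.rep_rel_class_eq_iff)

lemma cl_cong:
  assumes "unitary_rep EK \<rho>" "\<And>x. x \<in> K \<Longrightarrow> \<sigma> x = \<rho> x"
  shows "cl \<sigma> = cl \<rho>"
proof -
  have "(\<rho>, \<sigma>) \<in> rep_rel EK" using assms by (intro EK.rep_rel_cong) auto
  then show ?thesis using cl_eq_iff[OF assms(1)] by blast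
qed

lemma twist_cl:
  assumes "unitary_rep EK \<rho>" "k \<in> carrier_vec d\<^sub>2"
  shows "twist_class k (cl \<rho>) = cl (twist_rep k \<rho>)"
  unfolding twist_def twist_rep_def[symmetric]
proof (rule EK.rep_rel_Union_class[OF assms(1)])
  fix \<sigma> assume "(\<rho>, \<sigma>) \<in> rep_rel EK"
  then have "(twist_rep k \<rho>, twist_rep k \<sigma>) \<in> rep_rel EK" by (rule twist_rep_rel) fact
  then show "cl (twist_rep k \<sigma>) = cl (twist_rep k \<rho>)"
    using cl_eq_iff twist_rep_unitary assms by blast
qed

lemma conj_cl:
  assumes "unitary_rep EK \<rho>" and g: "g \<in> G"
  shows "conj_cls g (cl \<rho>) = cl (conj_by g \<rho>)"
proof -
  have eq: "(\<lambda>n. \<sigma> (inv\<^bsub>E\<^esub> g \<otimes>\<^bsub>E\<^esub> n \<otimes>\<^bsub>E\<^esub> g)) = conj_by g \<sigma>" for \<sigma> :: "isom \<Rightarrow> complex mat"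
    by (simp add: conj_rep_def inv_EG[OF g])
  show ?thesis
    unfolding conj_class_def eq
  proof (rule EK.rep_rel_Union_class[OF assms(1)])
    fix \<sigma> assume "(\<rho>, \<sigma>) \<in> rep_rel EK"
    then have "(conj_by g \<rho>, conj_by g \<sigma>) \<in> rep_rel EK" using g by (rule conj_by_rel)
    then show "cl (conj_by g \<sigma>) = cl (conj_by g \<rho>)"
      using cl_eq_iff conj_by_unitary assms by blast
  qed
qed

lemma irrepsE:
  assumes "C \<in> irreps EK"
  obtains \<rho> where "irreducible_rep EK \<rho>" "C = cl \<rho>"
  using assms by (auto simp: irreps_def quotient_def)

lemma irrepsI: "irreducible_rep EK \<rho> \<Longrightarrow> cl \<rho> \<in> irreps EK"
  by (auto simp: irreps_def quotient_def)

text \<open>Both sides carry a twist by the rotated k, and twisting by its negative cancels it. This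
  removes k from the equivalence.\<close>

lemma conj_twist_rel_iff:
  assumes \<rho>: "unitary_rep EK \<rho>" and \<sigma>: "unitary_rep EK \<sigma>" and g: "g \<in> G"
    and k: "k \<in> carrier_vec d\<^sub>2" and l: "l \<in> carrier_vec d\<^sub>2"
  shows "(conj_by g (twist_rep k \<rho>), twist_rep (rot g *\<^sub>v k + l) \<sigma>) \<in> rep_rel EK \<longleftrightarrow>
    (conj_by g \<rho>, twist_rep l \<sigma>) \<in> rep_rel EK"
proof -
  let ?k = "rot g *\<^sub>v k"
  have k': "?k \<in> carrier_vec d\<^sub>2" "- ?k \<in> carrier_vec d\<^sub>2" using k rot_carrier[OF g] by auto
  have u: "unitary_rep EK (conj_by g \<rho>)" "unitary_rep EK (twist_rep l \<sigma>)"
    using conj_by_unitary twist_rep_unitary \<rho> \<sigma> g l by auto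
  have a: "cl (conj_by g (twist_rep k \<rho>)) = cl (twist_rep ?k (conj_by g \<rho>))"
    using twist_rep_unitary[OF u(1) k'(1)] by (rule cl_cong) (rule conj_twist_rep[OF g k])
  have b: "cl (twist_rep (?k + l) \<sigma>) = cl (twist_rep ?k (twist_rep l \<sigma>))"
    using twist_rep_unitary[OF u(2) k'(1)] by (rule cl_cong) (simp add: twist_rep_twist_rep[OF k'(1) l])
  have c: "cl (twist_rep (- ?k) (twist_rep ?k \<tau>)) = cl \<tau>" if \<tau>: "unitary_rep EK \<tau>" for \<tau>
  proof (rule cl_cong[OF \<tau>])
    have "- ?k + ?k = 0\<^sub>v d\<^sub>2" using k' by simp
    then show "twist_rep (- ?k) (twist_rep ?k \<tau>) x = \<tau> x" if "x \<in> K" for x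
      using that by (simp add: twist_rep_twist_rep[OF k'(2,1)] twist_rep_zero)
  qed
  have "(conj_by g (twist_rep k \<rho>), twist_rep (?k + l) \<sigma>) \<in> rep_rel EK \<longleftrightarrow>
      cl (twist_rep ?k (conj_by g \<rho>)) = cl (twist_rep ?k (twist_rep l \<sigma>))"
    unfolding cl_eq_iff[OF conj_by_unitary[OF twist_rep_unitary[OF \<rho> k] g], symmetric] a b ..
  also have "\<dots> \<longleftrightarrow> cl (conj_by g \<rho>) = cl (twist_rep l \<sigma>)"
  proof
    assume "cl (twist_rep ?k (conj_by g \<rho>)) = cl (twist_rep ?k (twist_rep l \<sigma>))"
    then have "twist_class (- ?k) (cl (twist_rep ?k (conj_by g \<rho>))) =
        twist_class (- ?k) (cl (twist_rep ?k (twist_rep l \<sigma>)))" by simp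
    then show "cl (conj_by g \<rho>) = cl (twist_rep l \<sigma>)"
      unfolding twist_cl[OF twist_rep_unitary[OF u(1) k'(1)] k'(2)]
        twist_cl[OF twist_rep_unitary[OF u(2) k'(1)] k'(2)] c[OF u(1)] c[OF u(2)] .
  next
    assume "cl (conj_by g \<rho>) = cl (twist_rep l \<sigma>)"
    then show "cl (twist_rep ?k (conj_by g \<rho>)) = cl (twist_rep ?k (twist_rep l \<sigma>))"
      unfolding twist_cl[OF u(1) k'(1), symmetric] twist_cl[OF u(2) k'(1), symmetric] by simp
  qed
  also have "\<dots> \<longleftrightarrow> (conj_by g \<rho>, twist_rep l \<sigma>) \<in> rep_rel EK"
    by (rule cl_eq_iff[OF u(1)])
  finally show ?thesis .
qed

lemma Ind_cl_eq_iff: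
  assumes "irreducible_rep EK \<rho>" "unitary_rep EK \<sigma>"
  shows "Ind EG K (cl \<rho>) = Ind EG K (cl \<sigma>) \<longleftrightarrow> (\<exists>g\<in>G. (conj_by g \<rho>, \<sigma>) \<in> rep_rel EK)"
proof -
  obtain hs where "left_transversal EG K hs" by (rule transversal)
  from K.Ind_class_eq_iff[of \<rho> \<sigma>, OF _ _ this] assms show ?thesis by simp
qed

lemma Ind_twist_eq_iff:
  assumes C: "C \<in> irreps EK" and C': "C' \<in> irreps EK" 
    and k: "k \<in> carrier_vec d\<^sub>2" and k': "k' \<in> carrier_vec d\<^sub>2"
  shows "Ind EG K (twist_class k C) = Ind EG K (twist_class k' C') \<longleftrightarrow>
    (\<exists>g\<in>G. \<exists>l\<in>carrier_vec d\<^sub>2. conj_cls g C = twist_class l C' \<and> k' = rot g *\<^sub>v k + l)"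
proof -
  obtain \<rho> where \<rho>: "irreducible_rep EK \<rho>" "C = cl \<rho>" using C by (rule irrepsE)
  obtain \<sigma> where \<sigma>: "irreducible_rep EK \<sigma>" "C' = cl \<sigma>" using C' by (rule irrepsE)
  note u = irreducible_rep_unitary[OF \<rho>(1)] irreducible_rep_unitary[OF \<sigma>(1)]
  have "Ind EG K (twist_class k C) = Ind EG K (twist_class k' C') \<longleftrightarrow>
      (\<exists>g\<in>G. (conj_by g (twist_rep k \<rho>), twist_rep k' \<sigma>) \<in> rep_rel EK)"
    unfolding \<rho>(2) \<sigma>(2) twist_cl[OF u(1) k] twist_cl[OF u(2) k']
    by (rule Ind_cl_eq_iff[OF twist_rep_irreducible[OF \<rho>(1) k] twist_rep_unitary[OF u(2) k']])
  also have "\<dots> \<longleftrightarrow> (\<exists>g\<in>G. \<exists>l\<in>carrier_vec d\<^sub>2. conj_cls g C = twist_class l C' \<and> k' = rot g *\<^sub>v k + l)"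
  proof (rule bex_cong[OF refl])
    fix g assume g: "g \<in> G"
    have gk: "rot g *\<^sub>v k \<in> carrier_vec d\<^sub>2" using rot_carrier[OF g] k by simp
    have *: "conj_cls g C = twist_class l C' \<longleftrightarrow> (conj_by g \<rho>, twist_rep l \<sigma>) \<in> rep_rel EK"
      if "l \<in> carrier_vec d\<^sub>2" for l
      unfolding \<rho>(2) \<sigma>(2) twist_cl[OF u(2) that] conj_cl[OF u(1) g]
      by (rule cl_eq_iff[OF conj_by_unitary[OF u(1) g]])
    show "(conj_by g (twist_rep k \<rho>), twist_rep k' \<sigma>) \<in> rep_rel EK \<longleftrightarrow>
      (\<exists>l\<in>carrier_vec d\<^sub>2. conj_cls g C = twist_class l C' \<and> k' = rot g *\<^sub>v k + l)"
    proof
      assume rel: "(conj_by g (twist_rep k \<rho>), twist_rep k' \<sigma>) \<in> rep_rel EK"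
      \<comment> \<open>For given g this is the only vector compatible with the required formula for
        k'.\<close>
      define l where "l = k' - rot g *\<^sub>v k"
      have l: "l \<in> carrier_vec d\<^sub>2" using k' gk by (simp add: l_def)
      have e: "k' = rot g *\<^sub>v k + l" unfolding l_def using k' gk rot_carrier[OF g] by (intro eq_vecI) auto
      have "(conj_by g \<rho>, twist_rep l \<sigma>) \<in> rep_rel EK"
        using rel conj_twist_rel_iff[OF u g k l] e by simp
      then show "\<exists>l\<in>carrier_vec d\<^sub>2. conj_cls g C = twist_class l C' \<and> k' = rot g *\<^sub>v k + l"
        using * l e by blast
    next
      assume "\<exists>l\<in>carrier_vec d\<^sub>2. conj_cls g C = twist_class l C' \<and> k' = rot g *\<^sub>v k + l"
      then obtain l where l: "l \<in> carrier_vec d\<^sub>2" "conj_cls g C = twist_class l C'" "k' = rot g *\<^sub>v k + l"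
        by blast
      then show "(conj_by g (twist_rep k \<rho>), twist_rep k' \<sigma>) \<in> rep_rel EK"
        using * conj_twist_rel_iff[OF u g k l(1)] by simp
    qed
  qed
  finally show ?thesis .
qed

text \<open>The criterion for equal induction, applied with both classes equal to \<open>C\<close>.
  Orbits thus become fibres of a function of k, which is the form in which they are compared
  later.\<close>

lemma orbit_eq:
  assumes "C \<in> irreps EK" "k \<in> carrier_vec d\<^sub>2"
  shows "orbit (G_rho_group d\<^sub>1 d\<^sub>2 G K C) euc_act k =
    {k' \<in> carrier_vec d\<^sub>2. Ind EG K (twist_class k C) = Ind EG K (twist_class k' C)}"
proof -
  have "orbit (G_rho_group d\<^sub>1 d\<^sub>2 G K C) euc_act k =
    {rot g *\<^sub>v k + l |g l. g \<in> G \<and> l \<in> carrier_vec d\<^sub>2 \<and> conj_cls g C = twist_class l C}"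
    by (auto simp: orbit_def G_rho_def euc_act_def)
  also have "\<dots> = {k' \<in> carrier_vec d\<^sub>2. Ind EG K (twist_class k C) = Ind EG K (twist_class k' C)}"
  proof (intro subset_antisym subsetI)
    fix k' assume "k' \<in> {rot g *\<^sub>v k + l |g l. g \<in> G \<and> l \<in> carrier_vec d\<^sub>2 \<and> conj_cls g C = twist_class l C}"
    then obtain g l where gl: "g \<in> G" "l \<in> carrier_vec d\<^sub>2" "conj_cls g C = twist_class l C" "k' = rot g *\<^sub>v k + l"
      by blast
    then have "k' \<in> carrier_vec d\<^sub>2" 
      using mult_mat_vec_carrier[OF rot_carrier[OF gl(1)] assms(2)] by simp
    then show "k' \<in> {k' \<in> carrier_vec d\<^sub>2. Ind EG K (twist_class k C) = Ind EG K (twist_class k' C)}"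
      using Ind_twist_eq_iff[OF assms(1,1,2)] gl by blast
  next
    fix k' assume "k' \<in> {k' \<in> carrier_vec d\<^sub>2. Ind EG K (twist_class k C) = Ind EG K (twist_class k' C)}"
    then show "k' \<in> {rot g *\<^sub>v k + l |g l. g \<in> G \<and> l \<in> carrier_vec d\<^sub>2 \<and> conj_cls g C = twist_class l C}"
      using Ind_twist_eq_iff[OF assms(1,1,2)] by blast
  qed
  finally show ?thesis .
qed

section \<open>The bijection\<close>

abbreviation "TP \<equiv> pow_set (d\<^sub>1 + d\<^sub>2) T"
abbreviation "Ms \<equiv> M0 (d\<^sub>1 + d\<^sub>2) G T"

text \<open>The identity matrix is fixed by unitary conjugation, so one representative decides for
  the whole class.\<close>

lemma trivial_on_cl:
  assumes \<rho>: "unitary_representation EK n \<rho>" and X: "X \<subseteq> K"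
  shows "trivial_on X (cl \<rho>) \<longleftrightarrow> (\<forall>x\<in>X. \<rho> x = 1\<^sub>m n)"
proof
  interpret r: unitary_representation EK n \<rho> by fact
  assume "trivial_on X (cl \<rho>)"
  then have "\<forall>x\<in>X. \<rho> x = 1\<^sub>m (dim_row (\<rho> x))"
    using EK.rep_rel_refl[OF r.unitary_rep] by (auto simp: trivial_on_def)
  moreover have "dim_row (\<rho> x) = n" if "x \<in> X" for x using X that r.dims(1)[of x] by auto
  ultimately show "\<forall>x\<in>X. \<rho> x = 1\<^sub>m n" by metis
next
  interpret r: unitary_representation EK n \<rho> by fact
  assume triv: "\<forall>x\<in>X. \<rho> x = 1\<^sub>m n"
  show "trivial_on X (cl \<rho>)" unfolding trivial_on_def
  proof (intro ballI)
    fix \<sigma> x assume "\<sigma> \<in> cl \<rho>" and x: "x \<in> X"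
    then have "(\<rho>, \<sigma>) \<in> rep_rel EK" by simp
    then obtain n' U where n': "unitary_representation EK n' \<rho>" and U: "U \<in> carrier (unitary_group n')"
      and eq: "\<And>h. h \<in> carrier EK \<Longrightarrow> \<sigma> h = U * \<rho> h * mat_adjoint U"
      by (rule EK.rep_relE) blast
    have "n' = n" using unitary_representation.rep_dim[OF n'] r.rep_dim by simp
    then have "\<sigma> x = 1\<^sub>m n"
      using eq[of x] x X triv unitary_groupD[OF U] by auto
    then show "\<sigma> x = 1\<^sub>m (dim_row (\<sigma> x))" by simp
  qed
qed

lemma twist_rep_trivial_iff:
  assumes n: "0 < n" and triv: "\<rho> x = 1\<^sub>m n"
  shows "twist_rep k \<rho> x = 1\<^sub>m n \<longleftrightarrow> k \<bullet> tau x \<in> \<int>"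
proof
  assume "twist_rep k \<rho> x = 1\<^sub>m n"
  \<comment> \<open>Since n is positive, the entry (0, 0) exists and shows that the scalar is
    1.\<close>
  then have "(unit_exp (k \<bullet> tau x) \<cdot>\<^sub>m 1\<^sub>m n) $$ (0, 0) = 1\<^sub>m n $$ (0, 0)"
    using triv by (simp add: twist_rep_def chi_unit_exp)
  then show "k \<bullet> tau x \<in> \<int>" using n by (simp add: unit_exp_eq_1_iff)
next
  assume "k \<bullet> tau x \<in> \<int>"
  then have "unit_exp (k \<bullet> tau x) = 1" by (simp add: unit_exp_eq_1_iff)
  then show "twist_rep k \<rho> x = 1\<^sub>m n"
    using triv by (intro eq_matI) (auto simp: twist_rep_def chi_unit_exp)
qed

text \<open>Pairing k with the translation of t^N is pairing N k with that of t, and the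
  translations of \<open>T\<close> exhaust the lattice.\<close>

lemma scaled_dual_lattice_iff:
  assumes N: "0 < N"
  shows "k \<in> scaled_dual_lattice d\<^sub>2 S N \<longleftrightarrow>
    k \<in> carrier_vec d\<^sub>2 \<and> (\<forall>x\<in>TP N. k \<bullet> tau x \<in> \<int>)"
proof -
  have eq: "k \<bullet> tau (t [^]\<^bsub>E\<^esub> N) = (real N \<cdot>\<^sub>v k) \<bullet> tau t" if "t \<in> T" "k \<in> carrier_vec d\<^sub>2" for k t
  proof -
    have "t \<in> K" using that T_K by blast
    then show ?thesis using tau_pow[of t N] that tau_carrier[OF K_G[of t]] by simp
  qed
  have "trans_subgroup d\<^sub>2 S = p ` T" using proj_T by (simp add: bij_betw_def)
  then have L: "L = tau ` T" by (simp only: image_image)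
  show ?thesis
  proof
    assume "k \<in> scaled_dual_lattice d\<^sub>2 S N"
    then obtain l where l: "l \<in> dual_lattice d\<^sub>2 S" "k = (1 / real N) \<cdot>\<^sub>v l" by (auto simp: scaled_dual_lattice_def)
    have lc: "l \<in> carrier_vec d\<^sub>2" using l by (simp add: dual_lattice_def)
    have "real N \<cdot>\<^sub>v k = l" using N by (simp add: l(2) smult_smult_assoc)
    then have "(real N \<cdot>\<^sub>v k) \<bullet> tau t \<in> \<int>" if "t \<in> T" for t
      using l(1) that L by (auto simp: dual_lattice_def)
    then show "k \<in> carrier_vec d\<^sub>2 \<and> (\<forall>x\<in>TP N. k \<bullet> tau x \<in> \<int>)"
      using lc eq[of _ k] by (auto simp: l(2) pow_set_def)
  next
    assume k: "k \<in> carrier_vec d\<^sub>2 \<and> (\<forall>x\<in>TP N. k \<bullet> tau x \<in> \<int>)"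
    have "real N \<cdot>\<^sub>v k \<in> dual_lattice d\<^sub>2 S"
      unfolding dual_lattice_def L
    proof (intro CollectI conjI ballI)
      fix y assume "y \<in> tau ` T"
      then obtain t where t: "t \<in> T" "y = tau t" by blast
      then show "(real N \<cdot>\<^sub>v k) \<bullet> y \<in> \<int>" using k eq[of t k] by (auto simp: pow_set_def)
    qed (use k in auto)
    moreover have "k = (1 / real N) \<cdot>\<^sub>v (real N \<cdot>\<^sub>v k)" using N by (simp add: smult_smult_assoc)
    ultimately show "k \<in> scaled_dual_lattice d\<^sub>2 S N" unfolding scaled_dual_lattice_def by blast
  qed
qed

text \<open>\<open>\<T>\<^sup>m\<close> is central in \<open>K\<close>, so it acts by scalars, which define a character of the lattice.\<close>

lemma untwist:
  assumes m: "m \<in> Ms" and irr: "irreducible_rep EK \<sigma>"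
  obtains k where "k \<in> carrier_vec d\<^sub>2" "\<And>x. x \<in> TP m \<Longrightarrow> twist_rep k \<sigma> x = 1\<^sub>m (rep_dim EK \<sigma>)"
proof -
  define n where "n = rep_dim EK \<sigma>"
  have n: "n > 0" using irreducible_rep_dim_pos[OF irr] by (simp add: n_def)
  have m0: "m > 0" and nm: "TP m \<lhd> EG" using m M0_iff by auto
  interpret s: unitary_representation EK n \<sigma>
    unfolding n_def using irreducible_rep_unitary[OF irr] by (rule EK.unitary_repE)
  have "\<forall>v\<in>L. \<exists>t. t \<in> T \<and> tau t = v"
  proof
    fix v assume "v \<in> L"
    then obtain t where "t \<in> T" "tau t = v" by (rule T_lift)
    then show "\<exists>t. t \<in> T \<and> tau t = v" by blast
  qed
  from bchoice[OF this] obtain t where "\<forall>v\<in>L. t v \<in> T \<and> tau (t v) = v" ..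
  then have t: "t v \<in> T" "tau (t v) = v" if "v \<in> L" for v using that by blast+
  \<comment> \<open>The lift of m v into \<open>T\<close>^m. Lifts into \<open>T\<close> need not
    multiply, whereas z turns out to be a homomorphism.\<close>
  define z where "z v = t v [^]\<^bsub>E\<^esub> m" for v
  have zT: "z v \<in> TP m" if "v \<in> L" for v using t[OF that] by (auto simp: z_def pow_set_def)
  have zK: "z v \<in> K" if "v \<in> L" for v using zT[OF that] pow_set_K by blast
  have tauz: "tau (z v) = real m \<cdot>\<^sub>v v" if "v \<in> L" for v
    using tau_pow[of "t v" m] t that T_K unfolding z_def by auto
  \<comment> \<open>Both sides lie in the group \<open>T\<close>^m and have the same translation, so
    they coincide by \<open>pow_set_inj\<close>.\<close>
  have z_add: "z (v + w) = z v \<otimes>\<^bsub>E\<^esub> z w" if vw: "v \<in> L" "w \<in> L" for v w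
  proof (rule pow_set_inj[OF m0 zT[OF L_add[OF vw]]])
    show "z v \<otimes>\<^bsub>E\<^esub> z w \<in> TP m"
      using subgroup.m_closed[OF normal_imp_subgroup[OF nm] zT zT] vw by simp
    show "tau (z (v + w)) = tau (z v \<otimes>\<^bsub>E\<^esub> z w)"
      using tauz vw L_add[OF vw] tau_mult_K[OF zK[OF vw(1)] K_G[OF zK[OF vw(2)]]] L_carrier
      by (simp add: smult_add_distrib_vec[of _ d\<^sub>2])
  qed
  have "\<forall>v\<in>L. \<exists>c. \<sigma> (z v) = c \<cdot>\<^sub>m 1\<^sub>m n"
  proof
    fix v assume v: "v \<in> L"
    have "\<sigma> (z v) * \<sigma> h = \<sigma> h * \<sigma> (z v)" if h: "h \<in> carrier EK" for h
      using s.mult[of "z v" h] s.mult[of h "z v"] pow_set_central[OF m zT[OF v], of h] h zK[OF v] by simp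
    then obtain c where "\<sigma> (z v) = c \<cdot>\<^sub>m 1\<^sub>m n"
      using s.schur_scalar[OF irr, of "\<sigma> (z v)"] s.carrier[of "z v"] zK[OF v] by auto
    then show "\<exists>c. \<sigma> (z v) = c \<cdot>\<^sub>m 1\<^sub>m n" ..
  qed
  from bchoice[OF this] obtain \<phi> where "\<forall>v\<in>L. \<sigma> (z v) = \<phi> v \<cdot>\<^sub>m 1\<^sub>m n" ..
  then have \<phi>: "\<sigma> (z v) = \<phi> v \<cdot>\<^sub>m 1\<^sub>m n" if "v \<in> L" for v using that by blast
  have \<phi>_eq: "\<phi> v = \<sigma> (z v) $$ (0, 0)" if "v \<in> L" for v using \<phi>[OF that] n by simp
  have "\<phi> (v + w) = \<phi> v * \<phi> w" if vw: "v \<in> L" "w \<in> L" for v w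
  proof -
    have "\<sigma> (z (v + w)) = (\<phi> v \<cdot>\<^sub>m 1\<^sub>m n) * (\<phi> w \<cdot>\<^sub>m 1\<^sub>m n)"
      unfolding z_add[OF vw] using s.mult[of "z v" "z w"] zK vw \<phi> by simp
    also have "\<dots> = (\<phi> v * \<phi> w) \<cdot>\<^sub>m 1\<^sub>m n"
      by (intro eq_matI) (auto simp: mult_smult_assoc_mat[of _ n n _ n])
    finally show ?thesis using \<phi>_eq[OF L_add[OF vw]] n by simp
  qed
  moreover have "cmod (\<phi> v) = 1" if v: "v \<in> L" for v
  proof -
    have "(\<phi> v \<cdot>\<^sub>m 1\<^sub>m n) * mat_adjoint (\<phi> v \<cdot>\<^sub>m 1\<^sub>m n) = 1\<^sub>m n"
      using unitary_groupD(2)[OF s.closed[of "z v"]] zK[OF v] \<phi>[OF v] by simp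
    then have "((\<phi> v \<cdot>\<^sub>m 1\<^sub>m n) * (cnj (\<phi> v) \<cdot>\<^sub>m 1\<^sub>m n)) $$ (0, 0) = 1\<^sub>m n $$ (0, 0)"
      by (simp add: mat_adjoint_smult)
    then have "\<phi> v * cnj (\<phi> v) = 1" using n by (simp add: mult_smult_assoc_mat[of _ n n _ n])
    then have "complex_of_real ((cmod (\<phi> v))\<^sup>2) = 1" by (simp only: complex_norm_square)
    then have "(cmod (\<phi> v))\<^sup>2 = 1" by (metis of_real_eq_1_iff)
    then show ?thesis by (simp add: power2_eq_1_iff) (metis norm_ge_zero not_one_le_zero neg_0_le_iff_le)
  qed
  ultimately obtain l where l: "l \<in> carrier_vec d\<^sub>2" "\<And>v. v \<in> L \<Longrightarrow> \<phi> v = unit_exp (l \<bullet> v)"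
    using L_character by blast
  \<comment> \<open>The sign inverts the character; the factor 1 / m compensates for z v having
    translation m v.\<close>
  define k where "k = (- 1 / real m) \<cdot>\<^sub>v l"
  have "twist_rep k \<sigma> x = 1\<^sub>m n" if x: "x \<in> TP m" for x
  proof -
    obtain t' where t': "t' \<in> T" "x = t' [^]\<^bsub>E\<^esub> m" using x by (auto simp: pow_set_def)
    define v where "v = tau t'"
    have v: "v \<in> L" unfolding v_def by (rule tau_L[OF subsetD[OF T_G t'(1)] T_rot[OF t'(1)]])
    have "t v = t'" using T_tau_inj t[OF v] t'(1) v_def by blast
    then have xz: "x = z v" by (simp add: z_def t'(2))
    have "k \<bullet> tau x = - (l \<bullet> v)"
      unfolding xz tauz[OF v] k_def using m0 l(1) L_carrier[OF v] by simp
    then have "twist_rep k \<sigma> x = unit_exp (- (l \<bullet> v)) \<cdot>\<^sub>m (unit_exp (l \<bullet> v) \<cdot>\<^sub>m 1\<^sub>m n)"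
      unfolding twist_rep_def chi_unit_exp using \<phi>[OF v] l(2)[OF v] xz by simp
    also have "\<dots> = 1\<^sub>m n" by (intro eq_matI) (auto simp: unit_exp_minus)
    finally show ?thesis .
  qed
  moreover have "k \<in> carrier_vec d\<^sub>2" using l by (simp add: k_def)
  ultimately show thesis using that n_def by blast
qed

text \<open>An element t^(m j) is the j-th power of t^m, on which \<rho> is already trivial.\<close>

lemma trivial_pow:
  assumes \<rho>: "unitary_representation EK n \<rho>" and triv: "\<And>x. x \<in> TP m \<Longrightarrow> \<rho> x = 1\<^sub>m n"
    and x: "x \<in> TP (m * j)"
  shows "\<rho> x = 1\<^sub>m n"
proof -
  interpret r: unitary_representation EK n \<rho> by fact
  obtain t where t: "t \<in> T" "x = t [^]\<^bsub>E\<^esub> (m * j)" using x by (auto simp: pow_set_def)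
  define y where "y = t [^]\<^bsub>E\<^esub> m"
  have y: "y \<in> K" "\<rho> y = 1\<^sub>m n" using t triv[of y] tau_pow[of t m] T_K by (auto simp: y_def pow_set_def)
  have "t \<in> carrier E" using T_G t(1) subgroup.subset[OF G_subgroup] by blast
  then have xy: "x = y [^]\<^bsub>E\<^esub> j" by (simp only: t(2) y_def E.nat_pow_pow)
  have "y [^]\<^bsub>E\<^esub> j \<in> K \<and> \<rho> (y [^]\<^bsub>E\<^esub> j) = 1\<^sub>m n"
  proof (induction j)
    case 0
    then show ?case using r.one K.one_closed by simp
  next
    case (Suc j)
    then show ?case using r.mult[of "y [^]\<^bsub>E\<^esub> j" y] y K.m_closed[of "y [^]\<^bsub>E\<^esub> j" y] by simp
  qed
  then show ?thesis by (simp add: xy)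
qed

text \<open>Normality of \<open>T\<close>^N keeps the conjugated argument inside it.\<close>

lemma conj_by_trivial:
  assumes N: "N \<in> Ms" and g: "g \<in> G" and triv: "\<And>x. x \<in> TP N \<Longrightarrow> \<rho> x = 1\<^sub>m n" and x: "x \<in> TP N"
  shows "conj_by g \<rho> x = 1\<^sub>m n"
  using normal.inv_op_closed1[of "TP N" EG g x] triv N g x by (simp add: M0_iff conj_rep_def)

end

section \<open>The bijection relative to a set of representatives\<close>

locale representation_set_osum = osum_space_group +
  fixes m :: nat and R
  assumes m: "0 < m" and M0_eq: "M0 (d\<^sub>1 + d\<^sub>2) G T = {m * n |n. n \<ge> 1}"
    and R: "representation_set R
      {C \<in> irreps (Euc (d\<^sub>1 + d\<^sub>2)\<lparr>carrier := TF d\<^sub>1 d\<^sub>2 G T\<rparr>).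
        trivial_on (pow_set (d\<^sub>1 + d\<^sub>2) T m) C} (sim d\<^sub>1 d\<^sub>2 G (TF d\<^sub>1 d\<^sub>2 G T))"
begin

abbreviation "X \<equiv> {C \<in> irreps EK. trivial_on (TP m) C}"

lemma m_M0: "m \<in> Ms"
  unfolding M0_eq by (intro CollectI exI[of _ 1]) auto

lemma R_irreps: "C \<in> R \<Longrightarrow> C \<in> irreps EK"
  using R by (auto simp: representation_set_def)

lemma simI:
  assumes "C \<in> irreps EK" "C' \<in> irreps EK" "g \<in> G" "l \<in> carrier_vec d\<^sub>2" "conj_cls g C = twist_class l C'"
  shows "(C, C') \<in> sim d\<^sub>1 d\<^sub>2 G K"
  using assms by (auto simp: sim_def)

text \<open>Places a member of \<open>R\<close> in its own class, so that uniqueness can be applied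
  to it together with any related member.\<close>

lemma sim_refl:
  assumes "C \<in> irreps EK" shows "(C, C) \<in> sim d\<^sub>1 d\<^sub>2 G K"
proof -
  obtain \<rho> where \<rho>: "irreducible_rep EK \<rho>" "C = cl \<rho>" using assms by (rule irrepsE)
  note u = irreducible_rep_unitary[OF \<rho>(1)]
  have 1: "\<one>\<^bsub>E\<^esub> \<in> G" using EG.one_closed by simp
  have "conj_cls \<one>\<^bsub>E\<^esub> C = cl \<rho>"
    unfolding \<rho>(2) conj_cl[OF u 1] 
  proof (rule cl_cong[OF u])
    show "conj_by \<one>\<^bsub>E\<^esub> \<rho> x = \<rho> x" if "x \<in> K" for x
      using K.conj_rep_one[of x \<rho>] K_G[OF that] by simp
  qed
  also have "\<dots> = twist_class (0\<^sub>v d\<^sub>2) C"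
    unfolding \<rho>(2) twist_cl[OF u zero_carrier_vec] by (rule cl_cong[OF u, symmetric]) (rule twist_rep_zero)
  finally show ?thesis using simI[OF assms assms 1 zero_carrier_vec] by blast
qed

lemma R_class:
  assumes "C \<in> X"
  shows "\<exists>!x. x \<in> R \<inter> Restr (sim d\<^sub>1 d\<^sub>2 G K) X `` {C}"
proof -
  have "\<forall>c\<in>X // Restr (sim d\<^sub>1 d\<^sub>2 G K) X. \<exists>!x. x \<in> R \<inter> c"
    using R unfolding representation_set_def by (rule conjunct2)
  from bspec[OF this quotientI[OF assms]] show ?thesis .
qed

lemma R_unique:
  assumes "C \<in> R" "C' \<in> R" "(C, C') \<in> sim d\<^sub>1 d\<^sub>2 G K"
  shows "C = C'"
proof -
  have "R \<subseteq> X" using R unfolding representation_set_def by (rule conjunct1)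
  then have X: "C \<in> X" "C' \<in> X" using assms by (auto simp only:)
  from R_class[OF X(1)] obtain x where x: "\<And>y. y \<in> R \<inter> Restr (sim d\<^sub>1 d\<^sub>2 G K) X `` {C} \<Longrightarrow> y = x"
    by (elim ex1E) iprover
  have "(C, C) \<in> sim d\<^sub>1 d\<^sub>2 G K" using sim_refl X(1) by simp
  then have "C = x" using assms(1) X by (intro x) simp
  moreover have "C' = x" using assms X by (intro x) simp
  ultimately show ?thesis by simp
qed

lemma R_exists:
  assumes "C \<in> X"
  obtains C' g l where "C' \<in> R" "g \<in> G" "l \<in> carrier_vec d\<^sub>2" "conj_cls g C = twist_class l C'"
proof -
  from ex1_implies_ex[OF R_class[OF assms]]
  obtain C' where "C' \<in> R \<inter> Restr (sim d\<^sub>1 d\<^sub>2 G K) X `` {C}" ..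
  then have "C' \<in> R" "(C, C') \<in> sim d\<^sub>1 d\<^sub>2 G K" by simp_all
  then show thesis using that by (auto simp: sim_def)
qed

lemma Ind_twist_inj:
  assumes "C \<in> R" "C' \<in> R" "k \<in> carrier_vec d\<^sub>2" "k' \<in> carrier_vec d\<^sub>2"
    and "Ind EG K (twist_class k C) = Ind EG K (twist_class k' C')"
  shows "C = C'"
  using assms Ind_twist_eq_iff[OF R_irreps R_irreps] simI[OF R_irreps R_irreps] R_unique by metis

text \<open>Members of \<open>R\<close> are trivial on \<open>T\<close>^m, hence on
  \<open>T\<close>^N for all N in \<open>M0\<close>, as these N are multiples of m.\<close>

lemma rep_of_R:
  assumes "C \<in> R"
  obtains \<rho> n where "irreducible_rep EK \<rho>" "C = cl \<rho>" "unitary_representation EK n \<rho>" "0 < n"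
    "\<And>N x. N \<in> Ms \<Longrightarrow> x \<in> TP N \<Longrightarrow> \<rho> x = 1\<^sub>m n"
proof -
  have C: "C \<in> irreps EK" "trivial_on (TP m) C" using R assms by (auto simp: representation_set_def)
  obtain \<rho> where \<rho>: "irreducible_rep EK \<rho>" "C = cl \<rho>" using C(1) by (rule irrepsE)
  define n where "n = rep_dim EK \<rho>"
  have r: "unitary_representation EK n \<rho>"
    unfolding n_def using irreducible_rep_unitary[OF \<rho>(1)] by (rule EK.unitary_repE)
  have "\<rho> x = 1\<^sub>m n" if "x \<in> TP m" for x
    using trivial_on_cl[OF r pow_set_K] C(2) \<rho>(2) that by blast
  then have "\<rho> x = 1\<^sub>m n" if "N \<in> Ms" "x \<in> TP N" for N x
    using trivial_pow[OF r, of m] that unfolding M0_eq by blast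
  moreover have "0 < n" using irreducible_rep_dim_pos[OF \<rho>(1)] by (simp add: n_def)
  ultimately show thesis using that \<rho> r by blast
qed

text \<open>Shows that the map lands in the prescribed set: \<chi>_k and the representation are both
  trivial on \<open>T\<close>^N.\<close>

lemma twist_class_trivial:
  assumes C: "C \<in> R" and N: "N \<in> Ms" and k: "k \<in> scaled_dual_lattice d\<^sub>2 S N"
  shows "twist_class k C \<in> irreps EK" "trivial_on (TP N) (twist_class k C)"
proof -
  have N0: "0 < N" using N M0_iff by blast
  have kc: "k \<in> carrier_vec d\<^sub>2" and kN: "\<And>x. x \<in> TP N \<Longrightarrow> k \<bullet> tau x \<in> \<int>"
    using k scaled_dual_lattice_iff[OF N0] by auto
  obtain \<rho> n where \<rho>: "irreducible_rep EK \<rho>" "C = cl \<rho>" "unitary_representation EK n \<rho>" "0 < n"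
    "\<And>N x. N \<in> Ms \<Longrightarrow> x \<in> TP N \<Longrightarrow> \<rho> x = 1\<^sub>m n"
    using C by (rule rep_of_R) blast
  have eq: "twist_class k C = cl (twist_rep k \<rho>)"
    unfolding \<rho>(2) by (rule twist_cl[OF irreducible_rep_unitary[OF \<rho>(1)] kc])
  show "twist_class k C \<in> irreps EK"
    unfolding eq by (rule irrepsI[OF twist_rep_irreducible[OF \<rho>(1) kc]])
  show "trivial_on (TP N) (twist_class k C)"
    unfolding eq trivial_on_cl[OF twist_rep_representation[OF \<rho>(3) kc] pow_set_K]
    using twist_rep_trivial_iff[where \<rho> = \<rho> and k = k, OF \<rho>(4) \<rho>(5)[OF N]] kN by blast
qed

text \<open>The untwisting vector k and the vector l from the choice of a representative are
  uncontrolled; only their combination \<open>l'\<close> matters. It lies in the scaled dual lattice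
  because \<open>\<sigma>\<close> and the representative are both trivial on
  \<open>T\<close>^N.\<close>

lemma Ind_twist_surj:
  assumes C: "C \<in> irreps EK" and N: "N \<in> Ms" and triv: "trivial_on (TP N) C"
  obtains C' k where "C' \<in> R" "k \<in> scaled_dual_lattice d\<^sub>2 S N" "Ind EG K C = Ind EG K (twist_class k C')"
proof -
  have N0: "0 < N" using N M0_iff by blast
  obtain \<sigma> where \<sigma>: "irreducible_rep EK \<sigma>" "C = cl \<sigma>" using C by (rule irrepsE)
  note us = irreducible_rep_unitary[OF \<sigma>(1)]
  define n where "n = rep_dim EK \<sigma>"
  have s: "unitary_representation EK n \<sigma>" unfolding n_def using us by (rule EK.unitary_repE)
  have \<sigma>N: "\<sigma> x = 1\<^sub>m n" if "x \<in> TP N" for x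
    using triv that trivial_on_cl[OF s pow_set_K] \<sigma>(2) by blast
  obtain k where k: "k \<in> carrier_vec d\<^sub>2" "\<And>x. x \<in> TP m \<Longrightarrow> twist_rep k \<sigma> x = 1\<^sub>m n"
    using untwist[OF m_M0 \<sigma>(1)] unfolding n_def by blast
  have "cl (twist_rep k \<sigma>) \<in> X"
    using irrepsI[OF twist_rep_irreducible[OF \<sigma>(1) k(1)]] k(2)
      trivial_on_cl[OF twist_rep_representation[OF s k(1)] pow_set_K] by blast
  then obtain C' g l where C': "C' \<in> R" and g: "g \<in> G" and l: "l \<in> carrier_vec d\<^sub>2"
    and eq: "conj_cls g (cl (twist_rep k \<sigma>)) = twist_class l C'"
    by (rule R_exists)
  obtain \<rho> n' where \<rho>: "irreducible_rep EK \<rho>" "C' = cl \<rho>" "unitary_representation EK n' \<rho>" "0 < n'"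
    "\<And>N x. N \<in> Ms \<Longrightarrow> x \<in> TP N \<Longrightarrow> \<rho> x = 1\<^sub>m n'"
    using C' by (rule rep_of_R) blast
  note ur = irreducible_rep_unitary[OF \<rho>(1)]
  have rk: "rot g *\<^sub>v k \<in> carrier_vec d\<^sub>2" using mult_mat_vec_carrier[OF rot_carrier[OF g] k(1)] .
  \<comment> \<open>Moves the twist of \<sigma> to the other side: conjugation by g turns k into its
    rotation, which is subtracted from l.\<close>
  define l' where "l' = l - rot g *\<^sub>v k"
  have l': "l' \<in> carrier_vec d\<^sub>2" using l rk by (simp add: l'_def)
  have ll: "rot g *\<^sub>v k + l' = l" unfolding l'_def using l rk rot_carrier[OF g] by (intro eq_vecI) auto
  have "(conj_by g (twist_rep k \<sigma>), twist_rep l \<rho>) \<in> rep_rel EK"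
    using eq unfolding \<rho>(2) twist_cl[OF ur l] conj_cl[OF twist_rep_unitary[OF us k(1)] g]
      cl_eq_iff[OF conj_by_unitary[OF twist_rep_unitary[OF us k(1)] g]] .
  then have rel: "(conj_by g \<sigma>, twist_rep l' \<rho>) \<in> rep_rel EK"
    using conj_twist_rel_iff[OF us ur g k(1) l'] ll by simp
  have Ind: "Ind EG K C = Ind EG K (twist_class l' C')"
    unfolding \<sigma>(2) \<rho>(2) twist_cl[OF ur l'] Ind_cl_eq_iff[OF \<sigma>(1) twist_rep_unitary[OF ur l']]
    using rel g by blast
  have gs: "unitary_representation EK n (conj_by g \<sigma>)"
    using K.conj_rep_representation[of n \<sigma> g] s g by simp
  have "trivial_on (TP N) (cl (conj_by g \<sigma>))"
    unfolding trivial_on_cl[OF gs pow_set_K] using conj_by_trivial[where \<rho> = \<sigma>, OF N g \<sigma>N] by blast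
  also have "cl (conj_by g \<sigma>) = cl (twist_rep l' \<rho>)"
    using rel cl_eq_iff[OF conj_by_unitary[OF us g]] by blast
  finally have "\<And>x. x \<in> TP N \<Longrightarrow> twist_rep l' \<rho> x = 1\<^sub>m n'"
    unfolding trivial_on_cl[OF twist_rep_representation[OF \<rho>(3) l'] pow_set_K] by blast
  then have "l' \<bullet> tau x \<in> \<int>" if "x \<in> TP N" for x
    using twist_rep_trivial_iff[where \<rho> = \<rho> and k = l' and x = x, OF \<rho>(4) \<rho>(5)[OF N that]] that
    by blast
  then have "l' \<in> scaled_dual_lattice d\<^sub>2 S N" using scaled_dual_lattice_iff[OF N0] l' by blast
  then show thesis using that C' Ind by blast
qed

text \<open>Common core of both bijections, for any set \<open>Y\<close> of vectors. The image
  hypothesis supplies surjectivity; the description of orbits as fibres supplies the rest.\<close>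

lemma Ind_bijection:
  assumes Y: "Y \<subseteq> carrier_vec d\<^sub>2"
    and img: "(\<lambda>(k, C). Ind EG K (twist_class k C)) ` (Y \<times> R) = I"
  shows "\<exists>f. (\<forall>C\<in>R. \<forall>k\<in>Y.
        f (orbit (G_rho_group d\<^sub>1 d\<^sub>2 G K C) euc_act k, C) = Ind EG K (twist_class k C)) \<and>
      bij_betw f (orbit_union d\<^sub>1 d\<^sub>2 G K R Y) I"
proof -
  let ?I = "\<lambda>k C. Ind EG K (twist_class k C)" and ?O = "\<lambda>k C. orbit (G_rho_group d\<^sub>1 d\<^sub>2 G K C) euc_act k"
  \<comment> \<open>An arbitrary point of the orbit may be chosen, since induction is constant along
    it.\<close>
  define f where "f = (\<lambda>(Q, C). ?I (SOME k. k \<in> Q) C)"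
  have O: "?O k C = {k' \<in> carrier_vec d\<^sub>2. ?I k C = ?I k' C}" if "k \<in> Y" "C \<in> R" for k C
    using orbit_eq[OF R_irreps] that Y by blast
  have f: "f (?O k C, C) = ?I k C" if "k \<in> Y" "C \<in> R" for k C
  proof -
    have "k \<in> ?O k C" using O[OF that] that Y by blast
    then have "(SOME k'. k' \<in> ?O k C) \<in> ?O k C" by (rule someI)
    then show ?thesis unfolding f_def using O[OF that] by auto
  qed
  have U: "orbit_union d\<^sub>1 d\<^sub>2 G K R Y = (\<lambda>(k, C). (?O k C, C)) ` (Y \<times> R)"
    by (auto simp: orbit_union_def orbits_def)
  have "inj_on f (orbit_union d\<^sub>1 d\<^sub>2 G K R Y)"
  proof (rule inj_onI)
    fix a b assume "a \<in> orbit_union d\<^sub>1 d\<^sub>2 G K R Y" "b \<in> orbit_union d\<^sub>1 d\<^sub>2 G K R Y" and eq: "f a = f b"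
    then obtain k C k' C' where a: "k \<in> Y" "C \<in> R" "a = (?O k C, C)" and b: "k' \<in> Y" "C' \<in> R" "b = (?O k' C', C')"
      unfolding U by auto
    have I: "?I k C = ?I k' C'" using eq f a b by simp
    moreover have "C = C'" using Ind_twist_inj[OF a(2) b(2) _ _ I] a b Y by blast
    ultimately show "a = b" using O a b by simp
  qed
  moreover have "f ` orbit_union d\<^sub>1 d\<^sub>2 G K R Y = I"
    unfolding U img[symmetric] image_image using f by (intro image_cong) auto
  ultimately show ?thesis using f by (intro exI[of _ f]) (auto simp: bij_betw_def)
qed

lemma scaled_dual_lattice_carrier: "N \<in> Ms \<Longrightarrow> scaled_dual_lattice d\<^sub>2 S N \<subseteq> carrier_vec d\<^sub>2"
  using scaled_dual_lattice_iff M0_iff by blast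

lemma Ind_image:
  assumes N: "N \<in> Ms"
  shows "(\<lambda>(k, C). Ind EG K (twist_class k C)) ` (scaled_dual_lattice d\<^sub>2 S N \<times> R) =
    Ind EG K ` {C \<in> irreps EK. trivial_on (TP N) C}"
proof (intro subset_antisym subsetI)
  fix c assume "c \<in> (\<lambda>(k, C). Ind EG K (twist_class k C)) ` (scaled_dual_lattice d\<^sub>2 S N \<times> R)"
  then obtain k C where "k \<in> scaled_dual_lattice d\<^sub>2 S N" "C \<in> R" "c = Ind EG K (twist_class k C)" by auto
  then show "c \<in> Ind EG K ` {C \<in> irreps EK. trivial_on (TP N) C}"
    using twist_class_trivial[OF _ N] by blast
next
  fix c assume "c \<in> Ind EG K ` {C \<in> irreps EK. trivial_on (TP N) C}"
  then obtain C where "C \<in> irreps EK" "trivial_on (TP N) C" "c = Ind EG K C" by blast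
  then obtain C' k where "C' \<in> R" "k \<in> scaled_dual_lattice d\<^sub>2 S N" "c = Ind EG K (twist_class k C')"
    using Ind_twist_surj[OF _ N] by metis
  then show "c \<in> (\<lambda>(k, C). Ind EG K (twist_class k C)) ` (scaled_dual_lattice d\<^sub>2 S N \<times> R)" by force
qed

lemma Ind_bijection_level:
  assumes "N \<in> Ms"
  shows "\<exists>f. (\<forall>C\<in>R. \<forall>k\<in>scaled_dual_lattice d\<^sub>2 S N.
        f (orbit (G_rho_group d\<^sub>1 d\<^sub>2 G K C) euc_act k, C) = Ind EG K (twist_class k C)) \<and>
      bij_betw f (orbit_union d\<^sub>1 d\<^sub>2 G K R (scaled_dual_lattice d\<^sub>2 S N))
        (Ind EG K ` {C \<in> irreps EK. trivial_on (TP N) C})"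
  by (rule Ind_bijection[OF scaled_dual_lattice_carrier[OF assms] Ind_image[OF assms]])

text \<open>The index set is the union of the levels L*/N, so the image is the union of the images
  found for each N.\<close>

lemma Ind_bijection_union:
  "\<exists>f. (\<forall>C\<in>R. \<forall>k\<in>dual_lattice d\<^sub>2 S. \<forall>N\<in>Ms.
        f (orbit (G_rho_group d\<^sub>1 d\<^sub>2 G K C) euc_act ((1 / real N) \<cdot>\<^sub>v k), C) =
          Ind EG K (twist_class ((1 / real N) \<cdot>\<^sub>v k) C)) \<and>
      bij_betw f (orbit_union d\<^sub>1 d\<^sub>2 G K R {(1 / real N) \<cdot>\<^sub>v k |k N. k \<in> dual_lattice d\<^sub>2 S \<and> N \<in> Ms})
        (Ind EG K ` {C \<in> irreps EK. \<exists>N\<in>Ms. trivial_on (TP N) C})"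
proof -
  let ?Y = "{(1 / real N) \<cdot>\<^sub>v k |k N. k \<in> dual_lattice d\<^sub>2 S \<and> N \<in> Ms}"
  have Y: "?Y = (\<Union>N\<in>Ms. scaled_dual_lattice d\<^sub>2 S N)" by (auto simp: scaled_dual_lattice_def)
  have "(\<lambda>(k, C). Ind EG K (twist_class k C)) ` (?Y \<times> R) =
      (\<Union>N\<in>Ms. (\<lambda>(k, C). Ind EG K (twist_class k C)) ` (scaled_dual_lattice d\<^sub>2 S N \<times> R))"
    unfolding Y by blast
  also have "\<dots> = (\<Union>N\<in>Ms. Ind EG K ` {C \<in> irreps EK. trivial_on (TP N) C})"
    using Ind_image by simp
  also have "\<dots> = Ind EG K ` {C \<in> irreps EK. \<exists>N\<in>Ms. trivial_on (TP N) C}" by blast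
  finally have img: "(\<lambda>(k, C). Ind EG K (twist_class k C)) ` (?Y \<times> R) =
      Ind EG K ` {C \<in> irreps EK. \<exists>N\<in>Ms. trivial_on (TP N) C}" .
  have "?Y \<subseteq> carrier_vec d\<^sub>2" unfolding Y using scaled_dual_lattice_carrier by blast
  from Ind_bijection[OF this img] obtain f where
    f: "\<forall>C\<in>R. \<forall>k\<in>?Y. f (orbit (G_rho_group d\<^sub>1 d\<^sub>2 G K C) euc_act k, C) = Ind EG K (twist_class k C)"
    and bij: "bij_betw f (orbit_union d\<^sub>1 d\<^sub>2 G K R ?Y) (Ind EG K ` {C \<in> irreps EK. \<exists>N\<in>Ms. trivial_on (TP N) C})"
    by blast
  have "(1 / real N) \<cdot>\<^sub>v k \<in> ?Y" if "k \<in> dual_lattice d\<^sub>2 S" "N \<in> Ms" for k N using that by blast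
  then show ?thesis using f bij by (intro exI[of _ f]) blast
qed

end

theorem theorem4p17:
  fixes d\<^sub>1 d\<^sub>2 m :: nat
    and S G T K :: "isom set"
    and E\<^sub>G E\<^sub>K :: "isom monoid"
    and R :: "(isom \<Rightarrow> complex mat) set set"
  assumes "d\<^sub>1 + d\<^sub>2 \<ge> 1"
    and "space_group d\<^sub>2 S"
    and "discrete_subgroup (d\<^sub>1 + d\<^sub>2) G"
    and "G \<subseteq> osum_set d\<^sub>1 S"
    and "proj d\<^sub>1 d\<^sub>2 ` G = S"
    and "T \<subseteq> G"
    and "bij_betw (proj d\<^sub>1 d\<^sub>2) T (trans_subgroup d\<^sub>2 S)"
    and K: "K = TF d\<^sub>1 d\<^sub>2 G T"
    and E\<^sub>G: "E\<^sub>G = Euc (d\<^sub>1 + d\<^sub>2)\<lparr>carrier := G\<rparr>"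
    and E\<^sub>K: "E\<^sub>K = Euc (d\<^sub>1 + d\<^sub>2)\<lparr>carrier := K\<rparr>"
    and "m \<ge> 1"
    and "M0 (d\<^sub>1 + d\<^sub>2) G T = {m * n |n. n \<ge> 1}"
    and "representation_set R
           {\<rho> \<in> irreps E\<^sub>K. trivial_on (pow_set (d\<^sub>1 + d\<^sub>2) T m) \<rho>} (sim d\<^sub>1 d\<^sub>2 G K)"
  shows
    "(\<exists>f. (\<forall>\<rho>\<in>R. \<forall>k\<in>dual_lattice d\<^sub>2 S. \<forall>N\<in>M0 (d\<^sub>1 + d\<^sub>2) G T.
             f (orbit (G_rho_group d\<^sub>1 d\<^sub>2 G K \<rho>) euc_act ((1 / real N) \<cdot>\<^sub>v k), \<rho>)
               = Ind E\<^sub>G K (twist d\<^sub>1 d\<^sub>2 K ((1 / real N) \<cdot>\<^sub>v k) \<rho>)) \<and>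
          bij_betw f
            (orbit_union d\<^sub>1 d\<^sub>2 G K R
               {(1 / real N) \<cdot>\<^sub>v k |k N. k \<in> dual_lattice d\<^sub>2 S \<and> N \<in> M0 (d\<^sub>1 + d\<^sub>2) G T})
            (Ind E\<^sub>G K ` {\<rho> \<in> irreps E\<^sub>K.
               \<exists>N\<in>M0 (d\<^sub>1 + d\<^sub>2) G T. trivial_on (pow_set (d\<^sub>1 + d\<^sub>2) T N) \<rho>})) \<and>
     (\<forall>N\<in>M0 (d\<^sub>1 + d\<^sub>2) G T.
        \<exists>f. (\<forall>\<rho>\<in>R. \<forall>k\<in>scaled_dual_lattice d\<^sub>2 S N.
               f (orbit (G_rho_group d\<^sub>1 d\<^sub>2 G K \<rho>) euc_act k, \<rho>)
                 = Ind E\<^sub>G K (twist d\<^sub>1 d\<^sub>2 K k \<rho>)) \<and>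
            bij_betw f
              (orbit_union d\<^sub>1 d\<^sub>2 G K R (scaled_dual_lattice d\<^sub>2 S N))
              (Ind E\<^sub>G K ` {\<rho> \<in> irreps E\<^sub>K. trivial_on (pow_set (d\<^sub>1 + d\<^sub>2) T N) \<rho>}))"
proof -
  interpret osum_space_group d\<^sub>2 S d\<^sub>1 G T
    by (intro osum_space_group.intro osum_space_group_axioms.intro space_group_lattice.intro)
       (use assms in \<open>simp_all add: discrete_subgroup_def\<close>)
  interpret representation_set_osum d\<^sub>2 S d\<^sub>1 G T m R
    by (intro representation_set_osum.intro representation_set_osum_axioms.intro osum_space_group_axioms)
       (use assms in simp_all)
  show ?thesis
    unfolding E\<^sub>G E\<^sub>K K using Ind_bijection_union Ind_bijection_level by (intro conjI ballI)
qed

end
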